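(* Let $n\ge2$. For every $p\ge1$ and every oriented cell $w$ of the Stasheff associahedron $K_{p+1}$, $$(dY)(w)=(\delta Y)(w),$$ that is, $d(Y(w))=Y(\partial w)$. In other words, $Y_p\in C^{*,*}_{(p)}=C^*(K_{p+1};(\Omega^*(\Theta_n)\otimes H^*\otimes H^{\otimes(p+1)})^{\mathrm{Aut}(F_n)})$ is a $p$-cocycle.
   Context: **Magnus expansions.** $F_n$ is a free group of rank $n$, $H=H_1(F_n;\mathbb{R})$, $H^*$ its dual, $\widehat{T}=\prod_{m\ge0}H^{\otimes m}$, $\widehat{T}_p=\prod_{m\ge p}H^{\otimes m}$. $\Theta_n$ is the set of real Magnus expansions: group homomorphisms $\theta:F_n\to1+\widehat{T}_1$ with $\theta(\gamma)\equiv1+[\gamma]\bmod\widehat{T}_2$. $\mathrm{IA}(\widehat{T})$ is the group of $\mathbb{R}$-algebra automorphisms $V$ of $\widehat T$ with $V(\widehat{T}_p)=\widehat{T}_p$ for all $p\ge1$ inducing the identity on $\widehat{T}_1/\widehat{T}_2=H$; it acts freely and transitively on $\Theta_n$ by $\theta\mapsto V\circ\theta$, making $\Theta_n$ a (projective limit of) $C^\infty$ manifold(s). Its Lie algebra (derivations $u$ of $\widehat T$ with $u(\widehat{T}_1)\subset\widehat{T}_2$) is identified by restriction to $H$ with $\mathrm{Hom}(H,\widehat{T}_2)=\prod_{p\ge1}H^*\otimes H^{\otimes(p+1)}$. The Maurer-Cartan form $\eta=\sum_{p\ge1}\eta_p$, $\eta_p\in\Omega^1(\Theta_n)\otimes H^*\otimes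 H^{\otimes(p+1)}$, is defined by $\eta(\frac{d}{dt}|_{t=0}\exp(tu)\circ\theta)=u$. $\mathrm{Aut}(F_n)$ acts on $\Theta_n$ by $\theta\mapsto|\varphi|\circ\theta\circ\varphi^{-1}$, $|\varphi|$ the induced action on $H$; the $\eta_p$ are $\mathrm{Aut}(F_n)$-invariant. **Associahedron.** $K_{p+1}$ is the Stasheff associahedron, a $(p-1)$-dimensional cell complex whose cells correspond to meaningful insertions of parentheses into the word $12\cdots p+1$ (outermost pair included; the top cell is $(12\cdots p+1)$). $\deg w$ is the number of pairs of parentheses, so $\dim w=p-\deg w$. For $a,b\ge0$, $p'\ge1$ the face map $\partial_{a,p',b}:K_{a+b+1}\times K_{p'+1}\to K_{a+b+p'+1}$ replaces the $(a+1)$-st letter by a parenthesized word in $p'+1$ letters. $K_{p+1}$ is regarded, following Stasheff, as a subpolyhedron of $I^{p-1}$ with the standard orientation; $K_2$ is the point with sign $+$ and $$\partial K_{p+1}=\sum_{k,s}(-1)^{(s+1)(p+k)+k+1}\partial_{k,s,p-k-s}(K_{p-s+1}\times K_{s+1})\qquad(1\le s\le p-1,\ 0\le k\le p-s).$$ Every oriented cell other than $\pm K_{p+1}$ has the form $\partial_{a,p',b}(w\times K_{p'+1})$ for some oriented cell $w$ of $K_{a+b+1}$, $a+b+p'=p$ (choose an innermost pair of parentheses). **$Y$.** Define inductively on $\deg$, for oriented cells, $Y(\pm K_{p+1})=\pm\eta_p$ and $$Y(\partial_{a,p',b}(w\times K_{p'+1}))=(-1)^{a+(p'+1)b+\deg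 w}(1^{\otimes a}\otimes\eta_{p'}\otimes1^{\otimes b})Y(w),$$ where homomorphisms are composed ($Y(w)$ is a form of degree $\deg w$ with values in $\mathrm{Hom}(H,H^{\otimes(a+b+1)})$) and forms are wedged in the order written; this does not depend on the choice of innermost pair. $Y_p$ is the restriction of $Y$ to oriented cells of $K_{p+1}$, a $p$-cochain of the double complex $C^{*,*}_{(p)}$ (on an $i$-cell its value is a $(p-i)$-form). $(dY)(w)=d(Y(w))$ with $d$ the exterior derivative, $(\delta Y)(w)=Y(\partial w)$ with $\delta$ the cellular coboundary; being a cocycle means precisely $dY=\delta Y$. *)

theory Defs
  imports "HOL-Analysis.Analysis" "HOL-Algebra.Bij" "HOL-Algebra.Free_Abelian_Groups"
begin

section \<open>The completed tensor algebra\<close>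

text \<open>
  The rank \<open>n\<close> is \<open>CARD('n)\<close>, and \<open>H\<close> is \<open>real ^ 'n\<close> with standard basis indexed by \<open>'n\<close>.
  An element of the completed tensor algebra of \<open>H\<close> is the family of its coefficients with respect to
  the monomials in the basis vectors; \<open>H\<^sup>\<otimes>\<^sup>m\<close> consists of the elements supported on words of length \<open>m\<close>.
\<close>

typedef 'n tens = "UNIV :: ('n list \<Rightarrow> real) set"
  morphisms coeff Tens ..

lemma coeff_Tens [simp]: "coeff (Tens f) = f"
  by (simp add: Tens_inverse)

lemma tens_eqI: "(\<And>w. coeff f w = coeff g w) \<Longrightarrow> f = g"
  by (metis coeff_inverse ext)

instantiation tens :: (type) real_algebra_1
begin

definition zero_tens :: "'a tens" where "0 = Tens (\<lambda>w. 0)"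
definition one_tens :: "'a tens" where "1 = Tens (\<lambda>w. if w = [] then 1 else 0)"
definition plus_tens :: "'a tens \<Rightarrow> 'a tens \<Rightarrow> 'a tens"
  where "f + g = Tens (\<lambda>w. coeff f w + coeff g w)"
definition uminus_tens :: "'a tens \<Rightarrow> 'a tens" where "- f = Tens (\<lambda>w. - coeff f w)"
definition minus_tens :: "'a tens \<Rightarrow> 'a tens \<Rightarrow> 'a tens"
  where "f - g = Tens (\<lambda>w. coeff f w - coeff g w)"
definition scaleR_tens :: "real \<Rightarrow> 'a tens \<Rightarrow> 'a tens"
  where "c *\<^sub>R f = Tens (\<lambda>w. c * coeff f w)"
definition times_tens :: "'a tens \<Rightarrow> 'a tens \<Rightarrow> 'a tens"
  where "f * g = Tens (\<lambda>w. \<Sum>k\<le>length w. coeff f (take k w) * coeff g (drop k w))"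

instance
proof
  fix f g h :: "'a tens" and c d :: real
  show "f * g * h = f * (g * h)"
  proof (rule tens_eqI)
    fix w :: "'a list"
    let ?n = "length w"
    let ?t = "\<lambda>k j. coeff f (take k w) * coeff g (take j (drop k w)) * coeff h (drop (k + j) w)"
    have "coeff (f * g * h) w =
        (\<Sum>m\<le>?n. \<Sum>k\<le>m. coeff f (take k w) * coeff g (take (m - k) (drop k w)) * coeff h (drop m w))"
      by (auto simp: times_tens_def sum_distrib_right min_def drop_take intro!: sum.cong)
    also have "\<dots> = (\<Sum>m\<le>?n. \<Sum>k\<le>m. ?t k (m - k))"
      by (intro sum.cong) auto
    also have "\<dots> = (\<Sum>(k, j) | k + j \<le> ?n. ?t k j)"
      by (rule sum.triangle_reindex_eq [symmetric])
    also have "\<dots> = (\<Sum>(k, j)\<in>(SIGMA k:{..?n}. {..?n - k}). ?t k j)"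
      by (rule sum.cong) auto
    also have "\<dots> = (\<Sum>k\<le>?n. \<Sum>j\<le>?n - k. ?t k j)"
      by (simp add: sum.Sigma)
    also have "\<dots> = coeff (f * (g * h)) w"
      by (auto simp: times_tens_def sum_distrib_left mult.assoc add.commute intro!: sum.cong)
    finally show "coeff (f * g * h) w = coeff (f * (g * h)) w" .
  qed
  show "1 * f = f"
  proof (rule tens_eqI)
    fix w :: "'a list"
    have "coeff (1 * f) w = (\<Sum>k\<le>length w. if k = 0 then coeff f w else 0)"
      unfolding times_tens_def one_tens_def coeff_Tens by (rule sum.cong) auto
    then show "coeff (1 * f) w = coeff f w" by simp
  qed
  show "f * 1 = f"
  proof (rule tens_eqI)
    fix w :: "'a list"
    have "coeff (f * 1) w = (\<Sum>k\<le>length w. if k = length w then coeff f w else 0)"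
      unfolding times_tens_def one_tens_def coeff_Tens by (rule sum.cong) auto
    then show "coeff (f * 1) w = coeff f w" by simp
  qed
  show "(0 :: 'a tens) \<noteq> 1"
    by (auto simp: zero_tens_def one_tens_def Tens_inject fun_eq_iff)
qed (auto intro!: tens_eqI simp: zero_tens_def plus_tens_def uminus_tens_def minus_tens_def
      scaleR_tens_def times_tens_def algebra_simps sum.distrib sum_distrib_left)

end

definition monomial :: "'n list \<Rightarrow> 'n tens"
  where "monomial w = Tens (\<lambda>v. if v = w then 1 else 0)"

definition tens_ge :: "nat \<Rightarrow> 'n tens set"
  where "tens_ge p = {f. \<forall>w. length w < p \<longrightarrow> coeff f w = 0}"

definition tens_part :: "nat \<Rightarrow> 'n tens \<Rightarrow> 'n tens"
  where "tens_part m f = Tens (\<lambda>w. if length w = m then coeff f w else 0)"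

definition of_H :: "real ^ 'n::finite \<Rightarrow> 'n tens"
  where "of_H h = (\<Sum>i\<in>UNIV. (h $ i) *\<^sub>R monomial [i])"

text \<open>
  A linear map \<open>u\<close> from \<open>H\<close> to the completed tensor algebra is given by its values on the
  basis vectors: \<open>u $ i\<close> is the value at the \<open>i\<close>-th one.
\<close>

type_synonym 'n homs = "('n tens, 'n) vec"

definition Hom_deg :: "nat \<Rightarrow> ('n::finite) homs set"
  where "Hom_deg m = {u. \<forall>i. tens_part m (u $ i) = u $ i}"

text \<open>
  Composition of \<open>z : H \<rightarrow> H\<^sup>\<otimes>\<^sup>(\<^sup>a\<^sup>+\<^sup>b\<^sup>+\<^sup>1\<^sup>)\<close> with \<open>1\<^sup>\<otimes>\<^sup>a \<otimes> u \<otimes> 1\<^sup>\<otimes>\<^sup>b\<close>.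
\<close>

definition insert_hom :: "nat \<Rightarrow> ('n::finite) homs \<Rightarrow> nat \<Rightarrow> 'n homs \<Rightarrow> 'n homs"
  where "insert_hom a u b z = (\<chi> j. \<Sum>x | length x = a. \<Sum>i\<in>UNIV. \<Sum>y | length y = b.
           coeff (z $ j) (x @ [i] @ y) *\<^sub>R (monomial x * u $ i * monomial y))"


section \<open>Magnus expansions\<close>

text \<open>
  The free group on \<open>'n\<close> as the group of reduced words; the letter \<open>(i, True)\<close> is the \<open>i\<close>-th
  generator and \<open>(i, False)\<close> its inverse.
\<close>

type_synonym 'n fword = "('n \<times> bool) list"

fun push :: "'n \<times> bool \<Rightarrow> 'n fword \<Rightarrow> 'n fword" where
  "push x [] = [x]"
| "push x (y # w) = (if fst y = fst x \<and> snd y \<noteq> snd x then w else x # y # w)"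

definition reduce :: "'n fword \<Rightarrow> 'n fword"
  where "reduce w = foldr push w []"

definition free_grp :: "'n fword monoid"
  where "free_grp = \<lparr>carrier = {w. reduce w = w}, mult = (\<lambda>u v. reduce (u @ v)), one = []\<rparr>"

abbreviation gen :: "'n \<Rightarrow> 'n fword"
  where "gen i \<equiv> [(i, True)]"

definition H_class :: "'n fword \<Rightarrow> real ^ 'n::finite"
  where "H_class w = (\<chi> i. \<Sum>(j, e)\<leftarrow>w. if j = i then (if e then 1 else - 1) else 0)"

definition one_plus_tens :: "'n tens monoid"
  where "one_plus_tens = \<lparr>carrier = {f. f - 1 \<in> tens_ge 1}, mult = (*), one = 1\<rparr>"

type_synonym 'n point = "'n fword \<Rightarrow> 'n tens"

definition Theta :: "('n::finite) point set"
  where "Theta = {\<theta> \<in> hom free_grp one_plus_tens \<inter> extensional (carrier free_grp).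
           \<forall>g\<in>carrier free_grp. \<theta> g - (1 + of_H (H_class g)) \<in> tens_ge 2}"


section \<open>Calculus on the space of Magnus expansions\<close>

text \<open>
  The map sending \<open>\<theta>\<close> to the family of the \<open>\<theta> (gen i)\<close> is a bijection of \<open>Theta\<close> onto an
  affine space whose direction space is \<open>TTheta\<close>, and a global chart for the (projective limit)
  manifold structure given by the simply transitive action of the filtered algebra automorphisms. Tangent vectors are written
  in this chart.
\<close>

definition TTheta :: "('n::finite) homs set"
  where "TTheta = {v. \<forall>i. v $ i \<in> tens_ge 2}"

definition displace :: "('n::finite) point \<Rightarrow> 'n homs \<Rightarrow> 'n point"
  where "displace \<theta> v = (THE \<theta>'. \<theta>' \<in> Theta \<and> (\<forall>i. \<theta>' (gen i) = \<theta> (gen i) + v $ i))"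

definition velocity :: "(real \<Rightarrow> ('n::finite) point) \<Rightarrow> 'n homs \<Rightarrow> bool"
  where "velocity c v \<longleftrightarrow> (\<forall>i w. ((\<lambda>t. coeff (c t (gen i)) w) has_real_derivative coeff (v $ i) w) (at 0))"

definition dir_deriv :: "('n::finite) homs \<Rightarrow> ('n point \<Rightarrow> real) \<Rightarrow> 'n point \<Rightarrow> real"
  where "dir_deriv v f \<theta> = deriv (\<lambda>t. f (displace \<theta> (t *\<^sub>R v))) 0"

definition Theta_topology :: "('n::finite) point topology"
  where "Theta_topology = pullback_topology Theta (\<lambda>\<theta> i w. coeff (\<theta> (gen i)) w) euclidean"

definition smooth_fun :: "(('n::finite) point \<Rightarrow> real) \<Rightarrow> bool"
  where "smooth_fun f \<longleftrightarrow> (\<forall>vs. set vs \<subseteq> TTheta \<longrightarrow>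
           continuous_map Theta_topology euclideanreal (foldr dir_deriv vs f) \<and>
           (\<forall>\<theta>\<in>Theta. \<forall>v\<in>TTheta.
              (\<lambda>t. foldr dir_deriv vs f (displace \<theta> (t *\<^sub>R v))) differentiable at 0))"

text \<open>
  A \<open>k\<close>-form takes a point and a list of \<open>k\<close> tangent vectors. Forms are zero outside their
  domain, so that equality of forms is equality of functions. On a projective limit of
  manifolds, a form is one that comes from a finite stage.
\<close>

type_synonym 'n form = "'n point \<Rightarrow> 'n homs list \<Rightarrow> 'n homs"

definition forms :: "nat \<Rightarrow> nat \<Rightarrow> ('n::finite) form set"
  where "forms k m = {\<omega>.
    (\<forall>\<theta> vs. \<not> (\<theta> \<in> Theta \<and> length vs = k \<and> set vs \<subseteq> TTheta) \<longrightarrow> \<omega> \<theta> vs = 0) \<and>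
    (\<forall>\<theta> vs. \<omega> \<theta> vs \<in> Hom_deg m) \<and>
    (\<forall>\<theta>\<in>Theta. \<forall>vs. length vs = k \<and> set vs \<subseteq> TTheta \<longrightarrow>
       (\<forall>i<k. \<forall>x\<in>TTheta. \<forall>y\<in>TTheta. \<forall>c d.
          \<omega> \<theta> (vs[i := c *\<^sub>R x + d *\<^sub>R y]) = c *\<^sub>R \<omega> \<theta> (vs[i := x]) + d *\<^sub>R \<omega> \<theta> (vs[i := y])) \<and>
       (\<forall>i<k. \<forall>j<k. i \<noteq> j \<and> vs ! i = vs ! j \<longrightarrow> \<omega> \<theta> vs = 0)) \<and>
    (\<forall>vs. length vs = k \<and> set vs \<subseteq> TTheta \<longrightarrow>
       (\<forall>i w. smooth_fun (\<lambda>\<theta>. coeff (\<omega> \<theta> vs $ i) w))) \<and>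
    (\<exists>N. \<forall>\<theta>\<in>Theta. \<forall>\<theta>'\<in>Theta. \<forall>vs vs'. length vs = k \<and> length vs' = k \<and>
       set vs \<subseteq> TTheta \<and> set vs' \<subseteq> TTheta \<and>
       (\<forall>i. \<theta> (gen i) - \<theta>' (gen i) \<in> tens_ge N) \<and>
       (\<forall>j<k. \<forall>i. vs ! j $ i - vs' ! j $ i \<in> tens_ge N) \<longrightarrow> \<omega> \<theta> vs = \<omega> \<theta>' vs')}"

definition omit :: "nat \<Rightarrow> 'a list \<Rightarrow> 'a list"
  where "omit i xs = take i xs @ drop (Suc i) xs"

text \<open>
  The vectors \<open>vs\<close> extend to constant, hence commuting, vector fields in the affine chart, so no
  bracket terms occur.
\<close>

definition ext_deriv :: "('n::finite) form \<Rightarrow> 'n form"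
  where "ext_deriv \<omega> = (\<lambda>\<theta> vs. if \<theta> \<in> Theta \<and> set vs \<subseteq> TTheta then
           (\<Sum>i<length vs. (- 1) ^ i *\<^sub>R
              (\<chi> j. Tens (\<lambda>w. dir_deriv (vs ! i) (\<lambda>\<theta>'. coeff (\<omega> \<theta>' (omit i vs) $ j) w) \<theta>)))
         else 0)"

text \<open>
  The product \<open>(1\<^sup>\<otimes>\<^sup>a \<otimes> \<alpha> \<otimes> 1\<^sup>\<otimes>\<^sup>b) \<beta>\<close> for a 1-form \<open>\<alpha>\<close>: the wedge product (sum over shuffles, without
  factorials) combined with composition of the values.
\<close>

definition wedge_insert :: "nat \<Rightarrow> ('n::finite) form \<Rightarrow> nat \<Rightarrow> 'n form \<Rightarrow> 'n form"
  where "wedge_insert a \<alpha> b \<beta> = (\<lambda>\<theta> vs. \<Sum>i<length vs.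
           (- 1) ^ i *\<^sub>R insert_hom a (\<alpha> \<theta> [vs ! i]) b (\<beta> \<theta> (omit i vs)))"


section \<open>The Maurer-Cartan form\<close>

definition derivations :: "('n tens \<Rightarrow> 'n tens) set"
  where "derivations = {D. linear D \<and> (\<forall>f g. D (f * g) = D f * g + f * D g) \<and>
           D ` tens_ge 1 \<subseteq> tens_ge 2}"

definition restrict_H :: "(('n::finite) tens \<Rightarrow> 'n tens) \<Rightarrow> 'n homs"
  where "restrict_H D = (\<chi> i. D (monomial [i]))"

text \<open>
  Derivations in \<open>derivations\<close> raise the filtration degree, so each coefficient of the exponential
  series is a finite sum.
\<close>

definition exp_op :: "('n tens \<Rightarrow> 'n tens) \<Rightarrow> 'n tens \<Rightarrow> 'n tens"
  where "exp_op D f = Tens (\<lambda>w. suminf (\<lambda>k. coeff ((D ^^ k) f) w / fact k))"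

definition maurer_cartan :: "('n::finite) point \<Rightarrow> 'n homs \<Rightarrow> 'n homs"
  where "maurer_cartan \<theta> v = (THE u. \<exists>D\<in>derivations. u = restrict_H D \<and>
           velocity (\<lambda>t. \<lambda>g\<in>carrier free_grp. exp_op (\<lambda>f. t *\<^sub>R D f) (\<theta> g)) v)"

definition eta :: "nat \<Rightarrow> ('n::finite) form"
  where "eta p = (\<lambda>\<theta> vs. if \<theta> \<in> Theta \<and> length vs = 1 \<and> set vs \<subseteq> TTheta
           then \<chi> i. tens_part (p + 1) (maurer_cartan \<theta> (hd vs) $ i) else 0)"


section \<open>Invariant forms\<close>

text \<open>The matrix of the induced action on \<open>H\<close>, and its diagonal extension to tensors.\<close>

definition H_matrix :: "('n fword \<Rightarrow> 'n fword) \<Rightarrow> real ^ 'n ^ 'n::finite"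
  where "H_matrix \<phi> = (\<chi> i j. H_class (\<phi> (gen j)) $ i)"

definition tens_map :: "real ^ 'n ^ 'n \<Rightarrow> ('n::finite) tens \<Rightarrow> 'n tens"
  where "tens_map M f = Tens (\<lambda>w. \<Sum>x | length x = length w.
           (\<Prod>i<length w. M $ (w ! i) $ (x ! i)) * coeff f x)"

definition hom_act :: "real ^ 'n ^ 'n \<Rightarrow> ('n::finite) homs \<Rightarrow> 'n homs"
  where "hom_act M u = (\<chi> j. \<Sum>i\<in>UNIV. (matrix_inv M $ i $ j) *\<^sub>R tens_map M (u $ i))"

definition Theta_act :: "('n fword \<Rightarrow> 'n fword) \<Rightarrow> ('n::finite) point \<Rightarrow> 'n point"
  where "Theta_act \<phi> \<theta> =
    (\<lambda>g\<in>carrier free_grp. tens_map (H_matrix \<phi>) (\<theta> (inv_into (carrier free_grp) \<phi> g)))"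

definition Theta_act_deriv ::
    "('n fword \<Rightarrow> 'n fword) \<Rightarrow> ('n::finite) point \<Rightarrow> 'n homs \<Rightarrow> 'n homs"
  where "Theta_act_deriv \<phi> \<theta> v =
    (THE v'. velocity (\<lambda>t. Theta_act \<phi> (displace \<theta> (t *\<^sub>R v))) v')"

definition inv_forms :: "nat \<Rightarrow> nat \<Rightarrow> ('n::finite) form set"
  where "inv_forms k m = {\<omega> \<in> forms k m. \<forall>\<phi>\<in>auto free_grp. \<forall>\<theta>\<in>Theta.
           \<forall>vs. length vs = k \<and> set vs \<subseteq> TTheta \<longrightarrow>
             \<omega> (Theta_act \<phi> \<theta>) (map (Theta_act_deriv \<phi> \<theta>) vs) = hom_act (H_matrix \<phi>) (\<omega> \<theta> vs)}"


section \<open>Cells of the associahedra\<close>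

text \<open>
  A parenthesized word is a planar tree: the letters are the leaves, read from left to right,
  and the pairs of parentheses are the nodes.
\<close>

datatype ptree = Leaf | Node "ptree list"

primrec leaves :: "ptree \<Rightarrow> nat" where
  "leaves Leaf = 1"
| "leaves (Node ts) = sum_list (map leaves ts)"

primrec pdeg :: "ptree \<Rightarrow> nat" where
  "pdeg Leaf = 0"
| "pdeg (Node ts) = Suc (sum_list (map pdeg ts))"

primrec proper :: "ptree \<Rightarrow> bool" where
  "proper Leaf \<longleftrightarrow> True"
| "proper (Node ts) \<longleftrightarrow> 2 \<le> length ts \<and> list_all proper ts"

definition pdim :: "ptree \<Rightarrow> nat"
  where "pdim t = leaves t - 1 - pdeg t"

definition corolla :: "nat \<Rightarrow> ptree"
  where "corolla p = Node (replicate (p + 1) Leaf)"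

text \<open>
  An oriented cell is a pair of a sign and a tree. The cell of \<open>Node [t\<^sub>1, \<dots>, t\<^sub>m]\<close> is the product
  \<open>K\<^sub>m \<times> t\<^sub>1 \<times> \<dots> \<times> t\<^sub>m\<close>, a leaf contributing a point, and the sign \<open>1\<close> stands for its product
  orientation. Unravelled, the factors \<open>K\<close> are taken in the depth-first order of the nodes.
\<close>

type_synonym ocell = "int \<times> ptree"

definition ocells :: "nat \<Rightarrow> ocell set"
  where "ocells p = {(e, t). e \<in> {1, - 1} \<and> proper t \<and> leaves t = p + 1}"

text \<open>The tree part of the face map: replace leaf number \<open>a\<close> (counted from \<open>0\<close>) by \<open>corolla q\<close>.\<close>

fun graft :: "nat \<Rightarrow> nat \<Rightarrow> ptree \<Rightarrow> ptree"
  and graft_list :: "nat \<Rightarrow> nat \<Rightarrow> ptree list \<Rightarrow> ptree list" where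
  "graft a q Leaf = corolla q"
| "graft a q (Node ts) = Node (graft_list a q ts)"
| "graft_list a q [] = []"
| "graft_list a q (t # ts) =
     (if a < leaves t then graft a q t # ts else t # graft_list (a - leaves t) q ts)"

text \<open>The total dimension of the factors that come after leaf number \<open>a\<close> in depth-first order.\<close>

fun dim_after :: "nat \<Rightarrow> ptree \<Rightarrow> nat"
  and dim_after_list :: "nat \<Rightarrow> ptree list \<Rightarrow> nat" where
  "dim_after a Leaf = 0"
| "dim_after a (Node ts) = dim_after_list a ts"
| "dim_after_list a [] = 0"
| "dim_after_list a (t # ts) =
     (if a < leaves t then dim_after a t + sum_list (map pdim ts)
      else dim_after_list (a - leaves t) ts)"

text \<open>
  \<open>face a q w\<close> is \<open>w \<times> K\<^sub>q\<^sub>+\<^sub>1\<close> with its product orientation; the sign comes from moving the last factor,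
  of dimension \<open>q - 1\<close>, to its place in the depth-first order.
\<close>

definition face :: "nat \<Rightarrow> nat \<Rightarrow> ocell \<Rightarrow> ocell"
  where "face a q w = (case w of (e, t) \<Rightarrow> (e * (- 1) ^ ((q - 1) * dim_after a t), graft a q t))"

text \<open>
  The boundary of the positively oriented cell of a tree, by the Leibniz rule for
  \<open>K\<^sub>m \<times> t\<^sub>1 \<times> \<dots> \<times> t\<^sub>m\<close> with \<open>m = p + 1\<close>. In the part coming from the boundary of \<open>K\<^sub>m\<close>, the factor
  \<open>K\<^sub>s\<^sub>+\<^sub>1\<close> has to be moved past \<open>t\<^sub>1 \<times> \<dots> \<times> t\<^sub>k\<close>.
\<close>

fun bdry :: "ptree \<Rightarrow> ptree \<Rightarrow>\<^sub>0 int"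
  and bdry_list :: "ptree list \<Rightarrow> ptree list \<Rightarrow>\<^sub>0 int" where
  "bdry Leaf = 0"
| "bdry (Node ts) = (let p = length ts - 1 in
     (\<Sum>s=1..p-1. \<Sum>k=0..p-s.
        frag_cmul ((- 1) ^ ((s + 1) * (p + k) + k + 1) * (- 1) ^ ((s - 1) * sum_list (map pdim (take k ts))))
          (frag_of (Node (take k ts @ Node (take (s + 1) (drop k ts)) # drop (k + s + 1) ts)))) +
     frag_cmul ((- 1) ^ (p - 1)) (frag_extend (\<lambda>us. frag_of (Node us)) (bdry_list ts)))"
| "bdry_list [] = 0"
| "bdry_list (t # ts) =
     frag_extend (\<lambda>u. frag_of (u # ts)) (bdry t) +
     frag_cmul ((- 1) ^ pdim t) (frag_extend (\<lambda>us. frag_of (t # us)) (bdry_list ts))"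

definition obdry :: "ocell \<Rightarrow> ptree \<Rightarrow>\<^sub>0 int"
  where "obdry w = frag_cmul (fst w) (bdry (snd w))"


section \<open>The cochain\<close>

text \<open>All possible values of \<open>Y\<close>, over all choices of innermost pairs of parentheses.\<close>

inductive Y_value :: "ocell \<Rightarrow> ('n::finite) form \<Rightarrow> bool" where
  top: "Y_value (e, corolla p) (\<lambda>\<theta> vs. of_int e *\<^sub>R eta p \<theta> vs)"
    if "1 \<le> p" "e \<in> {1, - 1}"
| face: "Y_value (face a q w)
      (\<lambda>\<theta> vs. (- 1) ^ (a + (q + 1) * b + pdeg (snd w)) *\<^sub>R wedge_insert a (eta q) b y \<theta> vs)"
    if "Y_value w y" "w \<in> ocells (a + b)" "1 \<le> a + b" "1 \<le> q"

definition Y :: "ocell \<Rightarrow> ('n::finite) form"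
  where "Y w = (THE y. Y_value w y)"

definition coboundary :: "(ocell \<Rightarrow> ('n::finite) form) \<Rightarrow> ocell \<Rightarrow> 'n form"
  where "coboundary c w = (\<lambda>\<theta> vs. \<Sum>t\<in>Poly_Mapping.keys (obdry w).
           of_int (Poly_Mapping.lookup (obdry w) t) *\<^sub>R c (1, t) \<theta> vs)"

text \<open>
  The cochains of total degree \<open>k\<close> in the double complex of \<open>K\<^sub>p\<^sub>+\<^sub>1\<close>: an \<open>i\<close>-cell is sent to an
  invariant \<open>(k - i)\<close>-form.
\<close>

definition total_cochains :: "nat \<Rightarrow> nat \<Rightarrow> (ocell \<Rightarrow> ('n::finite) form) set"
  where "total_cochains p k = {c. \<forall>(e, t)\<in>ocells p.
           c (- e, t) = (\<lambda>\<theta> vs. - c (e, t) \<theta> vs) \<and>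
           (if pdim t \<le> k then c (e, t) \<in> inv_forms (k - pdim t) (p + 1)
            else c (e, t) = (\<lambda>\<theta> vs. 0))}"

end

theory Submission
  imports Defs
begin

text \<open>
  The value of \<open>\<eta>\<close> on a tangent vector \<open>v\<close> at \<open>\<theta>\<close> is the derivation \<open>D\<close> with \<open>D (\<theta> x) = v x\<close> for the
  generators \<open>x\<close>; differentiating this equation gives the Maurer-Cartan equation
  \<open>d \<eta>\<^sub>p = \<Sum> (1\<^sup>\<otimes>\<^sup>k \<otimes> \<eta>\<^sub>s \<otimes> 1\<^sup>\<otimes>\<^sup>b) \<eta>\<^sub>p\<^sub>-\<^sub>s\<close> with \<open>k + s + b = p\<close>, which is the cocycle condition on the top cell.
  Insertions of two \<open>\<eta>\<close>'s at different letters anticommute, and this matches the sign by which the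
  corresponding factors of a product cell are exchanged; hence \<open>Y\<close> is the product of the \<open>\<eta>\<close>'s in
  depth-first order, whatever innermost pairs are chosen. For an arbitrary cell, both sides satisfy
  the Leibniz rule with respect to grafting a corolla onto a tree, so the claim follows by induction
  on the number of nodes.
\<close>

section \<open>Insertions and derivations\<close>

text \<open>No analysis in infinite dimensions is involved: on \<open>Theta\<close>, each
  coefficient of each form in play is a polynomial in finitely many coefficients of the
  \<open>\<theta> (gen i)\<close>, so smoothness and the rules of differentiation come from closure
  properties. Identities between tensors are obtained modulo \<open>tens_ge p\<close> for every
  \<open>p\<close>. The obstacle is the signs: \<open>face\<close> puts the new factor last, an
  oriented tree carries the depth-first orientation, and \<open>Y\<close> is a definite description
  over all ways of building a tree. It helps to admit the bare leaf as a cell, with the identity of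
  H as its constant 0-form: a corolla is then a graft onto a leaf, and a single grafting step has to
  be analysed, for the form, for the orientation and for the boundary. The boundary part is pure
  combinatorics, proved for an arbitrary function \<open>\<Phi>\<close> on trees; forms enter only
  when \<open>\<Phi>\<close> is specialized. Membership in the double complex also asks for
  invariance, and since an automorphism makes \<open>\<theta>\<close> act on inverse images of
  generators, the infinitesimal equation has to be extended to all group elements.\<close>

lemma coeff_zero [simp]: "coeff 0 w = 0"
  by (simp add: zero_tens_def)

lemma coeff_one: "coeff 1 w = (if w = [] then 1 else 0)"
  by (simp add: one_tens_def)

lemma coeff_add [simp]: "coeff (f + g) w = coeff f w + coeff g w"
  by (simp add: plus_tens_def)

lemma coeff_uminus [simp]: "coeff (- f) w = - coeff f w"
  by (simp add: uminus_tens_def)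

lemma coeff_diff [simp]: "coeff (f - g) w = coeff f w - coeff g w"
  by (simp add: minus_tens_def)

lemma coeff_scaleR [simp]: "coeff (c *\<^sub>R f) w = c * coeff f w"
  by (simp add: scaleR_tens_def)

lemma coeff_sum: "coeff (sum f A) w = (\<Sum>x\<in>A. coeff (f x) w)"
  by (induction A rule: infinite_finite_induct) auto

lemma coeff_mult: "coeff (f * g) w = (\<Sum>k\<le>length w. coeff f (take k w) * coeff g (drop k w))"
  by (simp add: times_tens_def)

lemma coeff_monomial: "coeff (monomial x) w = (if w = x then 1 else 0)"
  by (simp add: monomial_def)

lemma coeff_tens_part: "coeff (tens_part m f) w = (if length w = m then coeff f w else 0)"
  by (simp add: tens_part_def)

lemma coeff_monomial_mult:
  "coeff (monomial x * f) w = (if take (length x) w = x then coeff f (drop (length x) w) else 0)"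
proof -
  have "coeff (monomial x * f) w =
      (\<Sum>k\<le>length w. if k = length x then (if take (length x) w = x then coeff f (drop (length x) w) else 0) else 0)"
    unfolding coeff_mult coeff_monomial by (rule sum.cong) auto
  also have "\<dots> = (if take (length x) w = x then coeff f (drop (length x) w) else 0)"
    by (auto simp: sum.delta)
  finally show ?thesis .
qed

lemma coeff_mult_monomial:
  "coeff (f * monomial y) w = (if length y \<le> length w \<and> drop (length w - length y) w = y
     then coeff f (take (length w - length y) w) else 0)"
proof -
  have "coeff (f * monomial y) w =
      (\<Sum>k\<le>length w. if k = length w - length y then (if length y \<le> length w \<and> drop (length w - length y) w = y
     then coeff f (take (length w - length y) w) else 0) else 0)"
    unfolding coeff_mult coeff_monomial by (rule sum.cong) auto
  also have "\<dots> = (if length y \<le> length w \<and> drop (length w - length y) w = y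
     then coeff f (take (length w - length y) w) else 0)"
    by (auto simp: sum.delta)
  finally show ?thesis .
qed

lemma finite_lists_length_eq' [simp]: "finite {x :: 'n::finite list. length x = a}"
  using finite_lists_length_eq [of "UNIV :: 'n set" a] by simp

text \<open>The operator with \<open>a\<close> identities to the left of \<open>u\<close> and
  \<open>b\<close> to the right, applied to one tensor and read off by coefficients: prefix,
  inserted block, suffix. Unlike in \<open>insert_hom\<close>, no sum over monomials occurs. The
  test \<open>a + b \<le> length w\<close> prevents prefix and suffix from overlapping.\<close>

definition ins :: "nat \<Rightarrow> ('n::finite) homs \<Rightarrow> nat \<Rightarrow> 'n tens \<Rightarrow> 'n tens"
  where "ins a u b f = Tens (\<lambda>w. if a + b \<le> length w
    then \<Sum>i\<in>UNIV. coeff f (take a w @ [i] @ drop (length w - b) w) *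
      coeff (u $ i) (drop a (take (length w - b) w)) else 0)"

lemma coeff_ins: "coeff (ins a u b f) w = (if a + b \<le> length w
    then \<Sum>i\<in>UNIV. coeff f (take a w @ [i] @ drop (length w - b) w) *
      coeff (u $ i) (drop a (take (length w - b) w)) else 0)"
  by (simp add: ins_def)

text \<open>\<open>monomial x * u $ i * monomial y\<close> meets the coefficient of \<open>w\<close>
  only if \<open>x\<close> and \<open>y\<close> are the prefix and the suffix of \<open>w\<close>,
  so the two sums over monomials collapse and only the sum over the replaced letter is left.\<close>

lemma insert_hom_nth: "insert_hom a u b z $ j = ins a u b (z $ j)"
proof (rule tens_eqI)
  fix w :: "'a list"
  let ?X = "{x :: 'a list. length x = a}" and ?Y = "{y :: 'a list. length y = b}"
  let ?x0 = "take a w" and ?y0 = "drop (length w - b) w" and ?m = "drop a (take (length w - b) w)"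
  have one: "coeff (monomial x * u $ i * monomial y) w =
      (if a + b \<le> length w \<and> x = ?x0 \<and> y = ?y0 then coeff (u $ i) ?m else 0)"
    if "length x = a" "length y = b" for x y i
    using that by (cases "a + b \<le> length w") (auto simp: coeff_mult_monomial coeff_monomial_mult)
  have "coeff (insert_hom a u b z $ j) w = (\<Sum>x\<in>?X. \<Sum>i\<in>UNIV. \<Sum>y\<in>?Y.
      coeff (z $ j) (x @ [i] @ y) * (if a + b \<le> length w \<and> x = ?x0 \<and> y = ?y0 then coeff (u $ i) ?m else 0))"
    unfolding insert_hom_def by (simp add: coeff_sum one)
  also have "\<dots> = (\<Sum>x\<in>?X. \<Sum>i\<in>UNIV. \<Sum>y\<in>?Y. if y = ?y0 then
      (if a + b \<le> length w \<and> x = ?x0 then coeff (z $ j) (?x0 @ [i] @ ?y0) * coeff (u $ i) ?m else 0) else 0)"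
    by (intro sum.cong) auto
  also have "\<dots> = (\<Sum>x\<in>?X. if x = ?x0 then
      (if a + b \<le> length w then \<Sum>i\<in>UNIV. coeff (z $ j) (?x0 @ [i] @ ?y0) * coeff (u $ i) ?m else 0) else 0)"
    by (intro sum.cong) (auto intro!: sum.neutral)
  also have "\<dots> = coeff (ins a u b (z $ j)) w"
    by (simp add: coeff_ins)
  finally show "coeff (insert_hom a u b z $ j) w = coeff (ins a u b (z $ j)) w" .
qed

lemma insert_hom_add_left: "insert_hom a (u + u') b z = insert_hom a u b z + insert_hom a u' b z"
  by (simp add: vec_eq_iff insert_hom_nth)
    (auto intro!: tens_eqI simp: coeff_ins sum.distrib algebra_simps)

lemma insert_hom_add_right: "insert_hom a u b (z + z') = insert_hom a u b z + insert_hom a u b z'"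
  by (simp add: vec_eq_iff insert_hom_nth)
    (auto intro!: tens_eqI simp: coeff_ins sum.distrib algebra_simps)

lemma insert_hom_scaleR_left: "insert_hom a (c *\<^sub>R u) b z = c *\<^sub>R insert_hom a u b z"
  by (simp add: vec_eq_iff insert_hom_nth)
    (auto intro!: tens_eqI simp: coeff_ins sum_distrib_left algebra_simps)

lemma insert_hom_scaleR_right: "insert_hom a u b (c *\<^sub>R z) = c *\<^sub>R insert_hom a u b z"
  by (simp add: vec_eq_iff insert_hom_nth)
    (auto intro!: tens_eqI simp: coeff_ins sum_distrib_left algebra_simps)

lemma linear_insert_hom_left: "linear (\<lambda>u :: ('n::finite) homs. insert_hom a u b z)"
  by (rule linearI) (auto simp: insert_hom_add_left insert_hom_scaleR_left)

lemma linear_insert_hom_right: "linear (insert_hom a (u :: ('n::finite) homs) b)"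
  by (rule linearI) (auto simp: insert_hom_add_right insert_hom_scaleR_right)

lemma insert_hom_zero_left [simp]: "insert_hom a 0 b z = 0"
  using linear_0 [OF linear_insert_hom_left] .

lemma insert_hom_zero_right [simp]: "insert_hom a u b 0 = 0"
  using linear_0 [OF linear_insert_hom_right] .

lemmas insert_hom_sum_left = linear_sum [OF linear_insert_hom_left, unfolded o_def]
lemmas insert_hom_sum_right = linear_sum [OF linear_insert_hom_right, unfolded o_def]
lemmas insert_hom_diff_left = linear_diff [OF linear_insert_hom_left]

lemma Hom_deg_iff: "(u :: ('n::finite) homs) \<in> Hom_deg m \<longleftrightarrow> (\<forall>i w. length w \<noteq> m \<longrightarrow> coeff (u $ i) w = 0)"
proof
  assume u: "u \<in> Hom_deg m"
  show "\<forall>i w. length w \<noteq> m \<longrightarrow> coeff (u $ i) w = 0"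
  proof (intro allI impI)
    fix i and w :: "'n list" assume "length w \<noteq> m"
    moreover have "coeff (u $ i) w = coeff (tens_part m (u $ i)) w"
      using u by (simp add: Hom_deg_def)
    ultimately show "coeff (u $ i) w = 0"
      by (simp add: coeff_tens_part)
  qed
qed (auto simp: Hom_deg_def coeff_tens_part intro!: tens_eqI)

lemma Hom_deg_zero [simp]: "0 \<in> Hom_deg m"
  by (simp add: Hom_deg_iff)

lemma Hom_deg_add: "u \<in> Hom_deg m \<Longrightarrow> v \<in> Hom_deg m \<Longrightarrow> u + v \<in> Hom_deg m"
  by (simp add: Hom_deg_iff)

lemma Hom_deg_scaleR: "u \<in> Hom_deg m \<Longrightarrow> c *\<^sub>R u \<in> Hom_deg m"
  by (simp add: Hom_deg_iff)

lemma Hom_deg_sum: "(\<And>x. x \<in> A \<Longrightarrow> f x \<in> Hom_deg m) \<Longrightarrow> sum f A \<in> Hom_deg m"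
  by (induction A rule: infinite_finite_induct) (auto intro: Hom_deg_add)

lemma Hom_deg_insert_hom:
  assumes "u \<in> Hom_deg (q + 1)" "z \<in> Hom_deg (a + b + 1)"
  shows "insert_hom a u b z \<in> Hom_deg (a + q + b + 1)"
  using assms by (auto simp: Hom_deg_iff insert_hom_nth coeff_ins intro!: sum.neutral)

lemma coeff_ins_append:
  "coeff (ins (length x) u (length y) f) (x @ m @ y) =
    (\<Sum>i\<in>UNIV. coeff f (x @ [i] @ y) * coeff (u $ i) m)"
  by (simp add: coeff_ins)

lemma split_list3:
  assumes "a + b \<le> length w"
  obtains x m y where "w = x @ m @ y" "length x = a" "length y = b"
proof
  have "take a w = take a (take (length w - b) w)"
    using assms by (simp add: min_absorb1)
  then show "w = take a w @ drop a (take (length w - b) w) @ drop (length w - b) w"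
    by (metis append_assoc append_take_drop_id)
qed (use assms in auto)

text \<open>Associativity of operadic composition: letter \<open>k\<close> of the block that
  \<open>z\<close> produces at position \<open>a\<close> is letter \<open>a + k\<close> of the whole
  word. In coefficients this is an exchange of the sums over the two replaced letters.\<close>

lemma insert_hom_nest:
  assumes "z \<in> Hom_deg (k + c + 1)"
  shows "insert_hom (a + k) u (c + b) (insert_hom a z b y) = insert_hom a (insert_hom k u c z) b y"
proof -
  have "coeff (ins (a + k) u (c + b) (ins a z b f)) w = coeff (ins a (insert_hom k u c z) b f) w" for f w
  proof (cases "(a + k) + (c + b) \<le> length w")
    case True
    then obtain x' m y' where 1: "w = x' @ m @ y'" "length x' = a + k" "length y' = c + b"
      by (rule split_list3)
    obtain x0 x1 where x: "x' = x0 @ x1" "length x0 = a" "length x1 = k"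
      using 1 by (metis append_take_drop_id add_diff_cancel_left' le_add1 length_drop length_take min.absorb2)
    obtain y1 y0 where y: "y' = y1 @ y0" "length y1 = c" "length y0 = b"
      using 1 by (metis append_take_drop_id add_diff_cancel_left' le_add1 length_drop length_take min.absorb2)
    have "coeff (ins (a + k) u (c + b) (ins a z b f)) w =
      (\<Sum>i\<in>UNIV. coeff (ins a z b f) (x0 @ (x1 @ [i] @ y1) @ y0) * coeff (u $ i) m)"
      using coeff_ins_append [of "x0 @ x1" u "y1 @ y0" "ins a z b f" m] x y 1 by simp
    also have "\<dots> = (\<Sum>i\<in>UNIV. \<Sum>j\<in>UNIV. coeff f (x0 @ [j] @ y0) * coeff (z $ j) (x1 @ [i] @ y1) * coeff (u $ i) m)"
      using coeff_ins_append [of x0 z y0 f "x1 @ [i] @ y1" for i] x y by (simp add: sum_distrib_right)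
    also have "\<dots> = (\<Sum>j\<in>UNIV. coeff f (x0 @ [j] @ y0) * (\<Sum>i\<in>UNIV. coeff (z $ j) (x1 @ [i] @ y1) * coeff (u $ i) m))"
      by (subst sum.swap) (simp add: sum_distrib_left mult.assoc)
    also have "\<dots> = (\<Sum>j\<in>UNIV. coeff f (x0 @ [j] @ y0) * coeff (insert_hom k u c z $ j) (x1 @ m @ y1))"
      using coeff_ins_append [of x1 u y1 _ m] x y by (simp add: insert_hom_nth)
    also have "\<dots> = coeff (ins a (insert_hom k u c z) b f) w"
      using coeff_ins_append [of x0 "insert_hom k u c z" y0 f "x1 @ m @ y1"] x y 1 by simp
    finally show ?thesis .
  next
    case False
    then show ?thesis
      by (auto simp: coeff_ins insert_hom_nth intro!: sum.neutral)
  qed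
  then show ?thesis
    by (auto simp: vec_eq_iff insert_hom_nth intro!: tens_eqI)
qed

text \<open>Replacements at two different letters commute; \<open>m\<close> is the number of letters
  between them. An insertion of \<open>u1\<close> on the left moves the other letter by
  \<open>q1\<close>, which is where the degrees enter.\<close>

lemma insert_hom_commute:
  assumes u1: "u1 \<in> Hom_deg (q1 + 1)" and u2: "u2 \<in> Hom_deg (q2 + 1)"
  shows "insert_hom (a + q1 + 1 + m) u2 b (insert_hom a u1 (m + 1 + b) z) =
    insert_hom a u1 (m + q2 + 1 + b) (insert_hom (a + 1 + m) u2 b z)"
proof -
  have "coeff (ins (a + q1 + 1 + m) u2 b (ins a u1 (m + 1 + b) f)) w =
    coeff (ins a u1 (m + q2 + 1 + b) (ins (a + 1 + m) u2 b f)) w" for f w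
  \<comment> \<open>The only length at which the sides can be nonzero: five blocks, of which the
    second and the fourth come from \<open>u1\<close> and \<open>u2\<close>. At any other length,
    the block left for \<open>u2\<close> on one side and the block left for \<open>u1\<close> on the
    other have the wrong degree.\<close>
  proof (cases "length w = a + (q1 + 1) + m + (q2 + 1) + b")
    case True
    define x where "x = take a w"
    define s where "s = take (q1 + 1) (drop a w)"
    define t where "t = take m (drop (a + (q1 + 1)) w)"
    define r where "r = take (q2 + 1) (drop (a + (q1 + 1) + m) w)"
    define y where "y = drop (a + (q1 + 1) + m + (q2 + 1)) w"
    have w: "w = x @ s @ t @ r @ y"
      unfolding x_def s_def t_def r_def y_def
      by (metis append_take_drop_id drop_drop add.commute)
    have l: "length x = a" "length s = q1 + 1" "length t = m" "length r = q2 + 1" "length y = b"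
      using True unfolding x_def s_def t_def r_def y_def by simp_all
    have L: "coeff (ins (a + q1 + 1 + m) u2 b (ins a u1 (m + 1 + b) f)) w =
      (\<Sum>j\<in>UNIV. (\<Sum>i\<in>UNIV. coeff f (x @ [i] @ t @ [j] @ y) * coeff (u1 $ i) s) * coeff (u2 $ j) r)"
      using coeff_ins_append [of "x @ s @ t" u2 y _ r] coeff_ins_append [of x u1 "t @ [j] @ y" f s for j]
      by (simp add: w l algebra_simps)
    have R: "coeff (ins a u1 (m + q2 + 1 + b) (ins (a + 1 + m) u2 b f)) w =
      (\<Sum>i\<in>UNIV. (\<Sum>j\<in>UNIV. coeff f (x @ [i] @ t @ [j] @ y) * coeff (u2 $ j) r) * coeff (u1 $ i) s)"
      using coeff_ins_append [of x u1 "t @ r @ y" _ s] coeff_ins_append [of "x @ [i] @ t" u2 y f r for i]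
      by (simp add: w l algebra_simps)
    show ?thesis
      unfolding L R sum_distrib_right by (subst sum.swap) (simp add: algebra_simps)
  next
    case False
    have "coeff (u2 $ i) (drop (a + q1 + 1 + m) (take (length w - b) w)) = 0"
      if "a + q1 + 1 + m + b \<le> length w" for i
      using u2 False that by (auto simp: Hom_deg_iff)
    then have L: "coeff (ins (a + q1 + 1 + m) u2 b (ins a u1 (m + 1 + b) f)) w = 0"
      by (simp only: coeff_ins) simp
    have "coeff (u1 $ i) (drop a (take (length w - (m + q2 + 1 + b)) w)) = 0"
      if "a + (m + q2 + 1 + b) \<le> length w" for i
      using u1 False that by (auto simp: Hom_deg_iff)
    then have R: "coeff (ins a u1 (m + q2 + 1 + b) (ins (a + 1 + m) u2 b f)) w = 0"
      by (simp only: coeff_ins) simp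
    show ?thesis unfolding L R ..
  qed
  then show ?thesis
    by (auto simp: vec_eq_iff insert_hom_nth intro!: tens_eqI)
qed

section \<open>The degree filtration\<close>

lemma tens_ge_mono: "f \<in> tens_ge q \<Longrightarrow> p \<le> q \<Longrightarrow> f \<in> tens_ge p"
  by (auto simp: tens_ge_def)

lemma tens_ge_zero [simp]: "0 \<in> tens_ge p"
  by (simp add: tens_ge_def)

lemma tens_ge_0 [simp]: "f \<in> tens_ge 0"
  by (simp add: tens_ge_def)

lemma tens_ge_add: "f \<in> tens_ge p \<Longrightarrow> g \<in> tens_ge p \<Longrightarrow> f + g \<in> tens_ge p"
  by (simp add: tens_ge_def)

lemma tens_ge_diff: "f \<in> tens_ge p \<Longrightarrow> g \<in> tens_ge p \<Longrightarrow> f - g \<in> tens_ge p"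
  by (simp add: tens_ge_def)

lemma tens_ge_uminus: "f \<in> tens_ge p \<Longrightarrow> - f \<in> tens_ge p"
  by (simp add: tens_ge_def)

lemma tens_ge_scaleR: "f \<in> tens_ge p \<Longrightarrow> c *\<^sub>R f \<in> tens_ge p"
  by (simp add: tens_ge_def)

lemma tens_ge_sum: "(\<And>x. x \<in> A \<Longrightarrow> f x \<in> tens_ge p) \<Longrightarrow> sum f A \<in> tens_ge p"
  by (simp add: tens_ge_def coeff_sum)

lemma tens_ge_mult:
  assumes "f \<in> tens_ge p" "g \<in> tens_ge q"
  shows "f * g \<in> tens_ge (p + q)"
  unfolding tens_ge_def mem_Collect_eq coeff_mult
proof (intro allI impI sum.neutral ballI)
  fix w :: "'a list" and k assume "length w < p + q" "k \<in> {..length w}"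
  then have "length (take k w) < p \<or> length (drop k w) < q"
    by auto
  then show "coeff f (take k w) * coeff g (drop k w) = 0"
    using assms unfolding tens_ge_def by auto
qed

text \<open>The filtration is separated. This replaces convergence arguments, since an identity can
  be checked modulo every \<open>tens_ge p\<close>.\<close>

lemma eq_if_diff_tens_ge:
  assumes "\<And>p. f - g \<in> tens_ge p"
  shows "f = g"
proof (rule tens_eqI)
  fix w show "coeff f w = coeff g w"
    using assms [of "Suc (length w)"] by (simp add: tens_ge_def)
qed

lemma monomial_tens_ge: "p \<le> length w \<Longrightarrow> monomial w \<in> tens_ge p"
  by (auto simp: tens_ge_def coeff_monomial)

text \<open>Left division by a basis vector. By \<open>coeff_mult_Cons\<close> a product recurses
  along the first letter through \<open>lquot\<close>, which allows inductions on words in place of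
  manipulations of convolution sums.\<close>

definition lquot :: "'n \<Rightarrow> 'n tens \<Rightarrow> 'n tens"
  where "lquot i f = Tens (\<lambda>w. coeff f (i # w))"

lemma coeff_lquot [simp]: "coeff (lquot i f) w = coeff f (i # w)"
  by (simp add: lquot_def)

lemma coeff_mult_Cons:
  "coeff (f * g) (i # w) = coeff f [] * coeff g (i # w) + coeff (lquot i f * g) w"
  by (simp add: coeff_mult sum.atMost_Suc_shift del: sum.atMost_Suc)

lemma lquot_mult: "lquot i (f * g) = lquot i f * g + coeff f [] *\<^sub>R lquot i g"
  by (rule tens_eqI) (simp add: coeff_mult_Cons)

text \<open>The derivation of the completed tensor algebra that extends \<open>u\<close>: the sum of
  all ways to replace one letter. At a given word only finitely many pairs \<open>a\<close>,
  \<open>b\<close> contribute, so the infinite sum raises no question of convergence.\<close>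

definition der :: "('n::finite) homs \<Rightarrow> 'n tens \<Rightarrow> 'n tens"
  where "der u f = Tens (\<lambda>w. \<Sum>a\<le>length w. \<Sum>b\<le>length w - a. coeff (ins a u b f) w)"

lemma coeff_der: "coeff (der u f) w = (\<Sum>a\<le>length w. \<Sum>b\<le>length w - a. coeff (ins a u b f) w)"
  by (simp add: der_def)

lemma coeff_ins_linear:
  "coeff (ins a (u + v) b f) w = coeff (ins a u b f) w + coeff (ins a v b f) w"
  "coeff (ins a (c *\<^sub>R u) b f) w = c * coeff (ins a u b f) w"
  "coeff (ins a u b (f + g)) w = coeff (ins a u b f) w + coeff (ins a u b g) w"
  "coeff (ins a u b (c *\<^sub>R f)) w = c * coeff (ins a u b f) w"
  by (simp_all add: coeff_ins sum.distrib sum_distrib_left algebra_simps)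

lemma der_add_left: "der (u + v) f = der u f + der v f"
  by (rule tens_eqI) (simp add: coeff_der coeff_ins_linear sum.distrib)

lemma der_scaleR_left: "der (c *\<^sub>R u) f = c *\<^sub>R der u f"
  by (rule tens_eqI) (simp add: coeff_der coeff_ins_linear sum_distrib_left)

lemma der_add: "der u (f + g) = der u f + der u g"
  by (rule tens_eqI) (simp add: coeff_der coeff_ins_linear sum.distrib)

lemma der_scaleR: "der u (c *\<^sub>R f) = c *\<^sub>R der u f"
  by (rule tens_eqI) (simp add: coeff_der coeff_ins_linear sum_distrib_left)

lemma linear_der: "linear (der u)"
  by (rule linearI) (auto simp: der_add der_scaleR)

lemma linear_der_left: "linear (\<lambda>u. der u f)"
  by (rule linearI) (auto simp: der_add_left der_scaleR_left)

lemmas der_zero [simp] = linear_0 [OF linear_der]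
lemmas der_diff = linear_diff [OF linear_der]
lemmas der_zero_left [simp] = linear_0 [OF linear_der_left]
lemmas der_diff_left = linear_diff [OF linear_der_left]

text \<open>These are the terms in which the leading letter is replaced. With
  \<open>k = length w - b\<close> as the length of the inserted block, the sum over \<open>b\<close>
  is a convolution product.\<close>

lemma sum_ins_0:
  "(\<Sum>b\<le>length w. coeff (ins 0 u b f) w) = coeff (\<Sum>i\<in>UNIV. u $ i * lquot i f) w"
proof -
  have "(\<Sum>b\<le>length w. coeff (ins 0 u b f) w) =
      (\<Sum>k\<le>length w. \<Sum>i\<in>UNIV. coeff (u $ i) (take k w) * coeff (lquot i f) (drop k w))"
    by (rule sum.reindex_bij_witness [of _ "\<lambda>k. length w - k" "\<lambda>k. length w - k"])
      (auto simp: coeff_ins algebra_simps)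
  also have "\<dots> = coeff (\<Sum>i\<in>UNIV. u $ i * lquot i f) w"
    unfolding coeff_sum coeff_mult by (rule sum.swap)
  finally show ?thesis .
qed

lemma coeff_der_Nil: "coeff (der u f) [] = coeff (\<Sum>i\<in>UNIV. u $ i * lquot i f) []"
  using sum_ins_0 [where w = "[]"] by (simp add: coeff_der)

text \<open>Either the leading letter of the argument is replaced, which gives the first summand, or
  \<open>j\<close> survives and the replacement happens behind it.\<close>

lemma coeff_der_Cons:
  "coeff (der u f) (j # w) = coeff (\<Sum>i\<in>UNIV. u $ i * lquot i f) (j # w) + coeff (der u (lquot j f)) w"
proof -
  have "coeff (ins (Suc a) u b f) (j # w) = coeff (ins a u b (lquot j f)) w" if "b \<le> length w - a" "a \<le> length w" for a b
    using that by (simp add: coeff_ins Suc_diff_le)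
  then have "coeff (der u f) (j # w) = (\<Sum>b\<le>length (j # w). coeff (ins 0 u b f) (j # w)) + coeff (der u (lquot j f)) w"
    by (simp add: coeff_der sum.atMost_Suc_shift [of _ "length w"] del: sum.atMost_Suc)
  then show ?thesis
    unfolding sum_ins_0 .
qed

lemma lquot_der: "lquot j (der u f) = (\<Sum>i\<in>UNIV. lquot j (u $ i * lquot i f)) + der u (lquot j f)"
  by (rule tens_eqI) (simp add: coeff_der_Cons coeff_sum)

text \<open>Induction on the word, for all \<open>f\<close> and \<open>g\<close> at once, because
  peeling off the first letter replaces \<open>f\<close> by \<open>lquot j f\<close>. The terms that
  come from replacing the leading letter match by associativity of the product.\<close>

lemma der_mult: "der u (f * g) = der u f * g + f * der u g"
proof (rule tens_eqI)
  fix w show "coeff (der u (f * g)) w = coeff (der u f * g + f * der u g) w"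
  proof (induction w arbitrary: f g)
    case Nil
    show ?case
      by (simp add: coeff_der_Nil coeff_sum lquot_mult algebra_simps sum_distrib_left sum.distrib coeff_mult)
  next
    case (Cons j w)
    have 1: "coeff (u $ i * (lquot i f * g)) (j # w) =
      coeff (u $ i * lquot i f) [] * coeff g (j # w) + coeff (lquot j (u $ i * lquot i f) * g) w" for i
      by (metis coeff_mult_Cons mult.assoc)
    have "coeff (der u (f * g)) (j # w) = (\<Sum>i\<in>UNIV. coeff (u $ i * (lquot i f * g)) (j # w)) +
       coeff f [] * (\<Sum>i\<in>UNIV. coeff (u $ i * lquot i g) (j # w)) +
       coeff (der u (lquot j f) * g + lquot j f * der u g) w + coeff f [] * coeff (der u (lquot j g)) w"
      unfolding coeff_der_Cons lquot_mult der_add coeff_add der_scaleR Cons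
      by (simp add: coeff_sum lquot_mult algebra_simps sum.distrib sum_distrib_left)
    moreover have "coeff (der u f * g) (j # w) = (\<Sum>i\<in>UNIV. coeff (u $ i * (lquot i f * g)) (j # w)) +
       coeff (der u (lquot j f) * g) w"
      unfolding coeff_mult_Cons [of "der u f" g] 1 lquot_der coeff_der_Nil
      by (simp add: coeff_sum sum.distrib sum_distrib_right distrib_right)
    moreover have "coeff (f * der u g) (j # w) =
       coeff f [] * (\<Sum>i\<in>UNIV. coeff (u $ i * lquot i g) (j # w)) +
       coeff (lquot j f * der u g) w + coeff f [] * coeff (der u (lquot j g)) w"
      unfolding coeff_mult_Cons [of f "der u g"] coeff_der_Cons
      by (simp add: coeff_sum algebra_simps)
    ultimately show ?case by simp
  qed
qed

lemma der_one [simp]: "der u 1 = 0"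
  using der_mult [of u 1 1] by simp

lemma der_tens_ge:
  assumes u: "\<And>i. u $ i \<in> tens_ge (m + 1)" and f: "f \<in> tens_ge p"
  shows "der u f \<in> tens_ge (p + m)"
  unfolding tens_ge_def mem_Collect_eq coeff_der
proof (intro allI impI sum.neutral ballI)
  fix w :: "'a list" and a b
  assume w: "length w < p + m" "a \<in> {..length w}" "b \<in> {..length w - a}"
  have "coeff f (take a w @ [i] @ drop (length w - b) w) *
    coeff (u $ i) (drop a (take (length w - b) w)) = 0" for i
  proof (cases "a + b + 1 < p")
    case True
    then have "length (take a w @ [i] @ drop (length w - b) w) < p"
      using w by simp
    then show ?thesis using f unfolding tens_ge_def by auto
  next
    case False
    then have "length (drop a (take (length w - b) w)) < m + 1"
      using w by simp
    then show ?thesis using u [of i] unfolding tens_ge_def by auto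
  qed
  then show "coeff (ins a u b f) w = 0"
    by (simp only: coeff_ins sum.neutral_const if_cancel)
qed

lemma der_monomial [simp]: "der u (monomial [i]) = u $ i"
proof -
  have l: "lquot j (monomial [i]) = (if i = j then 1 else 0)" for j :: 'a
    by (rule tens_eqI) (auto simp: coeff_monomial coeff_one)
  have "coeff (der u (monomial [i])) w = coeff (u $ i) w" for w
  proof (cases w)
    case Nil
    then show ?thesis
      by (simp add: coeff_der_Nil l if_distrib if_distribR cong: if_cong)
  next
    case (Cons j v)
    then show ?thesis
      by (simp add: coeff_der_Cons l if_distrib if_distribR cong: if_cong)
  qed
  then show ?thesis by (rule tens_eqI)
qed

lemma restrict_der [simp]: "restrict_H (der u) = u"
  by (simp add: restrict_H_def vec_eq_iff)

lemma der_in_derivations: "u \<in> TTheta \<Longrightarrow> der u \<in> derivations"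
  using der_tens_ge [of u 1 _ 1]
  by (auto simp: derivations_def linear_der der_mult TTheta_def numeral_2_eq_2)

lemma tens_decompose: "f = coeff f [] *\<^sub>R 1 + (\<Sum>i\<in>UNIV. monomial [i] * lquot i (f :: ('n::finite) tens))"
proof (rule tens_eqI)
  fix w :: "'n list"
  show "coeff f w = coeff (coeff f [] *\<^sub>R 1 + (\<Sum>i\<in>UNIV. monomial [i] * lquot i f)) w"
    by (cases w) (auto simp: coeff_sum coeff_one coeff_monomial_mult if_distrib cong: if_cong)
qed

text \<open>The coefficients of \<open>f\<close> are peeled off one letter at a time; what remains is divisible
  by arbitrarily long monomials, which is why no continuity of \<open>D\<close> has to be assumed.\<close>

lemma derivation_eq_der:
  fixes D :: "('n::finite) tens \<Rightarrow> 'n tens"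
  assumes D: "D \<in> derivations"
  shows "D = der (restrict_H D)" and "restrict_H D \<in> TTheta"
proof -
  define u where "u = restrict_H D"
  have lin: "linear D" and mult: "\<And>f g. D (f * g) = D f * g + f * D g"
    and ge: "\<And>f. f \<in> tens_ge 1 \<Longrightarrow> D f \<in> tens_ge 2"
    using D by (auto simp: derivations_def)
  show T: "restrict_H D \<in> TTheta"
    by (auto simp: restrict_H_def TTheta_def intro!: ge monomial_tens_ge)
  have one: "D 1 = 0"
    using mult [of 1 1] by simp
  have eq: "D f - der u f = (\<Sum>i\<in>UNIV. monomial [i] * (D (lquot i f) - der u (lquot i f)))" for f
  proof -
    have "D (monomial [i]) = u $ i" for i
      by (simp add: u_def restrict_H_def)
    moreover have "D f = D (coeff f [] *\<^sub>R 1 + (\<Sum>i\<in>UNIV. monomial [i] * lquot i f))"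
      using tens_decompose [of f] by simp
    moreover have "der u f = der u (coeff f [] *\<^sub>R 1 + (\<Sum>i\<in>UNIV. monomial [i] * lquot i f))"
      using tens_decompose [of f] by simp
    ultimately show ?thesis
      by (simp add: linear_add [OF lin] linear_cmul [OF lin] linear_sum [OF lin] one mult
          der_add der_scaleR linear_sum [OF linear_der] der_mult sum.distrib right_diff_distrib sum_subtractf)
  qed
  have "D f - der u f \<in> tens_ge p" for f p
  proof (induction p arbitrary: f)
    case (Suc p)
    have "monomial [i] * (D (lquot i f) - der u (lquot i f)) \<in> tens_ge (1 + p)" for i
      by (intro tens_ge_mult Suc) (simp add: monomial_tens_ge)
    then show ?case
      by (subst eq) (auto intro: tens_ge_sum)
  qed simp
  then show "D = der (restrict_H D)"
    unfolding u_def by (auto intro: eq_if_diff_tens_ge)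
qed

section \<open>Magnus expansions and their values on generators\<close>

lemma push_cancel_iff:
  "push x (y # w) = (if y = (fst x, \<not> snd x) then w else x # y # w)"
  by (cases x; cases y) auto

text \<open>A local description of the fixed points of \<open>reduce\<close>, by which the carrier
  of the group is defined. It passes to tails, so that values on the group can be computed by
  induction on words.\<close>

fun reduced :: "'n fword \<Rightarrow> bool" where
  "reduced [] \<longleftrightarrow> True"
| "reduced [x] \<longleftrightarrow> True"
| "reduced (x # y # w) \<longleftrightarrow> y \<noteq> (fst x, \<not> snd x) \<and> reduced (y # w)"

lemma reduced_ConsD: "reduced (x # w) \<Longrightarrow> reduced w"
  by (cases w) auto

lemma reduced_push: "reduced w \<Longrightarrow> reduced (push x w)"
  by (cases w) (auto simp: push_cancel_iff simp del: push.simps(2) intro: reduced_ConsD)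

lemma reduce_Nil [simp]: "reduce [] = []"
  by (simp add: reduce_def)

lemma reduce_Cons: "reduce (x # w) = push x (reduce w)"
  by (simp add: reduce_def)

lemma reduced_reduce: "reduced (reduce w)"
  by (induction w) (auto simp: reduce_Cons reduced_push)

lemma push_reduced: "reduced (x # w) \<Longrightarrow> push x w = x # w"
  by (cases w) (auto simp: push_cancel_iff simp del: push.simps(2))

lemma reduce_reduced: "reduced w \<Longrightarrow> reduce w = w"
proof (induction w)
  case (Cons x w)
  then show ?case
    using push_reduced [OF Cons.prems] reduced_ConsD [OF Cons.prems] by (simp add: reduce_Cons)
qed simp

lemma carrier_free_grp: "carrier free_grp = {w. reduced w}"
  by (auto simp: free_grp_def reduce_reduced) (metis reduced_reduce)

lemma Nil_in_free_grp [simp]: "[] \<in> carrier free_grp"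
  by (simp add: carrier_free_grp)

lemma letter_in_free_grp [simp]: "[x] \<in> carrier free_grp"
  by (simp add: carrier_free_grp)

lemma Cons_in_free_grpD: "x # w \<in> carrier free_grp \<Longrightarrow> w \<in> carrier free_grp"
  by (auto simp: carrier_free_grp dest: reduced_ConsD)

lemma mult_free_grp: "u \<otimes>\<^bsub>free_grp\<^esub> v = reduce (u @ v)"
  by (simp add: free_grp_def)

lemma reduce_in_free_grp [simp]: "reduce w \<in> carrier free_grp"
  by (simp add: carrier_free_grp reduced_reduce)

lemma Cons_eq_mult: "x # w \<in> carrier free_grp \<Longrightarrow> x # w = [x] \<otimes>\<^bsub>free_grp\<^esub> w"
  by (simp add: mult_free_grp carrier_free_grp reduce_reduced)

lemma letter_mult_inverse: "[(i, e)] \<otimes>\<^bsub>free_grp\<^esub> [(i, \<not> e)] = []"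
  by (simp add: mult_free_grp reduce_Cons)

text \<open>The geometric series for the inverse of \<open>f\<close>, cut off at the length of the
  word: if \<open>1 - f\<close> lies in \<open>tens_ge 1\<close>, higher powers do not reach that
  coefficient.\<close>

definition tinv :: "'n tens \<Rightarrow> 'n tens"
  where "tinv f = Tens (\<lambda>w. coeff (\<Sum>k\<le>length w. (1 - f) ^ k) w)"

lemma tens_ge_power: "f \<in> tens_ge 1 \<Longrightarrow> f ^ k \<in> tens_ge k"
proof (induction k)
  case (Suc k)
  then show ?case using tens_ge_mult [of f 1 "f ^ k" k] by simp
qed simp

lemma tinv_approx:
  assumes "1 - f \<in> tens_ge 1"
  shows "tinv f - (\<Sum>k\<le>n. (1 - f) ^ k) \<in> tens_ge (Suc n)"
  unfolding tens_ge_def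
proof (intro CollectI allI impI)
  fix w :: "'a list" assume w: "length w < Suc n"
  have "(\<Sum>k\<le>length w. coeff ((1 - f) ^ k) w) = (\<Sum>k\<le>n. coeff ((1 - f) ^ k) w)"
  proof (rule sum.mono_neutral_left)
    show "\<forall>k\<in>{..n} - {..length w}. coeff ((1 - f) ^ k) w = 0"
    proof
      fix k assume "k \<in> {..n} - {..length w}"
      then show "coeff ((1 - f) ^ k) w = 0"
        using tens_ge_power [OF assms, of k] unfolding tens_ge_def by simp
    qed
  qed (use w in auto)
  then show "coeff (tinv f - (\<Sum>k\<le>n. (1 - f) ^ k)) w = 0"
    by (simp add: tinv_def coeff_sum)
qed

lemma geometric_sum_tens: "f * (\<Sum>k\<le>n. (1 - f) ^ k) = 1 - (1 - f :: 'n tens) ^ Suc n"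
proof (induction n)
  case (Suc n)
  have "f * (\<Sum>k\<le>Suc n. (1 - f) ^ k) = f * (\<Sum>k\<le>n. (1 - f) ^ k) + f * (1 - f) ^ Suc n"
    by (simp add: distrib_left)
  also have "\<dots> = 1 - (1 - f) * (1 - f) ^ Suc n"
    unfolding Suc by (simp add: left_diff_distrib del: power_Suc)
  finally show ?case by simp
qed simp

lemma tinv_inverse:
  assumes f: "f - 1 \<in> tens_ge 1"
  shows "f * tinv f = 1" "tinv f * f = 1"
proof -
  have e: "1 - f \<in> tens_ge 1"
    using tens_ge_uminus [OF f] by simp
  have "f * tinv f - 1 \<in> tens_ge p" for p
  proof -
    have "f * tinv f - 1 = f * (tinv f - (\<Sum>k\<le>p. (1 - f) ^ k)) - (1 - f) ^ Suc p"
      unfolding right_diff_distrib geometric_sum_tens by simp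
    moreover have "f * (tinv f - (\<Sum>k\<le>p. (1 - f) ^ k)) \<in> tens_ge (0 + Suc p)"
      by (intro tens_ge_mult tinv_approx e) simp
    moreover have "(1 - f) ^ Suc p \<in> tens_ge (Suc p)"
      by (rule tens_ge_power [OF e])
    ultimately have "f * tinv f - 1 \<in> tens_ge (Suc p)"
      by (simp del: power_Suc add: tens_ge_diff)
    then show ?thesis by (rule tens_ge_mono) simp
  qed
  then show 1: "f * tinv f = 1"
    by (rule eq_if_diff_tens_ge)
  have "tinv f * f = 1"
  proof (rule eq_if_diff_tens_ge)
    fix p
    have "tinv f * f - 1 \<in> tens_ge p"
    proof (induction p)
      case (Suc p)
      \<comment> \<open>The right inverse identity yields the fixed point equation
        \<open>e = (1 - f) * e\<close> for \<open>e = tinv f * f - 1\<close>, and each use of it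
        raises the filtration degree of \<open>e\<close> by one.\<close>
      have "f * (tinv f * f - 1) = 0"
        using 1 by (simp add: right_diff_distrib flip: mult.assoc)
      then have "tinv f * f - 1 = (1 - f) * (tinv f * f - 1)"
        by (simp add: left_diff_distrib)
      then show ?case
        using tens_ge_mult [OF e Suc] by (metis plus_1_eq_Suc)
    qed simp
    then show "tinv f * f - 1 \<in> tens_ge p" .
  qed
  then show "tinv f * f = 1" .
qed

text \<open>\<open>hom\<close> asks only for multiplicativity, so the value of an expansion at the
  neutral element is a priori just an idempotent; invertibility forces it to be
  \<open>1\<close>.\<close>

lemma idempotent_eq_one:
  assumes f: "f - 1 \<in> tens_ge 1" and "f * f = f"
  shows "f = 1"
proof -
  have "f * tinv f = f * (f * tinv f)"
    using assms(2) by (simp flip: mult.assoc)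
  then show ?thesis
    by (simp add: tinv_inverse [OF f])
qed

section \<open>Homology classes and linear terms\<close>

lemma H_class_Nil [simp]: "H_class [] = 0"
  by (simp add: H_class_def vec_eq_iff)

lemma H_class_Cons: "H_class (x # w) = (if snd x then 1 else - 1) *\<^sub>R axis (fst x) 1 + H_class w"
  by (auto simp: H_class_def vec_eq_iff axis_def split: prod.splits)

lemma H_class_append: "H_class (u @ v) = H_class u + H_class v"
  by (induction u) (auto simp: H_class_Cons)

lemma H_class_push: "H_class (push x w) = H_class (x # w)"
  by (cases w; cases x; cases "snd x") (auto simp: push_cancel_iff H_class_Cons simp del: push.simps(2))

lemma H_class_reduce: "H_class (reduce w) = H_class w"
  by (induction w) (auto simp: reduce_Cons H_class_push H_class_Cons)

lemma coeff_of_H: "coeff (of_H h) w = (case w of [i] \<Rightarrow> h $ i | _ \<Rightarrow> 0)"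
  by (cases w rule: remdups_adj.cases)
    (auto simp: of_H_def coeff_sum coeff_monomial if_distrib cong: if_cong)

lemma of_H_add: "of_H (h + k) = of_H h + of_H k"
  by (rule tens_eqI) (auto simp: coeff_of_H split: list.splits)

lemma of_H_scaleR: "of_H (c *\<^sub>R h) = c *\<^sub>R of_H h"
  by (rule tens_eqI) (auto simp: coeff_of_H split: list.splits)

lemma of_H_zero [simp]: "of_H 0 = 0"
  by (rule tens_eqI) (auto simp: coeff_of_H split: list.splits)

lemma of_H_axis: "of_H (axis i 1) = monomial [i]"
  by (rule tens_eqI) (auto simp: coeff_of_H coeff_monomial axis_def split: list.splits)

lemma of_H_tens_ge: "of_H h \<in> tens_ge 1"
  by (auto simp: tens_ge_def coeff_of_H)

lemma mult_congruence:
  assumes "f - (1 + of_H h) \<in> tens_ge 2" "g - (1 + of_H k) \<in> tens_ge 2"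
  shows "f * g - (1 + of_H (h + k)) \<in> tens_ge 2"
proof -
  have "f * g - (1 + of_H (h + k)) =
      (f - (1 + of_H h)) * g + (1 + of_H h) * (g - (1 + of_H k)) + of_H h * of_H k"
    by (simp add: left_diff_distrib right_diff_distrib distrib_left distrib_right of_H_add)
  moreover have "(f - (1 + of_H h)) * g \<in> tens_ge 2"
    using tens_ge_mult [OF assms(1), of g 0] by simp
  moreover have "(1 + of_H h) * (g - (1 + of_H k)) \<in> tens_ge 2"
    using tens_ge_mult [OF tens_ge_0 assms(2), of "1 + of_H h"] by (simp add: numeral_2_eq_2)
  moreover have "of_H h * of_H k \<in> tens_ge 2"
    using tens_ge_mult [OF of_H_tens_ge of_H_tens_ge] by (simp add: numeral_2_eq_2)
  ultimately show ?thesis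
    by (simp add: tens_ge_add)
qed

definition letter_val :: "('n::finite \<Rightarrow> 'n tens) \<Rightarrow> 'n \<times> bool \<Rightarrow> 'n tens"
  where "letter_val F x = (if snd x then F (fst x) else tinv (F (fst x)))"

definition word_val :: "('n::finite \<Rightarrow> 'n tens) \<Rightarrow> 'n fword \<Rightarrow> 'n tens"
  where "word_val F w = prod_list (map (letter_val F) w)"

definition point_of :: "('n::finite \<Rightarrow> 'n tens) \<Rightarrow> 'n point"
  where "point_of F = restrict (word_val F) (carrier free_grp)"

lemma word_val_append: "word_val F (u @ v) = word_val F u * word_val F v"
  by (simp add: word_val_def)

lemma word_val_Cons: "word_val F (x # w) = letter_val F x * word_val F w"
  by (simp add: word_val_def)

lemma gen_minus_one:
  assumes "f - (1 + of_H h) \<in> tens_ge 2"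
  shows "f - 1 \<in> tens_ge 1"
  using tens_ge_add [OF tens_ge_mono [OF assms, of 1] of_H_tens_ge [of h]] by simp

text \<open>The linear term of the inverse is that of \<open>2 - f\<close>, the partial geometric
  sum up to the first power.\<close>

lemma tinv_congruence:
  assumes "f - (1 + of_H h) \<in> tens_ge 2"
  shows "tinv f - (1 + of_H (- h)) \<in> tens_ge 2"
proof -
  have e: "1 - f \<in> tens_ge 1"
    using tens_ge_uminus [OF gen_minus_one [OF assms]] by simp
  have "(tinv f - (\<Sum>k\<le>1. (1 - f) ^ k)) - (f - (1 + of_H h)) \<in> tens_ge 2"
    by (rule tens_ge_diff [OF _ assms]) (use tinv_approx [OF e, of 1] in \<open>simp add: numeral_2_eq_2\<close>)
  moreover have "(tinv f - (\<Sum>k\<le>1. (1 - f) ^ k)) - (f - (1 + of_H h)) = tinv f - (1 + of_H (- h))"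
    using of_H_scaleR [of "-1" h] by (simp add: algebra_simps flip: one_add_one)
  ultimately show ?thesis
    by (simp only:)
qed

lemma letter_val_inverse:
  assumes "\<And>i. F i - 1 \<in> tens_ge 1"
  shows "letter_val F (i, e) * letter_val F (i, \<not> e) = 1"
  using tinv_inverse [OF assms [of i]] by (auto simp: letter_val_def)

text \<open>A cancelled pair of letters contributes a value times its inverse, hence nothing; so
  \<open>word_val\<close> is compatible with the group multiplication and not only with
  concatenation.\<close>

lemma word_val_reduce:
  assumes "\<And>i. F i - 1 \<in> tens_ge 1"
  shows "word_val F (reduce w) = word_val F w"
proof -
  have "word_val F (push x w) = word_val F (x # w)" for x w
  proof (cases w)
    case (Cons y v)
    show ?thesis
    proof (cases "y = (fst x, \<not> snd x)")
      case True
      have "word_val F (x # y # v) = letter_val F (fst x, snd x) * letter_val F (fst x, \<not> snd x) * word_val F v"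
        by (simp add: word_val_Cons True mult.assoc)
      then show ?thesis
        unfolding Cons push_cancel_iff letter_val_inverse [OF assms] using True by simp
    qed (simp add: Cons push_cancel_iff del: push.simps(2))
  qed simp
  then show ?thesis
    by (induction w) (auto simp: reduce_Cons word_val_Cons)
qed

lemma word_val_congruence:
  assumes "\<And>i. F i - (1 + of_H (axis i 1)) \<in> tens_ge 2"
  shows "word_val F w - (1 + of_H (H_class w)) \<in> tens_ge 2"
proof (induction w)
  case (Cons x w)
  have "letter_val F x - (1 + of_H ((if snd x then 1 else - 1) *\<^sub>R axis (fst x) 1)) \<in> tens_ge 2"
    using assms tinv_congruence [OF assms] by (auto simp: letter_val_def)
  from mult_congruence [OF this Cons] show ?case
    by (simp add: word_val_Cons H_class_Cons)
qed (simp add: word_val_def)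

text \<open>Universal property of the free group: values on the generators with the prescribed
  linear terms extend to an expansion. Together with \<open>Theta_eqI\<close> this makes the values
  on the generators a global chart.\<close>

lemma point_of_in_Theta:
  assumes F: "\<And>i. F i - (1 + of_H (axis i 1)) \<in> tens_ge 2"
  shows "point_of F \<in> Theta" and "point_of F (gen i) = F i"
proof -
  have F1: "F i - 1 \<in> tens_ge 1" for i
    by (rule gen_minus_one [OF F])
  have "word_val F w - 1 \<in> tens_ge 1" for w
    by (rule gen_minus_one [OF word_val_congruence [OF F]])
  then have "point_of F \<in> hom free_grp one_plus_tens"
    by (auto simp: hom_def one_plus_tens_def point_of_def mult_free_grp word_val_reduce [OF F1] word_val_append
        simp flip: mult_free_grp) (simp_all add: mult_free_grp word_val_reduce [OF F1] word_val_append)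
  then show "point_of F \<in> Theta"
    using word_val_congruence [OF F] by (auto simp: Theta_def point_of_def)
  show "point_of F (gen i) = F i"
    by (simp add: point_of_def word_val_def letter_val_def)
qed

lemma Theta_mult:
  "\<theta> \<in> Theta \<Longrightarrow> g \<in> carrier free_grp \<Longrightarrow> h \<in> carrier free_grp \<Longrightarrow>
    \<theta> (g \<otimes>\<^bsub>free_grp\<^esub> h) = \<theta> g * \<theta> h"
  by (auto simp: Theta_def hom_def one_plus_tens_def)

lemma Theta_congruence:
  "\<theta> \<in> Theta \<Longrightarrow> g \<in> carrier free_grp \<Longrightarrow> \<theta> g - (1 + of_H (H_class g)) \<in> tens_ge 2"
  by (auto simp: Theta_def)

lemma Theta_gen: "\<theta> \<in> Theta \<Longrightarrow> \<theta> (gen i) - (1 + of_H (axis i 1)) \<in> tens_ge 2"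
  using Theta_congruence [of \<theta> "gen i"] by (simp add: H_class_Cons)

lemma Theta_Nil [simp]:
  assumes "\<theta> \<in> Theta"
  shows "\<theta> [] = 1"
  using Theta_mult [OF assms, of "[]" "[]"] gen_minus_one [OF Theta_congruence [OF assms, of "[]"]]
  by (intro idempotent_eq_one) (simp_all add: mult_free_grp)

lemma Theta_Cons:
  assumes "\<theta> \<in> Theta" "x # w \<in> carrier free_grp"
  shows "\<theta> (x # w) = \<theta> [x] * \<theta> w"
  using Theta_mult [OF assms(1), of "[x]" w] Cons_eq_mult [OF assms(2)] Cons_in_free_grpD [OF assms(2)]
  by simp

text \<open>The value at an inverse generator is a left inverse of the value at the generator,
  whereas \<open>tinv\<close> gives a right inverse; so the two coincide.\<close>

lemma Theta_letter:
  assumes "\<theta> \<in> Theta"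
  shows "\<theta> [x] = letter_val (\<lambda>i. \<theta> (gen i)) x"
proof (cases "snd x")
  case True
  then show ?thesis by (cases x) (auto simp: letter_val_def)
next
  case False
  let ?f = "\<theta> (gen (fst x))"
  have "\<theta> [(fst x, False)] * ?f = 1"
    using Theta_mult [OF assms, of "[(fst x, False)]" "gen (fst x)"] letter_mult_inverse [of "fst x" False] assms
    by simp
  moreover have "?f * tinv ?f = 1"
    by (intro tinv_inverse gen_minus_one [OF Theta_gen [OF assms]])
  ultimately have "\<theta> [(fst x, False)] = tinv ?f"
    by (metis mult.assoc mult.left_neutral mult.right_neutral)
  then show ?thesis
    using False by (cases x) (auto simp: letter_val_def)
qed

lemma Theta_eq_word_val:
  assumes "\<theta> \<in> Theta"
  shows "g \<in> carrier free_grp \<Longrightarrow> \<theta> g = word_val (\<lambda>i. \<theta> (gen i)) g"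
proof (induction g)
  case Nil
  then show ?case using assms by (simp add: word_val_def)
next
  case (Cons x g)
  then show ?case
    using Theta_Cons [OF assms Cons.prems] Theta_letter [OF assms, of x] Cons_in_free_grpD [of x g]
    by (simp add: word_val_Cons)
qed

lemma Theta_eqI:
  assumes "\<theta> \<in> Theta" "\<theta>' \<in> Theta" "\<And>i. \<theta> (gen i) = \<theta>' (gen i)"
  shows "\<theta> = \<theta>'"
proof (rule extensionalityI)
  show "\<theta> \<in> extensional (carrier free_grp)" "\<theta>' \<in> extensional (carrier free_grp)"
    using assms by (auto simp: Theta_def)
  show "\<theta> g = \<theta>' g" if "g \<in> carrier free_grp" for g
    using Theta_eq_word_val [OF assms(1) that] Theta_eq_word_val [OF assms(2) that] assms(3) by simp
qed

text \<open>The definite description in \<open>displace\<close> is met: existence by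
  \<open>point_of\<close>, uniqueness by agreement on the generators.\<close>

lemma displace:
  assumes "\<theta> \<in> Theta" "v \<in> TTheta"
  shows "displace \<theta> v \<in> Theta" and "displace \<theta> v (gen i) = \<theta> (gen i) + v $ i"
proof -
  let ?F = "\<lambda>i. \<theta> (gen i) + v $ i"
  have F: "?F i - (1 + of_H (axis i 1)) \<in> tens_ge 2" for i
    using tens_ge_add [OF Theta_gen [OF assms(1), of i]] assms(2) by (force simp: TTheta_def algebra_simps)
  have "\<exists>!\<theta>'. \<theta>' \<in> Theta \<and> (\<forall>i. \<theta>' (gen i) = ?F i)"
    using point_of_in_Theta [OF F] by (intro ex1I [of _ "point_of ?F"]) (auto intro: Theta_eqI)
  from theI' [OF this] show "displace \<theta> v \<in> Theta" "displace \<theta> v (gen i) = \<theta> (gen i) + v $ i"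
    by (simp_all add: displace_def)
qed

lemma TTheta_add: "u \<in> TTheta \<Longrightarrow> v \<in> TTheta \<Longrightarrow> u + v \<in> TTheta"
  by (simp add: TTheta_def tens_ge_add)

lemma TTheta_zero [simp]: "0 \<in> TTheta"
  by (simp add: TTheta_def)

lemma TTheta_scaleR: "u \<in> TTheta \<Longrightarrow> c *\<^sub>R u \<in> TTheta"
  by (simp add: TTheta_def tens_ge_scaleR)

section \<open>Polynomial functions on the space of Magnus expansions\<close>

text \<open>The class of functions that carries all the calculus. The rule \<open>cong\<close>
  permits changes off \<open>Theta\<close>, because formulas such as
  \<open>maurer_cartan_eq_mc\<close> are available only on \<open>Theta\<close>.\<close>

inductive poly_fun :: "(('n::finite) point \<Rightarrow> real) \<Rightarrow> bool" where
  const: "poly_fun (\<lambda>\<theta>. c)"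
| coord: "poly_fun (\<lambda>\<theta>. coeff (\<theta> (gen i)) w)"
| add: "poly_fun f \<Longrightarrow> poly_fun g \<Longrightarrow> poly_fun (\<lambda>\<theta>. f \<theta> + g \<theta>)"
| mult: "poly_fun f \<Longrightarrow> poly_fun g \<Longrightarrow> poly_fun (\<lambda>\<theta>. f \<theta> * g \<theta>)"
| cong: "poly_fun f \<Longrightarrow> (\<And>\<theta>. \<theta> \<in> Theta \<Longrightarrow> g \<theta> = f \<theta>) \<Longrightarrow> poly_fun g"

lemma poly_fun_sum: "(\<And>x. x \<in> A \<Longrightarrow> poly_fun (f x)) \<Longrightarrow> poly_fun (\<lambda>\<theta>. \<Sum>x\<in>A. f x \<theta>)"
  by (induction A rule: infinite_finite_induct) (auto intro: poly_fun.const poly_fun.add poly_fun.mult)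

lemma displace_zero [simp]: "\<theta> \<in> Theta \<Longrightarrow> displace \<theta> 0 = \<theta>"
  by (rule Theta_eqI) (simp_all add: displace)

text \<open>The derivative is given by one function \<open>g\<close> that is again polynomial and
  serves all base points, so directional derivatives can be iterated.\<close>

lemma poly_fun_has_derivative:
  assumes "poly_fun f" and v: "v \<in> TTheta"
  shows "\<exists>g. poly_fun g \<and>
    (\<forall>\<theta>\<in>Theta. ((\<lambda>t. f (displace \<theta> (t *\<^sub>R v))) has_real_derivative g \<theta>) (at 0))"
  using assms(1)
proof (induction f)
  case (const c)
  show ?case by (rule exI [of _ "\<lambda>\<theta>. 0"]) (auto intro: poly_fun.const poly_fun.add poly_fun.mult)
next
  case (coord i w)
  have "((\<lambda>t. coeff (displace \<theta> (t *\<^sub>R v) (gen i)) w) has_real_derivative coeff (v $ i) w) (at 0)"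
    if "\<theta> \<in> Theta" for \<theta>
    unfolding displace(2) [OF that TTheta_scaleR [OF v]] by (auto intro!: derivative_eq_intros)
  then show ?case
    by (intro exI [of _ "\<lambda>\<theta>. coeff (v $ i) w"]) (auto intro: poly_fun.const poly_fun.add poly_fun.mult)
next
  case (add f g)
  then obtain f' g' where "poly_fun f'" "poly_fun g'"
    "\<forall>\<theta>\<in>Theta. ((\<lambda>t. f (displace \<theta> (t *\<^sub>R v))) has_real_derivative f' \<theta>) (at 0)"
    "\<forall>\<theta>\<in>Theta. ((\<lambda>t. g (displace \<theta> (t *\<^sub>R v))) has_real_derivative g' \<theta>) (at 0)"
    by blast
  then show ?case
    by (intro exI [of _ "\<lambda>\<theta>. f' \<theta> + g' \<theta>"]) (auto intro!: poly_fun.const poly_fun.add poly_fun.mult derivative_intros)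
next
  case (mult f g)
  then obtain f' g' where "poly_fun f'" "poly_fun g'"
    and d: "\<forall>\<theta>\<in>Theta. ((\<lambda>t. f (displace \<theta> (t *\<^sub>R v))) has_real_derivative f' \<theta>) (at 0)"
    "\<forall>\<theta>\<in>Theta. ((\<lambda>t. g (displace \<theta> (t *\<^sub>R v))) has_real_derivative g' \<theta>) (at 0)"
    by blast
  \<comment> \<open>At \<open>t = 0\<close> the displaced point is \<open>\<theta>\<close> itself,
    so the product rule yields an expression in \<open>\<theta>\<close> alone.\<close>
  moreover have "((\<lambda>t. f (displace \<theta> (t *\<^sub>R v)) * g (displace \<theta> (t *\<^sub>R v))) has_real_derivative
      f' \<theta> * g \<theta> + f \<theta> * g' \<theta>) (at 0)" if "\<theta> \<in> Theta" for \<theta>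
    using DERIV_mult [OF d(1)[rule_format, OF that] d(2)[rule_format, OF that]] that
    by (simp add: algebra_simps)
  ultimately show ?case
    using mult by (intro exI [of _ "\<lambda>\<theta>. f' \<theta> * g \<theta> + f \<theta> * g' \<theta>"]) (auto intro!: poly_fun.const poly_fun.add poly_fun.mult)
next
  case (cong f g)
  have "(\<lambda>t. g (displace \<theta> (t *\<^sub>R v))) = (\<lambda>t. f (displace \<theta> (t *\<^sub>R v)))" if "\<theta> \<in> Theta" for \<theta>
    using cong.hyps(2) displace(1) [OF that TTheta_scaleR [OF v]] by auto
  then show ?case
    using cong.IH by auto
qed

lemma has_dir_deriv:
  assumes "poly_fun f" "v \<in> TTheta" "\<theta> \<in> Theta"
  shows "((\<lambda>t. f (displace \<theta> (t *\<^sub>R v))) has_real_derivative dir_deriv v f \<theta>) (at 0)"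
  using poly_fun_has_derivative [OF assms(1,2)] assms(3) DERIV_imp_deriv
  unfolding dir_deriv_def by metis

lemma dir_deriv_eqI:
  "((\<lambda>t. f (displace \<theta> (t *\<^sub>R v))) has_real_derivative d) (at 0) \<Longrightarrow> dir_deriv v f \<theta> = d"
  unfolding dir_deriv_def by (rule DERIV_imp_deriv)

lemma poly_fun_dir_deriv:
  assumes "poly_fun f" "v \<in> TTheta"
  shows "poly_fun (dir_deriv v f)"
proof -
  obtain g where "poly_fun g" and
    "\<forall>\<theta>\<in>Theta. ((\<lambda>t. f (displace \<theta> (t *\<^sub>R v))) has_real_derivative g \<theta>) (at 0)"
    using poly_fun_has_derivative [OF assms] by blast
  then show ?thesis
    by (auto intro: dir_deriv_eqI poly_fun.cong [of g])
qed

lemma topspace_Theta_topology: "topspace Theta_topology = Theta"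
  by (simp add: Theta_topology_def topspace_pullback_topology)

lemma poly_fun_continuous: "poly_fun f \<Longrightarrow> continuous_map Theta_topology euclideanreal f"
proof (induction f rule: poly_fun.induct)
  case (coord i w)
  have "continuous_on UNIV (\<lambda>F :: 'a \<Rightarrow> 'a list \<Rightarrow> real. F i w)"
    by (rule continuous_on_compose2 [OF continuous_on_product_coordinates continuous_on_product_coordinates])
      simp
  then have "continuous_map Theta_topology euclideanreal
      ((\<lambda>F. F i w) \<circ> (\<lambda>\<theta> i w. coeff (\<theta> (gen i)) w))"
    unfolding Theta_topology_def by (intro continuous_map_pullback) simp
  then show ?case by (simp add: o_def)
next
  case (cong f g)
  then show ?case
    by (metis continuous_map_eq topspace_Theta_topology)
qed (auto intro: continuous_map_add continuous_map_real_mult)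

lemma poly_fun_smooth:
  assumes "poly_fun f"
  shows "smooth_fun f"
proof -
  have "poly_fun (foldr dir_deriv vs f)" if "set vs \<subseteq> TTheta" for vs
    using that by (induction vs) (auto simp: assms poly_fun_dir_deriv)
  then show ?thesis
    unfolding smooth_fun_def real_differentiable_def
    by (blast intro: poly_fun_continuous has_dir_deriv)
qed

lemma dir_deriv_cong:
  assumes "\<And>\<theta>. \<theta> \<in> Theta \<Longrightarrow> f \<theta> = g \<theta>" "v \<in> TTheta" "\<theta> \<in> Theta"
  shows "dir_deriv v f \<theta> = dir_deriv v g \<theta>"
  proof -
  have "f (displace \<theta> (t *\<^sub>R v)) = g (displace \<theta> (t *\<^sub>R v))" for t
    by (intro assms displace TTheta_scaleR)
  then show ?thesis by (simp add: dir_deriv_def)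
qed

lemma dir_deriv_const [simp]: "dir_deriv v (\<lambda>\<theta>. c) \<theta> = 0"
  by (intro dir_deriv_eqI) auto

lemma dir_deriv_coord:
  assumes "\<theta> \<in> Theta" "v \<in> TTheta"
  shows "dir_deriv v (\<lambda>\<theta>. coeff (\<theta> (gen i)) w) \<theta> = coeff (v $ i) w"
  by (rule dir_deriv_eqI, unfold displace(2) [OF assms(1) TTheta_scaleR [OF assms(2)]])
    (auto intro!: derivative_eq_intros)

lemma dir_deriv_mult:
  assumes "poly_fun f" "poly_fun g" "v \<in> TTheta" "\<theta> \<in> Theta"
  shows "dir_deriv v (\<lambda>\<theta>. f \<theta> * g \<theta>) \<theta> = dir_deriv v f \<theta> * g \<theta> + f \<theta> * dir_deriv v g \<theta>"
  using DERIV_mult [OF has_dir_deriv [OF assms(1,3,4)] has_dir_deriv [OF assms(2,3,4)]] assms(4)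
  by (intro dir_deriv_eqI) (simp add: algebra_simps)

lemma dir_deriv_sum:
  assumes "\<And>x. x \<in> A \<Longrightarrow> poly_fun (f x)" "v \<in> TTheta" "\<theta> \<in> Theta"
  shows "dir_deriv v (\<lambda>\<theta>. \<Sum>x\<in>A. f x \<theta>) \<theta> = (\<Sum>x\<in>A. dir_deriv v (f x) \<theta>)"
  by (intro dir_deriv_eqI DERIV_sum has_dir_deriv assms)

lemma dir_deriv_cmult:
  assumes "poly_fun f" "v \<in> TTheta" "\<theta> \<in> Theta"
  shows "dir_deriv v (\<lambda>\<theta>. c * f \<theta>) \<theta> = c * dir_deriv v f \<theta>"
  by (intro dir_deriv_eqI DERIV_cmult has_dir_deriv assms)

definition poly_tens :: "(('n::finite) point \<Rightarrow> 'n tens) \<Rightarrow> bool"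
  where "poly_tens F \<longleftrightarrow> (\<forall>w. poly_fun (\<lambda>\<theta>. coeff (F \<theta>) w))"

definition poly_hom :: "(('n::finite) point \<Rightarrow> 'n homs) \<Rightarrow> bool"
  where "poly_hom U \<longleftrightarrow> (\<forall>i. poly_tens (\<lambda>\<theta>. U \<theta> $ i))"

lemma poly_homD: "poly_hom U \<Longrightarrow> poly_fun (\<lambda>\<theta>. coeff (U \<theta> $ i) w)"
  by (simp add: poly_hom_def poly_tens_def)

lemma poly_tensD: "poly_tens F \<Longrightarrow> poly_fun (\<lambda>\<theta>. coeff (F \<theta>) w)"
  by (simp add: poly_tens_def)

lemma poly_tens_cong: "poly_tens F \<Longrightarrow> (\<And>\<theta>. \<theta> \<in> Theta \<Longrightarrow> G \<theta> = F \<theta>) \<Longrightarrow> poly_tens G"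
  unfolding poly_tens_def by (metis (no_types, lifting) poly_fun.cong)

lemma poly_hom_cong: "poly_hom F \<Longrightarrow> (\<And>\<theta>. \<theta> \<in> Theta \<Longrightarrow> G \<theta> = F \<theta>) \<Longrightarrow> poly_hom G"
  unfolding poly_hom_def by (metis (no_types, lifting) poly_tens_cong)

lemma poly_tens_const: "poly_tens (\<lambda>\<theta>. f)"
  by (simp add: poly_tens_def poly_fun.const)

lemma poly_hom_const: "poly_hom (\<lambda>\<theta>. u)"
  by (simp add: poly_hom_def poly_tens_const)

lemma poly_tens_gen: "poly_tens (\<lambda>\<theta>. \<theta> (gen i))"
  by (simp add: poly_tens_def poly_fun.coord)

lemma poly_tens_add: "poly_tens F \<Longrightarrow> poly_tens G \<Longrightarrow> poly_tens (\<lambda>\<theta>. F \<theta> + G \<theta>)"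
  by (simp add: poly_tens_def poly_fun.add)

lemma poly_tens_scaleR: "poly_tens F \<Longrightarrow> poly_tens (\<lambda>\<theta>. c *\<^sub>R F \<theta>)"
  by (simp add: poly_tens_def poly_fun.mult poly_fun.const)

lemma poly_tens_diff: "poly_tens F \<Longrightarrow> poly_tens G \<Longrightarrow> poly_tens (\<lambda>\<theta>. F \<theta> - G \<theta>)"
  using poly_tens_add [OF _ poly_tens_scaleR [of G "-1"], of F] by simp

lemma poly_tens_sum: "(\<And>x. x \<in> A \<Longrightarrow> poly_tens (F x)) \<Longrightarrow> poly_tens (\<lambda>\<theta>. \<Sum>x\<in>A. F x \<theta>)"
  by (simp add: poly_tens_def coeff_sum poly_fun_sum)

lemma poly_tens_mult: "poly_tens F \<Longrightarrow> poly_tens G \<Longrightarrow> poly_tens (\<lambda>\<theta>. F \<theta> * G \<theta>)"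
  by (simp add: poly_tens_def coeff_mult poly_fun_sum poly_fun.mult)

lemma poly_tens_power: "poly_tens F \<Longrightarrow> poly_tens (\<lambda>\<theta>. F \<theta> ^ k)"
  by (induction k) (auto intro: poly_tens_const poly_tens_mult)

lemma poly_tens_tinv: "poly_tens F \<Longrightarrow> poly_tens (\<lambda>\<theta>. tinv (F \<theta>))"
  unfolding poly_tens_def [of "\<lambda>\<theta>. tinv (F \<theta>)"]
  by (auto simp: tinv_def intro!: poly_tensD poly_tens_sum poly_tens_power poly_tens_diff poly_tens_const)

text \<open>A group element is a word in generators and their inverses, so its value is a product of
  the \<open>\<theta> (gen i)\<close> and their \<open>tinv\<close>, and each coefficient of a
  \<open>tinv\<close> is that of a finite sum of powers.\<close>

lemma poly_tens_value:
  assumes "g \<in> carrier free_grp"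
  shows "poly_tens (\<lambda>\<theta>. \<theta> g)"
proof (rule poly_tens_cong)
  have "poly_tens (\<lambda>\<theta> :: 'a point. letter_val (\<lambda>i. \<theta> (gen i)) x)" for x
    by (cases "snd x") (auto simp: letter_val_def poly_tens_gen poly_tens_tinv)
  then show "poly_tens (\<lambda>\<theta>. word_val (\<lambda>i. \<theta> (gen i)) g)"
    by (induction g) (auto simp: word_val_Cons word_val_def intro: poly_tens_const poly_tens_mult)
qed (rule Theta_eq_word_val [OF _ assms])

lemma poly_tens_ins: "poly_hom U \<Longrightarrow> poly_tens F \<Longrightarrow> poly_tens (\<lambda>\<theta>. ins a (U \<theta>) b (F \<theta>))"
  unfolding poly_tens_def [of "\<lambda>\<theta>. ins a (U \<theta>) b (F \<theta>)"]
proof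
  fix w assume "poly_hom U" "poly_tens F"
  then show "poly_fun (\<lambda>\<theta>. coeff (ins a (U \<theta>) b (F \<theta>)) w)"
    by (cases "a + b \<le> length w")
      (simp_all add: coeff_ins poly_fun_sum poly_fun.mult poly_fun.const poly_homD poly_tensD)
qed

lemma poly_tens_der: "poly_hom U \<Longrightarrow> poly_tens F \<Longrightarrow> poly_tens (\<lambda>\<theta>. der (U \<theta>) (F \<theta>))"
  unfolding poly_tens_def [of "\<lambda>\<theta>. der (U \<theta>) (F \<theta>)"]
  by (auto simp: coeff_der intro!: poly_fun_sum poly_tensD [OF poly_tens_ins])

lemma poly_hom_insert_hom:
  "poly_hom U \<Longrightarrow> poly_hom Z \<Longrightarrow> poly_hom (\<lambda>\<theta>. insert_hom a (U \<theta>) b (Z \<theta>))"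
  unfolding poly_hom_def [of "\<lambda>\<theta>. insert_hom a (U \<theta>) b (Z \<theta>)"] insert_hom_nth
  by (auto intro!: poly_tens_ins) (simp add: poly_hom_def)

lemma poly_hom_scaleR: "poly_hom U \<Longrightarrow> poly_hom (\<lambda>\<theta>. c *\<^sub>R U \<theta>)"
  by (simp add: poly_hom_def poly_tens_scaleR)

lemma poly_hom_sum: "(\<And>x. x \<in> A \<Longrightarrow> poly_hom (U x)) \<Longrightarrow> poly_hom (\<lambda>\<theta>. \<Sum>x\<in>A. U x \<theta>)"
  by (simp add: poly_hom_def poly_tens_sum)

definition deriv_tens :: "('n::finite) homs \<Rightarrow> ('n point \<Rightarrow> 'n tens) \<Rightarrow> 'n point \<Rightarrow> 'n tens"
  where "deriv_tens v F \<theta> = Tens (\<lambda>w. dir_deriv v (\<lambda>\<theta>'. coeff (F \<theta>') w) \<theta>)"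

definition deriv_hom :: "('n::finite) homs \<Rightarrow> ('n point \<Rightarrow> 'n homs) \<Rightarrow> 'n point \<Rightarrow> 'n homs"
  where "deriv_hom v U \<theta> = (\<chi> j. deriv_tens v (\<lambda>\<theta>'. U \<theta>' $ j) \<theta>)"

lemma coeff_deriv_tens: "coeff (deriv_tens v F \<theta>) w = dir_deriv v (\<lambda>\<theta>'. coeff (F \<theta>') w) \<theta>"
  by (simp add: deriv_tens_def)

lemma deriv_hom_nth: "deriv_hom v U \<theta> $ j = deriv_tens v (\<lambda>\<theta>'. U \<theta>' $ j) \<theta>"
  by (simp add: deriv_hom_def)

context
  fixes v :: "('n::finite) homs" and \<theta> :: "'n point"
  assumes v: "v \<in> TTheta" and \<theta>: "\<theta> \<in> Theta"
begin

lemma deriv_tens_cong: "(\<And>\<theta>. \<theta> \<in> Theta \<Longrightarrow> F \<theta> = G \<theta>) \<Longrightarrow> deriv_tens v F \<theta> = deriv_tens v G \<theta>"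
  by (auto intro!: tens_eqI dir_deriv_cong simp: coeff_deriv_tens v \<theta>)

lemma deriv_hom_cong: "(\<And>\<theta>. \<theta> \<in> Theta \<Longrightarrow> F \<theta> = G \<theta>) \<Longrightarrow> deriv_hom v F \<theta> = deriv_hom v G \<theta>"
  by (auto intro!: deriv_tens_cong simp: deriv_hom_nth vec_eq_iff)

lemma deriv_tens_gen: "deriv_tens v (\<lambda>\<theta>. \<theta> (gen i)) \<theta> = v $ i"
  by (auto intro!: tens_eqI simp: coeff_deriv_tens dir_deriv_coord v \<theta>)

lemma deriv_tens_const: "deriv_tens v (\<lambda>\<theta>. f) \<theta> = 0"
  by (auto intro!: tens_eqI simp: coeff_deriv_tens)

lemma deriv_tens_mult:
  assumes "poly_tens F" "poly_tens G"
  shows "deriv_tens v (\<lambda>\<theta>. F \<theta> * G \<theta>) \<theta> = deriv_tens v F \<theta> * G \<theta> + F \<theta> * deriv_tens v G \<theta>"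
  by (rule tens_eqI) (simp add: coeff_deriv_tens coeff_mult dir_deriv_sum dir_deriv_mult poly_fun.mult
      poly_tensD [OF assms(1)] poly_tensD [OF assms(2)] v \<theta> sum.distrib)

lemma deriv_tens_ins:
  assumes "poly_hom U" "poly_tens F"
  shows "deriv_tens v (\<lambda>\<theta>. ins a (U \<theta>) b (F \<theta>)) \<theta> =
    ins a (deriv_hom v U \<theta>) b (F \<theta>) + ins a (U \<theta>) b (deriv_tens v F \<theta>)"
  by (rule tens_eqI) (simp add: coeff_deriv_tens deriv_hom_nth coeff_ins dir_deriv_sum dir_deriv_mult poly_fun.mult
      poly_homD [OF assms(1)] poly_tensD [OF assms(2)] v \<theta> sum.distrib)

lemma deriv_tens_der:
  assumes "poly_hom U" "poly_tens F"
  shows "deriv_tens v (\<lambda>\<theta>. der (U \<theta>) (F \<theta>)) \<theta> =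
    der (deriv_hom v U \<theta>) (F \<theta>) + der (U \<theta>) (deriv_tens v F \<theta>)"
proof -
  have p: "poly_fun (\<lambda>\<theta>. coeff (ins a (U \<theta>) b (F \<theta>)) w)" for a b w
    by (rule poly_tensD [OF poly_tens_ins [OF assms]])
  have d: "dir_deriv v (\<lambda>\<theta>. coeff (ins a (U \<theta>) b (F \<theta>)) w) \<theta> =
      coeff (ins a (deriv_hom v U \<theta>) b (F \<theta>)) w + coeff (ins a (U \<theta>) b (deriv_tens v F \<theta>)) w" for a b w
    unfolding coeff_deriv_tens [symmetric] deriv_tens_ins [OF assms] by simp
  show ?thesis
  proof (rule tens_eqI)
    fix w
    have "coeff (deriv_tens v (\<lambda>\<theta>. der (U \<theta>) (F \<theta>)) \<theta>) w =
        (\<Sum>a\<le>length w. \<Sum>b\<le>length w - a. dir_deriv v (\<lambda>\<theta>. coeff (ins a (U \<theta>) b (F \<theta>)) w) \<theta>)"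
      unfolding coeff_deriv_tens coeff_der by (simp add: dir_deriv_sum poly_fun_sum p v \<theta>)
    then show "coeff (deriv_tens v (\<lambda>\<theta>. der (U \<theta>) (F \<theta>)) \<theta>) w =
        coeff (der (deriv_hom v U \<theta>) (F \<theta>) + der (U \<theta>) (deriv_tens v F \<theta>)) w"
      unfolding d by (simp add: coeff_der sum.distrib)
  qed
qed

lemma deriv_hom_insert_hom:
  assumes "poly_hom U" "poly_hom Z"
  shows "deriv_hom v (\<lambda>\<theta>. insert_hom a (U \<theta>) b (Z \<theta>)) \<theta> =
    insert_hom a (deriv_hom v U \<theta>) b (Z \<theta>) + insert_hom a (U \<theta>) b (deriv_hom v Z \<theta>)"
  using assms by (simp add: vec_eq_iff deriv_hom_nth insert_hom_nth deriv_tens_ins poly_hom_def)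

lemma deriv_hom_sum:
  assumes "\<And>x. x \<in> A \<Longrightarrow> poly_hom (U x)"
  shows "deriv_hom v (\<lambda>\<theta>. \<Sum>x\<in>A. U x \<theta>) \<theta> = (\<Sum>x\<in>A. deriv_hom v (U x) \<theta>)"
  by (auto simp: vec_eq_iff deriv_hom_nth coeff_deriv_tens coeff_sum dir_deriv_sum v \<theta>
      poly_homD [OF assms] intro!: tens_eqI)

lemma deriv_hom_scaleR:
  assumes "poly_hom U"
  shows "deriv_hom v (\<lambda>\<theta>. c *\<^sub>R U \<theta>) \<theta> = c *\<^sub>R deriv_hom v U \<theta>"
  by (auto simp: vec_eq_iff deriv_hom_nth coeff_deriv_tens dir_deriv_cmult v \<theta>
      poly_homD [OF assms] intro!: tens_eqI)

end

section \<open>The Maurer-Cartan form\<close>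

text \<open>What is left of the value at a generator beyond \<open>1\<close> and the linear term. In
  these terms \<open>der u (\<theta> (gen i)) = v $ i\<close> reads
  \<open>u $ i = v $ i - der u (gen_rest \<theta> i)\<close>, the fixed point equation behind
  \<open>mc_iter\<close>.\<close>

definition gen_rest :: "('n::finite) point \<Rightarrow> 'n \<Rightarrow> 'n tens"
  where "gen_rest \<theta> i = \<theta> (gen i) - 1 - monomial [i]"

text \<open>Finding the derivation with prescribed values on the \<open>\<theta> (gen i)\<close> is a fixed point problem
  for a map that is contracting with respect to the filtration.\<close>

primrec mc_iter :: "nat \<Rightarrow> ('n::finite) point \<Rightarrow> 'n homs \<Rightarrow> 'n homs" where
  "mc_iter 0 \<theta> v = 0"
| "mc_iter (Suc k) \<theta> v = (\<chi> i. v $ i - der (mc_iter k \<theta> v) (gen_rest \<theta> i))"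

text \<open>The limit of the iteration, coefficient by coefficient: at a word of length
  \<open>l\<close> the iterates no longer change from step \<open>l\<close> on.\<close>

definition mc :: "('n::finite) point \<Rightarrow> 'n homs \<Rightarrow> 'n homs"
  where "mc \<theta> v = (\<chi> i. Tens (\<lambda>w. coeff (mc_iter (length w) \<theta> v $ i) w))"

lemma gen_rest_tens_ge: "\<theta> \<in> Theta \<Longrightarrow> gen_rest \<theta> i \<in> tens_ge 2"
  using Theta_gen [of \<theta> i] by (simp add: gen_rest_def of_H_axis algebra_simps)

lemma der_gen: "der u (\<theta> (gen i)) = u $ i + der u (gen_rest \<theta> i)"
  by (simp add: gen_rest_def der_diff)

lemma TTheta_nth: "v \<in> TTheta \<Longrightarrow> v $ i \<in> tens_ge 2"
  by (simp add: TTheta_def)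

text \<open>The contraction estimate. When one letter of a word of length at least 2 is replaced by
  a block of degree at least \<open>p\<close>, another letter remains, so the degree reaches
  \<open>p + 1\<close>. The case \<open>p = 0\<close> is separate, as \<open>der_tens_ge\<close>
  speaks of blocks of positive degree.\<close>

lemma der_rest_tens_ge:
  assumes "\<And>i. u $ i \<in> tens_ge p" "f \<in> tens_ge 2"
  shows "der u f \<in> tens_ge (Suc p)"
proof (cases p)
  case 0
  have "coeff (der u f) [] = 0"
    using assms(2) by (auto simp: coeff_der coeff_ins tens_ge_def intro!: sum.neutral)
  then show ?thesis using 0 by (auto simp: tens_ge_def)
next
  case (Suc m)
  then show ?thesis using der_tens_ge [of u m f 2] assms by simp
qed

context
  fixes \<theta> :: "('n::finite) point" and v :: "'n homs"
  assumes \<theta>: "\<theta> \<in> Theta" and v: "v \<in> TTheta"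
begin

lemma mc_iter_step: "mc_iter (Suc k) \<theta> v $ i - mc_iter k \<theta> v $ i \<in> tens_ge (k + 2)"
proof (induction k arbitrary: i)
  case 0
  then show ?case using TTheta_nth [OF v, of i] by (simp add: numeral_2_eq_2)
next
  case (Suc k)
  have "der (mc_iter (Suc k) \<theta> v - mc_iter k \<theta> v) (gen_rest \<theta> i) \<in> tens_ge (Suc (k + 2))"
    by (rule der_rest_tens_ge [OF _ gen_rest_tens_ge [OF \<theta>]]) (use Suc in simp)
  then have "- der (mc_iter (Suc k) \<theta> v - mc_iter k \<theta> v) (gen_rest \<theta> i) \<in> tens_ge (Suc k + 2)"
    by (intro tens_ge_uminus) simp
  moreover have "- der (mc_iter (Suc k) \<theta> v - mc_iter k \<theta> v) (gen_rest \<theta> i) =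
      mc_iter (Suc (Suc k)) \<theta> v $ i - mc_iter (Suc k) \<theta> v $ i"
    unfolding der_diff_left by simp
  ultimately show ?case by (simp only:)
qed

lemma mc_iter_diff: "j \<le> k \<Longrightarrow> mc_iter k \<theta> v $ i - mc_iter j \<theta> v $ i \<in> tens_ge (j + 2)"
proof (induction k rule: dec_induct)
  case (step k)
  have "(mc_iter (Suc k) \<theta> v $ i - mc_iter k \<theta> v $ i) + (mc_iter k \<theta> v $ i - mc_iter j \<theta> v $ i) \<in> tens_ge (j + 2)"
    by (intro tens_ge_add step.IH tens_ge_mono [OF mc_iter_step]) (use step in simp)
  then show ?case by simp
qed simp

lemma mc_approx: "mc \<theta> v $ i - mc_iter k \<theta> v $ i \<in> tens_ge (Suc k)"
  unfolding tens_ge_def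
proof (intro CollectI allI impI)
  fix w :: "'n list" assume "length w < Suc k"
  then have "mc_iter k \<theta> v $ i - mc_iter (length w) \<theta> v $ i \<in> tens_ge (length w + 2)"
    by (intro mc_iter_diff) simp
  then show "coeff (mc \<theta> v $ i - mc_iter k \<theta> v $ i) w = 0"
    by (simp add: mc_def tens_ge_def)
qed

lemma mc_TTheta: "mc \<theta> v \<in> TTheta"
proof -
  have "mc \<theta> v $ i \<in> tens_ge 2" for i
    using tens_ge_add [OF mc_approx [of i 1], of "v $ i"] TTheta_nth [OF v, of i]
    by (simp add: numeral_2_eq_2)
  then show ?thesis by (simp add: TTheta_def)
qed

lemma der_mc: "der (mc \<theta> v) (\<theta> (gen i)) = v $ i"
proof (rule eq_if_diff_tens_ge)
  fix p
  \<comment> \<open>The recursion of \<open>mc_iter\<close> makes the exact parts cancel. What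
    remains is the error of step \<open>p + 1\<close> and the derivation given by the error of step
    \<open>p\<close>, both of high degree.\<close>
  have "der (mc \<theta> v) (\<theta> (gen i)) - v $ i =
      (mc \<theta> v $ i - mc_iter (Suc p) \<theta> v $ i) + der (mc \<theta> v - mc_iter p \<theta> v) (gen_rest \<theta> i)"
    unfolding der_gen der_diff_left by simp
  moreover have "mc \<theta> v $ i - mc_iter (Suc p) \<theta> v $ i \<in> tens_ge p"
    by (rule tens_ge_mono [OF mc_approx]) simp
  moreover have "der (mc \<theta> v - mc_iter p \<theta> v) (gen_rest \<theta> i) \<in> tens_ge p"
    by (rule tens_ge_mono [OF der_rest_tens_ge [OF _ gen_rest_tens_ge [OF \<theta>], of _ "Suc p"]])
      (use mc_approx in simp_all)
  ultimately show "der (mc \<theta> v) (\<theta> (gen i)) - v $ i \<in> tens_ge p"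
    by (simp only: tens_ge_add)
qed

end

text \<open>The same contraction, applied to the homogeneous equation, puts \<open>u\<close> into
  every step of the filtration.\<close>

lemma der_gen_eq_zeroD:
  assumes \<theta>: "\<theta> \<in> Theta" and "\<And>i. der u (\<theta> (gen i)) = 0"
  shows "u = 0"
proof -
  have eq: "u $ i = - der u (gen_rest \<theta> i)" for i
    using assms(2) [of i] by (simp add: der_gen add_eq_0_iff2)
  have "u $ i \<in> tens_ge p" for i p
  proof (induction p arbitrary: i)
    case (Suc p)
    show ?case
      by (subst eq, rule tens_ge_uminus, rule der_rest_tens_ge [OF Suc gen_rest_tens_ge [OF \<theta>]])
  qed simp
  then have "u $ i = 0" for i
    by (intro eq_if_diff_tens_ge) simp
  then show ?thesis by (simp add: vec_eq_iff)
qed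

lemma der_gen_cancel:
  assumes "\<theta> \<in> Theta" "\<And>i. der u (\<theta> (gen i)) = der u' (\<theta> (gen i))"
  shows "u = u'"
  using der_gen_eq_zeroD [OF assms(1), of "u - u'"] assms(2) by (simp add: der_diff_left)

lemma exp_op_derivative:
  fixes D :: "('n::finite) tens \<Rightarrow> 'n tens"
  assumes "D \<in> derivations"
  shows "((\<lambda>t. coeff (exp_op (\<lambda>f. t *\<^sub>R D f) f) w) has_real_derivative coeff (D f) w) (at 0)"
proof -
  obtain u where D: "D = der u" and u: "u \<in> TTheta"
    using derivation_eq_der [OF assms] by blast
  have ge: "(D ^^ k) g \<in> tens_ge k" for k g
  proof (induction k)
    case (Suc k)
    then show ?case
      using der_tens_ge [of u 1 "(D ^^ k) g" k] TTheta_nth [OF u] by (simp add: D numeral_2_eq_2)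
  qed simp
  have "((\<lambda>f. t *\<^sub>R D f) ^^ k) f = t ^ k *\<^sub>R (D ^^ k) f" for t k
    by (induction k) (simp_all add: D der_scaleR)
  \<comment> \<open>Each power of \<open>D\<close> gains a degree, so nothing is contributed beyond
    \<open>k = length w\<close>. The bound is one larger so that \<open>k = 1\<close> is a summand
    even for the empty word.\<close>
  then have exp: "coeff (exp_op (\<lambda>f. t *\<^sub>R D f) f) w =
      (\<Sum>k\<le>Suc (length w). t ^ k * (coeff ((D ^^ k) f) w / fact k))" for t
    using ge unfolding exp_op_def coeff_Tens
    by (subst suminf_finite [of "{..Suc (length w)}"]) (auto simp: tens_ge_def)
  have "((\<lambda>t. \<Sum>k\<le>Suc (length w). t ^ k * (coeff ((D ^^ k) f) w / fact k)) has_real_derivative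
      (\<Sum>k\<le>Suc (length w). (of_nat k * 0 ^ (k - 1)) * (coeff ((D ^^ k) f) w / fact k))) (at 0)"
    by (auto intro!: derivative_eq_intros sum.cong)
  \<comment> \<open>Only \<open>k = 1\<close> survives at \<open>t = 0\<close>. For
    \<open>k = 0\<close> the truncated exponent gives \<open>0 ^ 0 = 1\<close>, but the factor
    \<open>of_nat k\<close> removes it.\<close>
  also have "(\<Sum>k\<le>Suc (length w). (of_nat k * 0 ^ (k - 1)) * (coeff ((D ^^ k) f) w / fact k)) =
      (\<Sum>k\<le>Suc (length w). if k = 1 then coeff (D f) w else 0)"
    by (intro sum.cong refl) (auto simp: power_0_left)
  finally show ?thesis
    by (simp add: exp del: sum.atMost_Suc)
qed

text \<open>Reduces the flow in the definition of \<open>maurer_cartan\<close> to an algebraic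
  condition at the generators.\<close>

lemma velocity_exp_iff:
  fixes D :: "('n::finite) tens \<Rightarrow> 'n tens"
  assumes "D \<in> derivations"
  shows "velocity (\<lambda>t. \<lambda>g\<in>carrier free_grp. exp_op (\<lambda>f. t *\<^sub>R D f) (\<theta> g)) v \<longleftrightarrow>
    (\<forall>i. D (\<theta> (gen i)) = v $ i)"
proof
  assume "velocity (\<lambda>t. \<lambda>g\<in>carrier free_grp. exp_op (\<lambda>f. t *\<^sub>R D f) (\<theta> g)) v"
  then show "\<forall>i. D (\<theta> (gen i)) = v $ i"
    using DERIV_unique [OF exp_op_derivative [OF assms]]
    by (auto simp: velocity_def intro!: tens_eqI)
next
  assume "\<forall>i. D (\<theta> (gen i)) = v $ i"
  then show "velocity (\<lambda>t. \<lambda>g\<in>carrier free_grp. exp_op (\<lambda>f. t *\<^sub>R D f) (\<theta> g)) v"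
    using exp_op_derivative [OF assms] by (auto simp: velocity_def) metis
qed

text \<open>Replaces the definite description by the solution of the fixed point equation. For
  uniqueness, a competing derivation is brought into the form \<open>der u\<close>, and then its
  values at the \<open>\<theta> (gen i)\<close> determine \<open>u\<close>.\<close>

lemma maurer_cartan_eq_mc:
  assumes "\<theta> \<in> Theta" "v \<in> TTheta"
  shows "maurer_cartan \<theta> v = mc \<theta> v"
  unfolding maurer_cartan_def
proof (rule the_equality)
  show "\<exists>D\<in>derivations. mc \<theta> v = restrict_H D \<and>
      velocity (\<lambda>t. \<lambda>g\<in>carrier free_grp. exp_op (\<lambda>f. t *\<^sub>R D f) (\<theta> g)) v"
    by (rule bexI [of _ "der (mc \<theta> v)"])
      (simp_all add: velocity_exp_iff der_in_derivations mc_TTheta der_mc assms)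
next
  fix u
  assume "\<exists>D\<in>derivations. u = restrict_H D \<and>
      velocity (\<lambda>t. \<lambda>g\<in>carrier free_grp. exp_op (\<lambda>f. t *\<^sub>R D f) (\<theta> g)) v"
  then obtain D where D: "D \<in> derivations" "u = restrict_H D" "\<forall>i. D (\<theta> (gen i)) = v $ i"
    using velocity_exp_iff by blast
  then have "der u (\<theta> (gen i)) = der (mc \<theta> v) (\<theta> (gen i))" for i
    by (metis derivation_eq_der(1) der_mc assms)
  then show "u = mc \<theta> v"
    by (rule der_gen_cancel [OF assms(1)])
qed

lemma mc_eqI: "\<theta> \<in> Theta \<Longrightarrow> v \<in> TTheta \<Longrightarrow> (\<And>i. der u (\<theta> (gen i)) = v $ i) \<Longrightarrow> mc \<theta> v = u"
  by (rule der_gen_cancel) (auto simp: der_mc)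

lemma mc_linear:
  assumes "\<theta> \<in> Theta" "x \<in> TTheta" "y \<in> TTheta"
  shows "mc \<theta> (c *\<^sub>R x + d *\<^sub>R y) = c *\<^sub>R mc \<theta> x + d *\<^sub>R mc \<theta> y"
  using assms by (intro mc_eqI) (auto simp: TTheta_add TTheta_scaleR der_add_left der_scaleR_left der_mc)

lemma poly_hom_mc: "poly_hom (\<lambda>\<theta>. mc \<theta> v)"
proof -
  have rest: "poly_tens (\<lambda>\<theta>. gen_rest \<theta> i)" for i :: 'a
    unfolding gen_rest_def by (intro poly_tens_diff poly_tens_gen poly_tens_const)
  have "poly_hom (\<lambda>\<theta>. mc_iter k \<theta> v)" for k
  proof (induction k)
    case (Suc k)
    then show ?case
      unfolding poly_hom_def [of "\<lambda>\<theta>. mc_iter (Suc k) \<theta> v"]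
      by (simp add: poly_tens_diff poly_tens_const poly_tens_der rest)
  qed (simp add: poly_hom_const)
  then show ?thesis
    by (simp add: poly_hom_def poly_tens_def mc_def)
qed

text \<open>The iteration respects congruence modulo \<open>tens_ge N\<close>, since
  \<open>der u\<close> preserves the filtration when \<open>u\<close> has values in
  \<open>tens_ge 1\<close>. This supplies the finite stage from which each \<open>eta p\<close>
  comes.\<close>

lemma mc_local:
  assumes \<theta>: "\<theta> \<in> Theta" "\<theta>' \<in> Theta" and v: "v \<in> TTheta" "v' \<in> TTheta"
    and eq: "\<And>i. \<theta> (gen i) - \<theta>' (gen i) \<in> tens_ge N" "\<And>i. v $ i - v' $ i \<in> tens_ge N"
  shows "mc \<theta> v $ i - mc \<theta>' v' $ i \<in> tens_ge N"
proof -
  have ge2: "mc_iter k \<theta>' v' $ i \<in> tens_ge 1" for k i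
  proof (cases k)
    case (Suc j)
    then show ?thesis
      using mc_iter_diff [OF \<theta>(2) v(2), of 0 k] by (auto intro: tens_ge_mono)
  qed simp
  have iter: "mc_iter k \<theta> v $ i - mc_iter k \<theta>' v' $ i \<in> tens_ge N" for k i
  proof (induction k arbitrary: i)
    case (Suc k)
    have r: "gen_rest \<theta> i - gen_rest \<theta>' i \<in> tens_ge N"
      using eq(1) [of i] by (simp add: gen_rest_def)
    have "der (mc_iter k \<theta> v - mc_iter k \<theta>' v') (gen_rest \<theta> i) \<in> tens_ge N"
      by (rule tens_ge_mono [OF der_rest_tens_ge [OF _ gen_rest_tens_ge [OF \<theta>(1)]], of _ N])
        (use Suc in simp_all)
    moreover have "der (mc_iter k \<theta>' v') (gen_rest \<theta> i - gen_rest \<theta>' i) \<in> tens_ge N"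
      using der_tens_ge [of "mc_iter k \<theta>' v'" 0, OF _ r] ge2 by simp
    ultimately have "v $ i - v' $ i - (der (mc_iter k \<theta> v - mc_iter k \<theta>' v') (gen_rest \<theta> i) +
       der (mc_iter k \<theta>' v') (gen_rest \<theta> i - gen_rest \<theta>' i)) \<in> tens_ge N"
      by (intro tens_ge_add tens_ge_diff eq)
    then show ?case
      by (simp add: der_diff der_diff_left algebra_simps)
  qed simp
  have "(mc \<theta> v $ i - mc_iter N \<theta> v $ i) + (mc_iter N \<theta> v $ i - mc_iter N \<theta>' v' $ i) -
      (mc \<theta>' v' $ i - mc_iter N \<theta>' v' $ i) \<in> tens_ge N"
    by (intro tens_ge_add tens_ge_diff iter tens_ge_mono [OF mc_approx] \<theta> v) simp_all
  then show ?thesis by simp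
qed

text \<open>Differentiating \<open>der (mc \<theta> y) (\<theta> (gen i)) = y $ i\<close> along \<open>x\<close> expresses the derivative of
  \<open>mc\<close> by a composition of two derivations; antisymmetrizing gives their commutator, which is
  again a derivation.\<close>

lemma maurer_cartan_equation:
  assumes \<theta>: "\<theta> \<in> Theta" and x: "x \<in> TTheta" and y: "y \<in> TTheta"
  shows "deriv_hom x (\<lambda>\<theta>. mc \<theta> y) \<theta> - deriv_hom y (\<lambda>\<theta>. mc \<theta> x) \<theta> =
    (\<chi> i. der (mc \<theta> x) (mc \<theta> y $ i) - der (mc \<theta> y) (mc \<theta> x $ i))"
proof -
  have d: "der (deriv_hom x (\<lambda>\<theta>. mc \<theta> y) \<theta>) (\<theta> (gen i)) = - der (mc \<theta> y) (der (mc \<theta> x) (\<theta> (gen i)))"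
    if x: "x \<in> TTheta" and y: "y \<in> TTheta" for x y :: "'a homs" and i
  proof -
    have "der (deriv_hom x (\<lambda>\<theta>. mc \<theta> y) \<theta>) (\<theta> (gen i)) + der (mc \<theta> y) (x $ i) =
        deriv_tens x (\<lambda>\<theta>. der (mc \<theta> y) (\<theta> (gen i))) \<theta>"
      using deriv_tens_der [OF x \<theta> poly_hom_mc poly_tens_gen] deriv_tens_gen [OF x \<theta>] by simp
    also have "\<dots> = deriv_tens x (\<lambda>\<theta>. y $ i) \<theta>"
      by (rule deriv_tens_cong [OF x \<theta>]) (simp add: der_mc y)
    also have "\<dots> = 0"
      by (rule deriv_tens_const [OF x \<theta>])
    finally show ?thesis
      using der_mc [OF \<theta> x] by (simp add: add_eq_0_iff)
  qed
  define D where "D f = der (mc \<theta> x) (der (mc \<theta> y) f) - der (mc \<theta> y) (der (mc \<theta> x) f)" for f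
  have "D \<in> derivations"
  proof -
    have "linear D"
      by (rule linearI) (simp_all add: D_def der_add der_scaleR algebra_simps)
    moreover have "D (f * g) = D f * g + f * D g" for f g
      by (simp add: D_def der_mult der_add algebra_simps)
    moreover have "D f \<in> tens_ge 2" if f: "f \<in> tens_ge 1" for f
    proof -
      have ge: "der (mc \<theta> z) f \<in> tens_ge 2" if "z \<in> TTheta" "f \<in> tens_ge 1" for z f
        using der_in_derivations [OF mc_TTheta [OF \<theta> that(1)]] that(2) unfolding derivations_def by blast
      show ?thesis
        unfolding D_def by (intro tens_ge_diff ge x y f tens_ge_mono [OF ge, of _ _ 1]) simp_all
    qed
    ultimately show ?thesis by (auto simp: derivations_def)
  qed
  then have "D = der (restrict_H D)"
    by (rule derivation_eq_der)
  moreover have "restrict_H D = (\<chi> i. der (mc \<theta> x) (mc \<theta> y $ i) - der (mc \<theta> y) (mc \<theta> x $ i))"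
    by (simp add: restrict_H_def D_def)
  ultimately have D: "D f = der (\<chi> i. der (mc \<theta> x) (mc \<theta> y $ i) - der (mc \<theta> y) (mc \<theta> x $ i)) f" for f
    by simp
  \<comment> \<open>Both sides are tested at the \<open>\<theta> (gen i)\<close>: by
    \<open>d\<close> the left one gives the difference of the two compositions, and the right one
    gives the commutator \<open>D\<close>.\<close>
  show ?thesis
    by (rule der_gen_cancel [OF \<theta>]) (simp add: D [symmetric] der_diff_left d x y, simp add: D_def)
qed

section \<open>Homogeneous components of the Maurer-Cartan equation\<close>

definition hom_part :: "nat \<Rightarrow> ('n::finite) homs \<Rightarrow> 'n homs"
  where "hom_part m u = (\<chi> i. tens_part m (u $ i))"

lemma coeff_hom_part: "coeff (hom_part m u $ i) w = (if length w = m then coeff (u $ i) w else 0)"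
  by (simp add: hom_part_def coeff_tens_part)

text \<open>In degree \<open>p + 1\<close>, a component of \<open>f\<close> of degree
  \<open>p - s + 1\<close> meets a block of degree \<open>s + 1\<close>, with \<open>k\<close>
  letters before the block and \<open>p - s - k\<close> behind it. Since \<open>u\<close> and
  \<open>f\<close> start in degree 2, both \<open>s\<close> and \<open>p - s\<close> are at least 1:
  this is the index range in the boundary of the associahedron.\<close>

lemma tens_part_der:
  assumes u: "u \<in> TTheta" and f: "f \<in> tens_ge 2"
  shows "tens_part (p + 1) (der u f) = (\<Sum>s = 1..p - 1. \<Sum>k = 0..p - s.
    ins k (hom_part (s + 1) u) (p - s - k) (tens_part (p - s + 1) f))"
proof (rule tens_eqI)
  fix w :: "'a list"
  show "coeff (tens_part (p + 1) (der u f)) w = coeff (\<Sum>s = 1..p - 1. \<Sum>k = 0..p - s.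
    ins k (hom_part (s + 1) u) (p - s - k) (tens_part (p - s + 1) f)) w"
  proof (cases "length w = p + 1")
    case False
    then show ?thesis
      by (auto simp: coeff_tens_part coeff_sum coeff_ins coeff_hom_part intro!: sum.neutral)
  next
    case w: True
    have zero: "coeff (ins a u b f) w = 0" if "\<not> (1 \<le> a + b \<and> a + b \<le> p - 1)" "a + b \<le> length w" for a b
    proof (cases "a + b = 0")
      case True
      then show ?thesis using f by (auto simp: coeff_ins tens_ge_def)
    next
      case False
      then have "length (drop a (take (length w - b) w)) < 2"
        using that w by simp linarith
      then have "coeff (u $ i) (drop a (take (length w - b) w)) = 0" for i
        using TTheta_nth [OF u, of i] unfolding tens_ge_def by blast
      then show ?thesis unfolding coeff_ins by simp
    qed
    have part: "coeff (ins k u (p - s - k) f) w =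
        coeff (ins k (hom_part (s + 1) u) (p - s - k) (tens_part (p - s + 1) f)) w"
      if "s \<in> {1..p - 1}" "k \<in> {0..p - s}" for s k
      using that w by (auto simp: coeff_ins coeff_hom_part coeff_tens_part intro!: sum.cong)
    have "coeff (tens_part (p + 1) (der u f)) w =
        (\<Sum>(a, b)\<in>(SIGMA a:{..p + 1}. {..p + 1 - a}). coeff (ins a u b f) w)"
      by (simp add: coeff_tens_part w coeff_der sum.Sigma del: sum.atMost_Suc)
    also have "\<dots> = (\<Sum>(a, b) | 1 \<le> a + b \<and> a + b \<le> p - 1. coeff (ins a u b f) w)"
      by (rule sum.mono_neutral_right) (auto simp: w intro!: zero)
    also have "\<dots> = (\<Sum>(s, k)\<in>(SIGMA s:{1..p - 1}. {0..p - s}). coeff (ins k u (p - s - k) f) w)"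
      by (rule sum.reindex_bij_witness [of _ "\<lambda>(s, k). (k, p - s - k)" "\<lambda>(a, b). (p - a - b, a)"]) auto
    also have "\<dots> = (\<Sum>s = 1..p - 1. \<Sum>k = 0..p - s. coeff (ins k u (p - s - k) f) w)"
      by (simp add: sum.Sigma)
    also have "\<dots> = (\<Sum>s = 1..p - 1. \<Sum>k = 0..p - s.
        coeff (ins k (hom_part (s + 1) u) (p - s - k) (tens_part (p - s + 1) f)) w)"
      by (intro sum.cong refl part)
    finally show ?thesis
      by (simp add: coeff_sum)
  qed
qed

lemma eta_nth: "\<theta> \<in> Theta \<Longrightarrow> v \<in> TTheta \<Longrightarrow> eta p \<theta> [v] = hom_part (p + 1) (mc \<theta> v)"
  by (simp add: eta_def hom_part_def maurer_cartan_eq_mc)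

lemma poly_hom_eta:
  assumes "v \<in> TTheta"
  shows "poly_hom (\<lambda>\<theta>. eta p \<theta> [v])"
proof (rule poly_hom_cong)
  show "poly_hom (\<lambda>\<theta>. hom_part (p + 1) (mc \<theta> v))"
    unfolding poly_hom_def poly_tens_def
  proof (intro allI)
    fix i w
    show "poly_fun (\<lambda>\<theta>. coeff (hom_part (p + 1) (mc \<theta> v) $ i) w)"
      by (cases "length w = p + 1")
        (simp_all add: coeff_hom_part poly_fun.const poly_homD [OF poly_hom_mc])
  qed
qed (rule eta_nth [OF _ assms])

lemma deriv_hom_eta:
  assumes \<theta>: "\<theta> \<in> Theta" and x: "x \<in> TTheta" and y: "y \<in> TTheta"
  shows "deriv_hom x (\<lambda>\<theta>. eta p \<theta> [y]) \<theta> = hom_part (p + 1) (deriv_hom x (\<lambda>\<theta>. mc \<theta> y) \<theta>)"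
proof -
  have "deriv_hom x (\<lambda>\<theta>. eta p \<theta> [y]) \<theta> = deriv_hom x (\<lambda>\<theta>. hom_part (p + 1) (mc \<theta> y)) \<theta>"
    by (rule deriv_hom_cong [OF x \<theta>]) (rule eta_nth [OF _ y])
  then show ?thesis
    by (auto simp: vec_eq_iff deriv_hom_nth coeff_deriv_tens coeff_hom_part intro!: tens_eqI)
qed

lemma maurer_cartan_equation_eta:
  assumes \<theta>: "\<theta> \<in> Theta" and x: "x \<in> TTheta" and y: "y \<in> TTheta"
  shows "deriv_hom x (\<lambda>\<theta>. eta p \<theta> [y]) \<theta> - deriv_hom y (\<lambda>\<theta>. eta p \<theta> [x]) \<theta> =
    (\<Sum>s = 1..p - 1. \<Sum>k = 0..p - s. insert_hom k (eta s \<theta> [x]) (p - s - k) (eta (p - s) \<theta> [y])) -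
    (\<Sum>s = 1..p - 1. \<Sum>k = 0..p - s. insert_hom k (eta s \<theta> [y]) (p - s - k) (eta (p - s) \<theta> [x]))"
proof -
  have d: "tens_part (p + 1) (der (mc \<theta> x) (mc \<theta> y $ i)) =
      (\<Sum>s = 1..p - 1. \<Sum>k = 0..p - s. insert_hom k (eta s \<theta> [x]) (p - s - k) (eta (p - s) \<theta> [y])) $ i"
    if "x \<in> TTheta" "y \<in> TTheta" for x y i
    unfolding tens_part_der [OF mc_TTheta [OF \<theta> that(1)] TTheta_nth [OF mc_TTheta [OF \<theta> that(2)]]]
    using that by (simp add: insert_hom_nth eta_nth \<theta>) (simp add: hom_part_def)
  have "(deriv_hom x (\<lambda>\<theta>. eta p \<theta> [y]) \<theta> - deriv_hom y (\<lambda>\<theta>. eta p \<theta> [x]) \<theta>) =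
     hom_part (p + 1) (deriv_hom x (\<lambda>\<theta>. mc \<theta> y) \<theta> - deriv_hom y (\<lambda>\<theta>. mc \<theta> x) \<theta>)"
    unfolding deriv_hom_eta [OF \<theta> x y] deriv_hom_eta [OF \<theta> y x]
    by (auto simp: vec_eq_iff coeff_hom_part intro!: tens_eqI)
  also have "\<dots> = (\<chi> i. tens_part (p + 1) (der (mc \<theta> x) (mc \<theta> y $ i)) - tens_part (p + 1) (der (mc \<theta> y) (mc \<theta> x $ i)))"
    unfolding maurer_cartan_equation [OF \<theta> x y]
    by (auto simp: vec_eq_iff hom_part_def coeff_tens_part intro!: tens_eqI)
  also have "\<dots> = (\<Sum>s = 1..p - 1. \<Sum>k = 0..p - s. insert_hom k (eta s \<theta> [x]) (p - s - k) (eta (p - s) \<theta> [y])) -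
    (\<Sum>s = 1..p - 1. \<Sum>k = 0..p - s. insert_hom k (eta s \<theta> [y]) (p - s - k) (eta (p - s) \<theta> [x]))"
    by (simp only: vec_eq_iff vec_lambda_beta vector_minus_component d x y simp_thms)
  finally show ?thesis .
qed

section \<open>Forms\<close>

lemma length_omit: "i < length xs \<Longrightarrow> length (omit i xs) = length xs - 1"
  by (simp add: omit_def)

lemma nth_omit: "i < length xs \<Longrightarrow> j < length xs - 1 \<Longrightarrow> omit i xs ! j = (if j < i then xs ! j else xs ! Suc j)"
  by (simp add: omit_def nth_append min_def)

lemma set_omit: "set (omit i xs) \<subseteq> set xs"
  by (auto simp: omit_def dest: in_set_takeD in_set_dropD)

lemma insert_set_omit: "i < length xs \<Longrightarrow> insert (xs ! i) (set (omit i xs)) = set xs"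
  by (metis (no_types) Un_insert_right id_take_nth_drop list.simps(15) omit_def set_append)

lemma omit_update_same: "omit i (xs[i := x]) = omit i xs"
  by (simp add: omit_def)

lemma omit_update:
  assumes "i < length xs" "j < length xs" "i \<noteq> j"
  shows "omit i (xs[j := x]) = (omit i xs)[(if j < i then j else j - 1) := x]"
  using assms by (auto intro!: nth_equalityI simp: length_omit nth_omit nth_list_update)

lemma omit_adjacent:
  assumes "Suc i < length xs" "xs ! i = xs ! Suc i"
  shows "omit (Suc i) xs = omit i xs"
  using assms by (auto intro!: nth_equalityI simp: length_omit nth_omit less_Suc_eq)

lemma omit_omit:
  assumes "j < i" "i < length xs"
  shows "omit j (omit i xs) = omit (i - 1) (omit j xs)"
  using assms by (auto intro!: nth_equalityI simp: length_omit nth_omit)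

text \<open>Wedge products with two 1-forms and exterior derivatives of wedge products both have this shape,
  and only the part of \<open>A\<close> that is antisymmetric in its first two arguments matters.\<close>

definition omit2_sum :: "('v \<Rightarrow> 'v \<Rightarrow> 'v list \<Rightarrow> 'w::real_vector) \<Rightarrow> 'v list \<Rightarrow> 'w"
  where "omit2_sum A vs = (\<Sum>i<length vs. \<Sum>j<length vs - 1.
    (- 1) ^ (i + j) *\<^sub>R A (vs ! i) (omit i vs ! j) (omit j (omit i vs)))"

text \<open>The pair \<open>(i, j)\<close> removes position \<open>i\<close> and after that position
  \<open>j\<close> of what remains. \<open>?\<phi>\<close> gives the pair that removes the same two
  positions in the opposite order; its index sum differs by one, hence the sign.\<close>

lemma omit2_sum_swap:
  fixes A :: "'v \<Rightarrow> 'v \<Rightarrow> 'v list \<Rightarrow> 'w::real_vector"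
  shows "omit2_sum A vs = - omit2_sum (\<lambda>x y. A y x) vs"
proof -
  let ?n = "length vs"
  let ?\<phi> = "\<lambda>(i, j). if j < i then (j, i - 1) else (Suc j, i)"
  let ?t = "\<lambda>A (i, j). (- 1 :: real) ^ (i + j) *\<^sub>R A (vs ! i) (omit i vs ! j) (omit j (omit i vs))"
  have omit2_sum: "omit2_sum A vs = sum (?t A) ({..<?n} \<times> {..<?n - 1})" for A :: "'v \<Rightarrow> 'v \<Rightarrow> 'v list \<Rightarrow> 'w"
    by (simp add: omit2_sum_def sum.cartesian_product)
  have "sum (?t A) ({..<?n} \<times> {..<?n - 1}) = (\<Sum>x\<in>{..<?n} \<times> {..<?n - 1}. - ?t (\<lambda>x y. A y x) x)"
  proof (rule sum.reindex_bij_witness [of _ ?\<phi> ?\<phi>])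
    fix x assume x: "x \<in> {..<?n} \<times> {..<?n - 1}"
    obtain i j where [simp]: "x = (i, j)" by (cases x)
    have ij: "i < ?n" "j < ?n - 1" using x by auto
    show "?\<phi> (?\<phi> x) = x" using ij by auto
    show "?\<phi> x \<in> {..<?n} \<times> {..<?n - 1}" using ij by auto
    show "- ?t (\<lambda>x y. A y x) (?\<phi> x) = ?t A x"
    proof (cases "j < i")
      case True
      then have "(- 1 :: real) ^ (i + j) = - ((- 1) ^ (j + (i - 1)))"
        by (cases i) (auto simp: add.commute)
      moreover have "\<not> i - 1 < j" "Suc (i - 1) = i"
        using True by auto
      ultimately show ?thesis
        using True ij omit_omit [of j i vs] by (simp add: nth_omit)
    next
      case False
      then show ?thesis
        using ij omit_omit [of i "Suc j" vs] by (simp add: nth_omit add.commute)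
    qed
  qed (auto split: if_splits)
  then show ?thesis
    by (simp add: omit2_sum sum_negf)
qed

lemma omit2_sum_sum: "omit2_sum (\<lambda>x y r. \<Sum>s\<in>S. F s x y r) vs = (\<Sum>s\<in>S. omit2_sum (F s) vs)"
proof -
  have "omit2_sum (\<lambda>x y r. \<Sum>s\<in>S. F s x y r) vs = (\<Sum>i<length vs. \<Sum>s\<in>S. \<Sum>j<length vs - 1.
      (- 1) ^ (i + j) *\<^sub>R F s (vs ! i) (omit i vs ! j) (omit j (omit i vs)))"
    unfolding omit2_sum_def scaleR_sum_right by (intro sum.cong refl sum.swap)
  also have "\<dots> = (\<Sum>s\<in>S. omit2_sum (F s) vs)"
    unfolding omit2_sum_def by (rule sum.swap)
  finally show ?thesis .
qed

text \<open>By \<open>omit2_sum_swap\<close>, twice the sum is the sum formed with the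
  antisymmetrization of \<open>A\<close>.\<close>

lemma omit2_sum_antisym_cong:
  assumes "\<And>x y r. x \<in> set vs \<Longrightarrow> y \<in> set vs \<Longrightarrow> A x y r - A y x r = B x y r - B y x r"
  shows "omit2_sum A vs = omit2_sum B vs"
proof -
  have "omit2_sum A vs - omit2_sum (\<lambda>x y. A y x) vs = omit2_sum B vs - omit2_sum (\<lambda>x y. B y x) vs"
    unfolding omit2_sum_def sum_subtractf [symmetric] scaleR_diff_right [symmetric]
  proof (intro sum.cong refl arg_cong [of _ _ "scaleR _"] assms)
    fix i j assume ij: "i \<in> {..<length vs}" "j \<in> {..<length vs - 1}"
    then show "vs ! i \<in> set vs" by simp
    have "omit i vs ! j \<in> set (omit i vs)"
      using ij by (intro nth_mem) (simp add: length_omit)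
    then show "omit i vs ! j \<in> set vs"
      using set_omit by fast
  qed
  then have "2 *\<^sub>R omit2_sum A vs = 2 *\<^sub>R omit2_sum B vs"
    using omit2_sum_swap [of A vs] omit2_sum_swap [of B vs] by (simp add: scaleR_2)
  then show ?thesis by simp
qed

text \<open>Polarization at \<open>j\<close> and \<open>Suc j\<close> shows that exchanging these
  two entries changes the sign, which moves the repeated entry one place towards
  \<open>i\<close>.\<close>

lemma alternating_if_adjacent:
  fixes F :: "'v::ab_group_add list \<Rightarrow> 'w::ab_group_add"
  assumes add: "\<And>vs i x y. length vs = k \<Longrightarrow> set vs \<subseteq> S \<Longrightarrow> i < k \<Longrightarrow> x \<in> S \<Longrightarrow> y \<in> S \<Longrightarrow>
      F (vs[i := x + y]) = F (vs[i := x]) + F (vs[i := y])"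
    and adj: "\<And>vs i. length vs = k \<Longrightarrow> set vs \<subseteq> S \<Longrightarrow> Suc i < k \<Longrightarrow> vs ! i = vs ! Suc i \<Longrightarrow> F vs = 0"
    and S: "\<And>x y. x \<in> S \<Longrightarrow> y \<in> S \<Longrightarrow> x + y \<in> S"
  shows "i < j \<Longrightarrow> j < k \<Longrightarrow> length vs = k \<Longrightarrow> set vs \<subseteq> S \<Longrightarrow> vs ! i = vs ! j \<Longrightarrow> F vs = 0"
proof (induction j arbitrary: vs)
  case (Suc j)
  show ?case
  proof (cases "i = j")
    case True
    then show ?thesis using adj Suc.prems by auto
  next
    case False
    define x y where "x = vs ! j" and "y = vs ! Suc j"
    have xy: "x \<in> S" "y \<in> S"
      using Suc.prems by (auto simp: x_def y_def)
    let ?G = "\<lambda>x y. F (vs[j := x, Suc j := y])"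
    have sub: "set (vs[j := x, Suc j := y]) \<subseteq> S" if "x \<in> S" "y \<in> S" for x y
      using Suc.prems that by (meson set_update_subsetI)
    have sub1: "set (vs[i := x]) \<subseteq> S" if "x \<in> S" for x i
      using Suc.prems that by (meson set_update_subsetI)
    have diag: "?G x x = 0" if "x \<in> S" for x
      using Suc.prems that sub [OF that that] by (intro adj [of _ j]) auto
    have r: "?G x (y + z) = ?G x y + ?G x z" if "x \<in> S" "y \<in> S" "z \<in> S" for x y z
      using add [of "vs[j := x]" "Suc j" y z] sub1 Suc.prems that by simp
    have l: "?G (x + y) z = ?G x z + ?G y z" if "x \<in> S" "y \<in> S" "z \<in> S" for x y z
      using add [of "vs[Suc j := z]" j x y] sub1 Suc.prems that by (simp add: list_update_swap [of j])
    have "?G (x + y) (x + y) = (?G x x + ?G y x) + (?G x y + ?G y y)"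
      using xy by (simp add: l r S)
    then have "?G x y = - ?G y x"
      using xy by (simp add: diag S eq_neg_iff_add_eq_0 add.commute)
    moreover have "?G y x = 0"
      using Suc.prems False sub [OF xy(2,1)] by (intro Suc.IH) (auto simp: y_def)
    moreover have "vs[j := x, Suc j := y] = vs"
      by (simp add: x_def y_def)
    ultimately show ?thesis by simp
  qed
qed simp

definition finite_stage :: "nat \<Rightarrow> nat \<Rightarrow> ('n::finite) form \<Rightarrow> bool"
  where "finite_stage N k \<omega> \<longleftrightarrow> (\<forall>\<theta>\<in>Theta. \<forall>\<theta>'\<in>Theta. \<forall>vs vs'. length vs = k \<and> length vs' = k \<and>
       set vs \<subseteq> TTheta \<and> set vs' \<subseteq> TTheta \<and>
       (\<forall>i. \<theta> (gen i) - \<theta>' (gen i) \<in> tens_ge N) \<and>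
       (\<forall>j<k. \<forall>i. vs ! j $ i - vs' ! j $ i \<in> tens_ge N) \<longrightarrow> \<omega> \<theta> vs = \<omega> \<theta>' vs')"

lemma finite_stageD:
  assumes "finite_stage N k \<omega>" "\<theta> \<in> Theta" "\<theta>' \<in> Theta" "length vs = k" "length vs' = k"
    "set vs \<subseteq> TTheta" "set vs' \<subseteq> TTheta" "\<And>i. \<theta> (gen i) - \<theta>' (gen i) \<in> tens_ge N"
    "\<And>i j. j < k \<Longrightarrow> vs ! j $ i - vs' ! j $ i \<in> tens_ge N"
  shows "\<omega> \<theta> vs = \<omega> \<theta>' vs'"
  using assms unfolding finite_stage_def by simp

text \<open>A version of \<open>forms\<close> that is easier to establish: polynomial instead of
  smooth coefficients, and vanishing asked for only when adjacent arguments agree. Polynomial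
  coefficients are also what the product rules for derivatives require.\<close>

definition poly_forms :: "nat \<Rightarrow> nat \<Rightarrow> ('n::finite) form set"
  where "poly_forms k m = {\<omega>.
    (\<forall>\<theta> vs. \<not> (\<theta> \<in> Theta \<and> length vs = k \<and> set vs \<subseteq> TTheta) \<longrightarrow> \<omega> \<theta> vs = 0) \<and>
    (\<forall>\<theta> vs. \<omega> \<theta> vs \<in> Hom_deg m) \<and>
    (\<forall>\<theta>\<in>Theta. \<forall>vs. length vs = k \<and> set vs \<subseteq> TTheta \<longrightarrow>
       (\<forall>i<k. \<forall>x\<in>TTheta. \<forall>y\<in>TTheta. \<forall>c d.
          \<omega> \<theta> (vs[i := c *\<^sub>R x + d *\<^sub>R y]) = c *\<^sub>R \<omega> \<theta> (vs[i := x]) + d *\<^sub>R \<omega> \<theta> (vs[i := y])) \<and>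
       (\<forall>i. Suc i < k \<and> vs ! i = vs ! Suc i \<longrightarrow> \<omega> \<theta> vs = 0)) \<and>
    (\<forall>vs. length vs = k \<and> set vs \<subseteq> TTheta \<longrightarrow> poly_hom (\<lambda>\<theta>. \<omega> \<theta> vs)) \<and>
    (\<exists>N. finite_stage N k \<omega>)}"

lemma poly_forms_zero:
  "\<omega> \<in> poly_forms k m \<Longrightarrow> \<not> (\<theta> \<in> Theta \<and> length vs = k \<and> set vs \<subseteq> TTheta) \<Longrightarrow> \<omega> \<theta> vs = 0"
  by (simp add: poly_forms_def)

lemma poly_forms_Hom_deg: "\<omega> \<in> poly_forms k m \<Longrightarrow> \<omega> \<theta> vs \<in> Hom_deg m"
  by (simp add: poly_forms_def)

lemma poly_forms_linear:
  "\<omega> \<in> poly_forms k m \<Longrightarrow> \<theta> \<in> Theta \<Longrightarrow> length vs = k \<Longrightarrow> set vs \<subseteq> TTheta \<Longrightarrow> i < k \<Longrightarrow>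
    x \<in> TTheta \<Longrightarrow> y \<in> TTheta \<Longrightarrow>
    \<omega> \<theta> (vs[i := c *\<^sub>R x + d *\<^sub>R y]) = c *\<^sub>R \<omega> \<theta> (vs[i := x]) + d *\<^sub>R \<omega> \<theta> (vs[i := y])"
  by (simp add: poly_forms_def)

lemma poly_forms_adjacent:
  "\<omega> \<in> poly_forms k m \<Longrightarrow> \<theta> \<in> Theta \<Longrightarrow> length vs = k \<Longrightarrow> set vs \<subseteq> TTheta \<Longrightarrow> Suc i < k \<Longrightarrow>
    vs ! i = vs ! Suc i \<Longrightarrow> \<omega> \<theta> vs = 0"
  unfolding poly_forms_def by blast

lemma poly_forms_poly:
  "\<omega> \<in> poly_forms k m \<Longrightarrow> length vs = k \<Longrightarrow> set vs \<subseteq> TTheta \<Longrightarrow> poly_hom (\<lambda>\<theta>. \<omega> \<theta> vs)"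
  by (simp add: poly_forms_def)

lemma poly_forms_local: "\<omega> \<in> poly_forms k m \<Longrightarrow> \<exists>N. finite_stage N k \<omega>"
  by (simp add: poly_forms_def)

lemma poly_forms_subset_forms: "poly_forms k m \<subseteq> forms k m"
proof
  fix \<omega> :: "('n::finite) form" assume \<omega>: "\<omega> \<in> poly_forms k m"
  have lt: "\<omega> \<theta> vs = 0" if "\<theta> \<in> Theta" "length vs = k" "set vs \<subseteq> TTheta" "i < j" "j < k" "vs ! i = vs ! j"
    for \<theta> vs i j
  proof (rule alternating_if_adjacent [where k = k and S = TTheta and i = i and j = j])
    show "\<omega> \<theta> (vs[i := x + y]) = \<omega> \<theta> (vs[i := x]) + \<omega> \<theta> (vs[i := y])"
      if "length vs = k" "set vs \<subseteq> TTheta" "i < k" "x \<in> TTheta" "y \<in> TTheta" for vs i x y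
      using poly_forms_linear [OF \<omega> \<open>\<theta> \<in> Theta\<close> that, of 1 1] by simp
    show "\<omega> \<theta> vs = 0" if "length vs = k" "set vs \<subseteq> TTheta" "Suc i < k" "vs ! i = vs ! Suc i" for vs i
      by (rule poly_forms_adjacent [OF \<omega> \<open>\<theta> \<in> Theta\<close> that])
  qed (fact that TTheta_add)+
  have "\<omega> \<theta> vs = 0" if "\<theta> \<in> Theta" "length vs = k" "set vs \<subseteq> TTheta" "i < k" "j < k" "i \<noteq> j" "vs ! i = vs ! j"
    for \<theta> vs i j
    using lt [OF that(1-3), of i j] lt [OF that(1-3), of j i] that by (cases i j rule: linorder_cases) auto
  then show "\<omega> \<in> forms k m"
    unfolding forms_def mem_Collect_eq
    apply (intro conjI)
    subgoal using poly_forms_zero [OF \<omega>] by blast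
    subgoal using poly_forms_Hom_deg [OF \<omega>] by blast
    subgoal using poly_forms_linear [OF \<omega>] by blast
    subgoal by (intro allI impI poly_fun_smooth poly_homD poly_forms_poly [OF \<omega>]) auto
    subgoal using poly_forms_local [OF \<omega>] unfolding finite_stage_def .
    done
qed

lemma poly_forms_scaleR:
  assumes "\<omega> \<in> poly_forms k m"
  shows "(\<lambda>\<theta> vs. c *\<^sub>R \<omega> \<theta> vs) \<in> poly_forms k m"
proof -
  obtain N where N: "finite_stage N k \<omega>"
    using poly_forms_local [OF assms] by blast
  show ?thesis
    unfolding poly_forms_def mem_Collect_eq
    apply (intro conjI exI [of _ N])
    subgoal using poly_forms_zero [OF assms] by simp
    subgoal using poly_forms_Hom_deg [OF assms] by (simp add: Hom_deg_scaleR)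
    subgoal using poly_forms_linear [OF assms] poly_forms_adjacent [OF assms] by (simp add: algebra_simps) blast
    subgoal using poly_forms_poly [OF assms] by (simp add: poly_hom_scaleR)
    subgoal using N unfolding finite_stage_def by simp
    done
qed

lemma wedge_insert_poly_forms:
  assumes \<alpha>: "\<alpha> \<in> poly_forms 1 (q + 1)" and \<beta>: "\<beta> \<in> poly_forms k (a + b + 1)"
  shows "wedge_insert a \<alpha> b \<beta> \<in> poly_forms (Suc k) (a + q + b + 1)"
proof -
  let ?\<omega> = "wedge_insert a \<alpha> b \<beta>"
  have zero: "?\<omega> \<theta> vs = 0" if "\<not> (\<theta> \<in> Theta \<and> length vs = Suc k \<and> set vs \<subseteq> TTheta)" for \<theta> vs
    unfolding wedge_insert_def
  proof (intro sum.neutral ballI)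
    fix i assume "i \<in> {..<length vs}"
    then have i: "i < length vs" by simp
    \<comment> \<open>\<open>vs ! i\<close> and \<open>omit i vs\<close> together have the entries
      of \<open>vs\<close>, so an inadmissible \<open>vs\<close> makes the arguments of one of the
      two factors inadmissible.\<close>
    then have "\<not> (\<theta> \<in> Theta \<and> length [vs ! i] = 1 \<and> set [vs ! i] \<subseteq> TTheta) \<or>
        \<not> (\<theta> \<in> Theta \<and> length (omit i vs) = k \<and> set (omit i vs) \<subseteq> TTheta)"
      using that unfolding insert_set_omit [of i vs, OF i, symmetric] by (auto simp: length_omit)
    then have "\<alpha> \<theta> [vs ! i] = 0 \<or> \<beta> \<theta> (omit i vs) = 0"
      by (metis poly_forms_zero [OF \<alpha>] poly_forms_zero [OF \<beta>])
    then show "(- 1) ^ i *\<^sub>R insert_hom a (\<alpha> \<theta> [vs ! i]) b (\<beta> \<theta> (omit i vs)) = 0"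
      by auto
  qed
  have deg: "?\<omega> \<theta> vs \<in> Hom_deg (a + q + b + 1)" for \<theta> vs
    unfolding wedge_insert_def
    by (intro Hom_deg_sum Hom_deg_scaleR Hom_deg_insert_hom poly_forms_Hom_deg [OF \<alpha>] poly_forms_Hom_deg [OF \<beta>])
  have lin: "?\<omega> \<theta> (vs[j := c *\<^sub>R x + d *\<^sub>R y]) = c *\<^sub>R ?\<omega> \<theta> (vs[j := x]) + d *\<^sub>R ?\<omega> \<theta> (vs[j := y])"
    if \<theta>: "\<theta> \<in> Theta" and vs: "length vs = Suc k" "set vs \<subseteq> TTheta" and j: "j < Suc k"
      and x: "x \<in> TTheta" and y: "y \<in> TTheta" for \<theta> vs j x y c d
    unfolding wedge_insert_def scaleR_sum_right sum.distrib [symmetric] length_list_update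
  proof (rule sum.cong [OF refl])
    fix i assume "i \<in> {..<length vs}"
    then have i: "i < length vs" by simp
    let ?t = "\<lambda>z. insert_hom a (\<alpha> \<theta> [vs[j := z] ! i]) b (\<beta> \<theta> (omit i (vs[j := z])))"
    have "?t (c *\<^sub>R x + d *\<^sub>R y) = c *\<^sub>R ?t x + d *\<^sub>R ?t y"
    proof (cases "i = j")
      case True
      then show ?thesis
        using poly_forms_linear [OF \<alpha> \<theta>, of "[x]" 0 x y c d] x y i
        by (simp add: omit_update_same insert_hom_add_left insert_hom_scaleR_left)
    next
      case False
      have len: "length (omit i vs) = k" and sub: "set (omit i vs) \<subseteq> TTheta"
        using i vs set_omit [of i vs] by (auto simp: length_omit)
      have "(if j < i then j else j - 1) < k"
        using False j vs i by auto
      from poly_forms_linear [OF \<beta> \<theta> len sub this x y, of c d] show ?thesis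
        using False i j vs by (simp add: omit_update insert_hom_add_right insert_hom_scaleR_right)
    qed
    then show "(- 1) ^ i *\<^sub>R ?t (c *\<^sub>R x + d *\<^sub>R y) = c *\<^sub>R (- 1) ^ i *\<^sub>R ?t x + d *\<^sub>R (- 1) ^ i *\<^sub>R ?t y"
      by (simp add: scaleR_add_right mult.commute)
  qed
  have adj: "?\<omega> \<theta> vs = 0"
    if \<theta>: "\<theta> \<in> Theta" and vs: "length vs = Suc k" "set vs \<subseteq> TTheta" and i: "Suc i < Suc k" "vs ! i = vs ! Suc i"
    for \<theta> vs i
  proof -
    let ?t = "\<lambda>l. (- 1) ^ l *\<^sub>R insert_hom a (\<alpha> \<theta> [vs ! l]) b (\<beta> \<theta> (omit l vs))"
    \<comment> \<open>Removing any other entry leaves the two equal ones adjacent. Of the sum only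
      the summands \<open>i\<close> and \<open>Suc i\<close> remain, and these are opposite to each
      other.\<close>
    have "?t l = 0" if l: "l < length vs" "l \<noteq> i" "l \<noteq> Suc i" for l
    proof -
      have "\<beta> \<theta> (omit l vs) = 0"
      proof (rule poly_forms_adjacent [OF \<beta> \<theta>, of _ "if l < i then i - 1 else i"])
        show "length (omit l vs) = k" "set (omit l vs) \<subseteq> TTheta"
          using l vs set_omit [of l vs] by (auto simp: length_omit)
        show "Suc (if l < i then i - 1 else i) < k"
          using l vs i by auto
        show "omit l vs ! (if l < i then i - 1 else i) = omit l vs ! Suc (if l < i then i - 1 else i)"
          using l vs i by (auto simp: nth_omit)
      qed
      then show ?thesis by simp
    qed
    then have "?\<omega> \<theta> vs = sum ?t {i, Suc i}"
      unfolding wedge_insert_def using i vs by (intro sum.mono_neutral_right) auto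
    then show ?thesis
      using i vs omit_adjacent [of i vs] by simp
  qed
  have poly: "poly_hom (\<lambda>\<theta>. ?\<omega> \<theta> vs)" if "length vs = Suc k" "set vs \<subseteq> TTheta" for vs
    unfolding wedge_insert_def using that set_omit [of _ vs]
    by (intro poly_hom_sum poly_hom_scaleR poly_hom_insert_hom poly_forms_poly [OF \<alpha>] poly_forms_poly [OF \<beta>])
      (auto simp: length_omit)
  obtain M where M: "finite_stage M 1 \<alpha>"
    using poly_forms_local [OF \<alpha>] by blast
  obtain N where N: "finite_stage N k \<beta>"
    using poly_forms_local [OF \<beta>] by blast
  have loc: "?\<omega> \<theta> vs = ?\<omega> \<theta>' vs'"
    if \<theta>: "\<theta> \<in> Theta" "\<theta>' \<in> Theta" and len: "length vs = Suc k" "length vs' = Suc k"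
      and sub: "set vs \<subseteq> TTheta" "set vs' \<subseteq> TTheta"
      and eq: "\<And>i. \<theta> (gen i) - \<theta>' (gen i) \<in> tens_ge (max M N)"
        "\<And>i j. j < Suc k \<Longrightarrow> vs ! j $ i - vs' ! j $ i \<in> tens_ge (max M N)" for \<theta> \<theta>' vs vs'
  proof -
    have "\<alpha> \<theta> [vs ! i] = \<alpha> \<theta>' [vs' ! i]" if "i < Suc k" for i
      using that len sub
      by (intro finite_stageD [OF M] \<theta>) (auto intro: tens_ge_mono [OF eq(1)] tens_ge_mono [OF eq(2)])
    moreover have "\<beta> \<theta> (omit i vs) = \<beta> \<theta>' (omit i vs')" if "i < Suc k" for i
      using that len sub set_omit [of i vs] set_omit [of i vs']
      by (intro finite_stageD [OF N] \<theta>) (auto simp: length_omit nth_omit intro: tens_ge_mono [OF eq(1)] tens_ge_mono [OF eq(2)])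
    ultimately show ?thesis
      unfolding wedge_insert_def using len by simp
  qed
  show ?thesis
    unfolding poly_forms_def mem_Collect_eq
    apply (intro conjI exI [of _ "max M N"])
    subgoal using zero by blast
    subgoal using deg by blast
    subgoal using lin adj by blast
    subgoal using poly by blast
    subgoal using loc unfolding finite_stage_def by blast
    done
qed

lemma eta_poly_forms: "eta p \<in> poly_forms 1 (p + 1)"
proof -
  have lin: "eta p \<theta> [c *\<^sub>R x + d *\<^sub>R y] = c *\<^sub>R eta p \<theta> [x] + d *\<^sub>R eta p \<theta> [y]"
    if "\<theta> \<in> Theta" "x \<in> TTheta" "y \<in> TTheta" for \<theta> :: "'a point" and x y c d
    using that by (auto simp: eta_nth TTheta_add TTheta_scaleR mc_linear vec_eq_iff coeff_hom_part intro!: tens_eqI)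
  have loc: "eta p \<theta> [v] = eta p \<theta>' [v']"
    if "\<theta> \<in> Theta" "\<theta>' \<in> Theta" "v \<in> TTheta" "v' \<in> TTheta"
      "\<And>i. \<theta> (gen i) - \<theta>' (gen i) \<in> tens_ge (p + 2)" "\<And>i. v $ i - v' $ i \<in> tens_ge (p + 2)"
    for \<theta> \<theta>' :: "'a point" and v v'
    using mc_local [OF that] that(1-4)
    by (auto simp: eta_nth vec_eq_iff coeff_hom_part tens_ge_def intro!: tens_eqI)
  show ?thesis
    unfolding poly_forms_def mem_Collect_eq
    apply (intro conjI exI [of _ "p + 2"])
    subgoal by (auto simp: eta_def)
    subgoal by (auto simp: eta_def Hom_deg_iff coeff_tens_part)
    subgoal by (auto simp: length_Suc_conv lin)
    subgoal by (auto simp: length_Suc_conv poly_hom_eta)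
    subgoal unfolding finite_stage_def by (auto simp: length_Suc_conv simp del: add_2_eq_Suc' intro!: loc)
    done
qed

section \<open>Exterior derivatives of wedge products\<close>

lemma ext_deriv_eq:
  "ext_deriv \<omega> \<theta> vs = (if \<theta> \<in> Theta \<and> set vs \<subseteq> TTheta then
    \<Sum>i<length vs. (- 1) ^ i *\<^sub>R deriv_hom (vs ! i) (\<lambda>\<theta>'. \<omega> \<theta>' (omit i vs)) \<theta> else 0)"
  by (simp add: ext_deriv_def deriv_hom_def deriv_tens_def)

lemma deriv_hom_zero: "deriv_hom v (\<lambda>\<theta>. 0) \<theta> = 0"
  by (auto simp: vec_eq_iff deriv_hom_nth coeff_deriv_tens intro!: tens_eqI)

lemma ext_deriv_zero:
  assumes \<omega>: "\<omega> \<in> poly_forms k m" and "\<not> (\<theta> \<in> Theta \<and> length vs = Suc k \<and> set vs \<subseteq> TTheta)"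
  shows "ext_deriv \<omega> \<theta> vs = 0"
proof (cases "\<theta> \<in> Theta \<and> set vs \<subseteq> TTheta")
  case True
  then have "length vs \<noteq> Suc k"
    using assms by simp
  then have "(\<lambda>\<theta>'. \<omega> \<theta>' (omit i vs)) = (\<lambda>\<theta>'. 0)" if "i < length vs" for i
    using that by (intro ext poly_forms_zero [OF \<omega>]) (auto simp: length_omit)
  then show ?thesis
    by (simp add: ext_deriv_eq deriv_hom_zero)
qed (auto simp: ext_deriv_eq)

lemma ext_deriv_scaleR:
  assumes "\<omega> \<in> poly_forms k m"
  shows "ext_deriv (\<lambda>\<theta> vs. c *\<^sub>R \<omega> \<theta> vs) \<theta> vs = c *\<^sub>R ext_deriv \<omega> \<theta> vs"
proof (cases "\<theta> \<in> Theta \<and> length vs = Suc k \<and> set vs \<subseteq> TTheta")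
  case True
  have "deriv_hom (vs ! i) (\<lambda>\<theta>'. c *\<^sub>R \<omega> \<theta>' (omit i vs)) \<theta> = c *\<^sub>R deriv_hom (vs ! i) (\<lambda>\<theta>'. \<omega> \<theta>' (omit i vs)) \<theta>"
    if "i < length vs" for i
    using that True set_omit [of i vs]
    by (intro deriv_hom_scaleR poly_forms_poly [OF assms]) (auto simp: length_omit)
  then show ?thesis
    using True by (simp add: ext_deriv_eq scaleR_sum_right mult.commute del: sum.lessThan_Suc)
next
  case False
  then show ?thesis
    using ext_deriv_zero [OF assms False] ext_deriv_zero [OF poly_forms_scaleR [OF assms] False] by simp
qed

text \<open>Each derivative splits into a term on \<open>\<alpha>\<close> and a term on
  \<open>\<beta>\<close>. To form \<open>ext_deriv \<beta>\<close> in the latter, the vector that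
  differentiates and the vector fed to \<open>\<alpha>\<close> have to be exchanged, whence the
  minus sign. The former stays a double sum, because for \<open>eta\<close> only its
  antisymmetrization is known.\<close>

lemma ext_deriv_wedge_insert:
  assumes \<alpha>: "\<alpha> \<in> poly_forms 1 (q + 1)" and \<beta>: "\<beta> \<in> poly_forms k (a + b + 1)"
    and \<theta>: "\<theta> \<in> Theta" and vs: "set vs \<subseteq> TTheta" "length vs = Suc (Suc k)"
  shows "ext_deriv (wedge_insert a \<alpha> b \<beta>) \<theta> vs =
    omit2_sum (\<lambda>x y r. insert_hom a (deriv_hom x (\<lambda>\<theta>. \<alpha> \<theta> [y]) \<theta>) b (\<beta> \<theta> r)) vs -
    wedge_insert a \<alpha> b (ext_deriv \<beta>) \<theta> vs"
proof -
  let ?A = "\<lambda>x y r. insert_hom a (deriv_hom x (\<lambda>\<theta>. \<alpha> \<theta> [y]) \<theta>) b (\<beta> \<theta> r)"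
  let ?B = "\<lambda>x y r. insert_hom a (\<alpha> \<theta> [y]) b (deriv_hom x (\<lambda>\<theta>. \<beta> \<theta> r) \<theta>)"
  have len: "length (omit i vs) = Suc k" if "i < length vs" for i
    using that vs by (simp add: length_omit)
  have sub: "set (omit i vs) \<subseteq> TTheta" for i
    using vs set_omit by fast
  have T: "vs ! i \<in> TTheta" if "i < length vs" for i
    using that vs by auto
  have T': "omit i vs ! j \<in> TTheta" if "i < length vs" "j < length vs - 1" for i j
    using that vs sub [of i] len [of i] nth_mem [of j "omit i vs"] by auto
  have step: "deriv_hom (vs ! i) (\<lambda>\<theta>. wedge_insert a \<alpha> b \<beta> \<theta> (omit i vs)) \<theta> =
      (\<Sum>j<length vs - 1. (- 1) ^ j *\<^sub>R (?A (vs ! i) (omit i vs ! j) (omit j (omit i vs)) +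
        ?B (vs ! i) (omit i vs ! j) (omit j (omit i vs))))" if i: "i < length vs" for i
  proof -
    have pa: "poly_hom (\<lambda>\<theta>. \<alpha> \<theta> [omit i vs ! j])" if "j < Suc k" for j
      using that T' [OF i] vs by (intro poly_forms_poly [OF \<alpha>]) auto
    have pb: "poly_hom (\<lambda>\<theta>. \<beta> \<theta> (omit j (omit i vs)))" if "j < Suc k" for j
      using that len [OF i] sub [of i] set_omit [of j "omit i vs"]
      by (intro poly_forms_poly [OF \<beta>]) (auto simp: length_omit)
    have "deriv_hom (vs ! i) (\<lambda>\<theta>. \<Sum>j<Suc k. (- 1) ^ j *\<^sub>R insert_hom a (\<alpha> \<theta> [omit i vs ! j]) b
          (\<beta> \<theta> (omit j (omit i vs)))) \<theta> =
        (\<Sum>j<Suc k. deriv_hom (vs ! i) (\<lambda>\<theta>. (- 1) ^ j *\<^sub>R insert_hom a (\<alpha> \<theta> [omit i vs ! j]) b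
          (\<beta> \<theta> (omit j (omit i vs)))) \<theta>)"
      by (intro deriv_hom_sum T i \<theta> poly_hom_scaleR poly_hom_insert_hom pa pb) auto
    also have "\<dots> = (\<Sum>j<Suc k. (- 1) ^ j *\<^sub>R (?A (vs ! i) (omit i vs ! j) (omit j (omit i vs)) +
        ?B (vs ! i) (omit i vs ! j) (omit j (omit i vs))))"
      by (intro sum.cong refl) (simp add: deriv_hom_scaleR [OF T [OF i] \<theta>] poly_hom_insert_hom pa pb
          deriv_hom_insert_hom [OF T [OF i] \<theta>])
    finally show ?thesis
      unfolding wedge_insert_def len [OF i] using vs by simp
  qed
  have "ext_deriv (wedge_insert a \<alpha> b \<beta>) \<theta> vs = omit2_sum (\<lambda>x y r. ?A x y r + ?B x y r) vs"
    using \<theta> vs(1) by (simp add: ext_deriv_eq step omit2_sum_def power_add scaleR_sum_right del: sum.lessThan_Suc)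
  also have "\<dots> = omit2_sum ?A vs + omit2_sum ?B vs"
    by (simp add: omit2_sum_def scaleR_add_right sum.distrib)
  also have "omit2_sum ?B vs = - omit2_sum (\<lambda>x y r. ?B y x r) vs"
    by (rule omit2_sum_swap)
  also have "omit2_sum (\<lambda>x y r. ?B y x r) vs = wedge_insert a \<alpha> b (ext_deriv \<beta>) \<theta> vs"
    using \<theta> by (simp add: omit2_sum_def wedge_insert_def ext_deriv_eq sub len vs(2) insert_hom_sum_right
        insert_hom_scaleR_right power_add scaleR_sum_right del: sum.lessThan_Suc)
  finally show ?thesis by simp
qed

text \<open>The Maurer-Cartan equation gives the derivative of \<open>eta q\<close> after
  antisymmetrization, which is all that the double sum sees. \<open>insert_hom_nest\<close> turns
  the insertion of a composite into two successive insertions, hence into two successive wedge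
  products.\<close>

lemma ext_deriv_wedge_insert_eta:
  assumes \<beta>: "\<beta> \<in> poly_forms k (a + b + 1)"
    and \<theta>: "\<theta> \<in> Theta" and vs: "set vs \<subseteq> TTheta" "length vs = Suc (Suc k)"
  shows "ext_deriv (wedge_insert a (eta q) b \<beta>) \<theta> vs =
    (\<Sum>s = 1..q - 1. \<Sum>c = 0..q - s.
      wedge_insert (a + c) (eta s) (q - s - c + b) (wedge_insert a (eta (q - s)) b \<beta>) \<theta> vs) -
    wedge_insert a (eta q) b (ext_deriv \<beta>) \<theta> vs"
proof -
  let ?e = "\<lambda>p x. eta p \<theta> [x]"
  let ?R = "\<lambda>s c x y r. insert_hom (a + c) (?e s x) (q - s - c + b) (insert_hom a (?e (q - s) y) b (\<beta> \<theta> r))"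
  have nest: "?R s c x y r = insert_hom a (insert_hom c (?e s x) (q - s - c) (?e (q - s) y)) b (\<beta> \<theta> r)"
    if "s \<in> {1..q - 1}" "c \<in> {0..q - s}" for s c x y r
  proof -
    have "c + (q - s - c) = q - s" using that by simp
    then show ?thesis
      by (intro insert_hom_nest) (simp only: poly_forms_Hom_deg [OF eta_poly_forms])
  qed
  have "omit2_sum (\<lambda>x y r. insert_hom a (deriv_hom x (\<lambda>\<theta>. eta q \<theta> [y]) \<theta>) b (\<beta> \<theta> r)) vs =
      omit2_sum (\<lambda>x y r. \<Sum>s = 1..q - 1. \<Sum>c = 0..q - s. ?R s c x y r) vs"
  proof (rule omit2_sum_antisym_cong)
    fix x y r assume "x \<in> set vs" "y \<in> set vs"
    then have xy: "x \<in> TTheta" "y \<in> TTheta" using vs by auto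
    have R: "(\<Sum>s = 1..q - 1. \<Sum>c = 0..q - s. ?R s c x y r) =
        insert_hom a (\<Sum>s = 1..q - 1. \<Sum>c = 0..q - s. insert_hom c (?e s x) (q - s - c) (?e (q - s) y)) b (\<beta> \<theta> r)" for x y
      unfolding insert_hom_sum_left by (intro sum.cong refl nest)
    show "insert_hom a (deriv_hom x (\<lambda>\<theta>. eta q \<theta> [y]) \<theta>) b (\<beta> \<theta> r) -
        insert_hom a (deriv_hom y (\<lambda>\<theta>. eta q \<theta> [x]) \<theta>) b (\<beta> \<theta> r) =
        (\<Sum>s = 1..q - 1. \<Sum>c = 0..q - s. ?R s c x y r) - (\<Sum>s = 1..q - 1. \<Sum>c = 0..q - s. ?R s c y x r)"
      unfolding R insert_hom_diff_left [symmetric] maurer_cartan_equation_eta [OF \<theta> xy] ..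
  qed
  also have "\<dots> = (\<Sum>s = 1..q - 1. \<Sum>c = 0..q - s. omit2_sum (?R s c) vs)"
    by (simp only: omit2_sum_sum)
  also have "\<dots> = (\<Sum>s = 1..q - 1. \<Sum>c = 0..q - s.
      wedge_insert (a + c) (eta s) (q - s - c + b) (wedge_insert a (eta (q - s)) b \<beta>) \<theta> vs)"
    by (intro sum.cong refl) (simp add: omit2_sum_def wedge_insert_def length_omit insert_hom_sum_right
        insert_hom_scaleR_right power_add scaleR_sum_right del: sum.lessThan_Suc)
  finally show ?thesis
    by (simp only: ext_deriv_wedge_insert [OF eta_poly_forms \<beta> \<theta> vs])
qed

section \<open>The cochain on trees\<close>

definition scale_form :: "real \<Rightarrow> ('n::finite) form \<Rightarrow> 'n form"
  where "scale_form c \<omega> = (\<lambda>\<theta> vs. c *\<^sub>R \<omega> \<theta> vs)"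

lemma scale_form_scale_form [simp]: "scale_form c (scale_form d \<omega>) = scale_form (c * d) \<omega>"
  by (simp add: scale_form_def)

lemma scale_form_1 [simp]: "scale_form 1 \<omega> = \<omega>"
  by (simp add: scale_form_def)

lemma wedge_insert_scale_form: "wedge_insert a \<alpha> b (scale_form c \<beta>) = scale_form c (wedge_insert a \<alpha> b \<beta>)"
  by (intro ext) (simp add: wedge_insert_def scale_form_def insert_hom_scaleR_right scaleR_sum_right mult.commute)

lemma wedge_insert_twice:
  "wedge_insert a \<alpha> b (wedge_insert a' \<beta> b' \<omega>) \<theta> vs =
    omit2_sum (\<lambda>x y r. insert_hom a (\<alpha> \<theta> [x]) b (insert_hom a' (\<beta> \<theta> [y]) b' (\<omega> \<theta> r))) vs"
  by (simp add: omit2_sum_def wedge_insert_def length_omit insert_hom_sum_right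
        insert_hom_scaleR_right power_add scaleR_sum_right del: sum.lessThan_Suc)

text \<open>The values commute by \<open>insert_hom_commute\<close>, so only the exchange of two
  1-forms is felt.\<close>

lemma wedge_insert_anticommute:
  "wedge_insert (a + q1 + 1 + m) (eta q2) b (wedge_insert a (eta q1) (m + 1 + b) \<omega>) =
    scale_form (- 1) (wedge_insert a (eta q1) (m + q2 + 1 + b) (wedge_insert (a + 1 + m) (eta q2) b \<omega>))"
proof (intro ext)
  fix \<theta> vs
  show "wedge_insert (a + q1 + 1 + m) (eta q2) b (wedge_insert a (eta q1) (m + 1 + b) \<omega>) \<theta> vs =
    scale_form (- 1) (wedge_insert a (eta q1) (m + q2 + 1 + b) (wedge_insert (a + 1 + m) (eta q2) b \<omega>)) \<theta> vs"
    unfolding scale_form_def wedge_insert_twice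
    by (subst omit2_sum_swap)
      (simp only: insert_hom_commute [OF poly_forms_Hom_deg [OF eta_poly_forms] poly_forms_Hom_deg [OF eta_poly_forms]]
        scaleR_minus1_left)
qed

text \<open>One step of the recursion defining the cochain, where \<open>d\<close> is the number of nodes already present.\<close>

definition graft_form :: "nat \<Rightarrow> nat \<Rightarrow> nat \<Rightarrow> nat \<Rightarrow> ('n::finite) form \<Rightarrow> 'n form"
  where "graft_form d a q b \<omega> = scale_form ((- 1) ^ (a + (q + 1) * b + d)) (wedge_insert a (eta q) b \<omega>)"

lemma graft_form_scale_form: "graft_form d a q b (scale_form c \<omega>) = scale_form c (graft_form d a q b \<omega>)"
  by (simp add: graft_form_def wedge_insert_scale_form mult.commute)

text \<open>Besides the anticommutation of the forms, the prescribed exponents change, because each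
  insertion shifts the numbers of letters seen by the other. The total is the sign of exchanging
  cells of dimensions \<open>q1 - 1\<close> and \<open>q2 - 1\<close>, as product orientations
  demand.\<close>

lemma graft_form_commute:
  assumes "1 \<le> q1" "1 \<le> q2"
  shows "graft_form (Suc d) a q1 (m + q2 + 1 + b) (graft_form d (a + 1 + m) q2 b \<omega>) =
    scale_form ((- 1) ^ ((q1 - 1) * (q2 - 1)))
      (graft_form (Suc d) (a + q1 + 1 + m) q2 b (graft_form d a q1 (m + 1 + b) \<omega>))"
proof -
  \<comment> \<open>Successors replace the truncated differences, so that the identity of signs
    becomes one of parities.\<close>
  obtain r1 r2 where "q1 = Suc r1" "q2 = Suc r2"
    using assms by (metis Suc_diff_1 Suc_le_eq One_nat_def)
  then have "(- 1 :: real) ^ (a + (q1 + 1) * (m + q2 + 1 + b) + Suc d) * (- 1) ^ (a + 1 + m + (q2 + 1) * b + d) =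
      (- 1) ^ ((q1 - 1) * (q2 - 1)) * (- 1) ^ (a + q1 + 1 + m + (q2 + 1) * b + Suc d) *
      (- 1) ^ (a + (q1 + 1) * (m + 1 + b) + d) * (- 1)"
    by (simp add: minus_one_power_iff) auto
  then show ?thesis
    unfolding graft_form_def wedge_insert_scale_form wedge_insert_anticommute scale_form_scale_form
    by (simp add: mult.assoc)
qed

text \<open>The nodes are inserted in depth-first order, so that no choice is involved; in this order the
  exponent of the sign in \<open>face\<close> is zero at each step.\<close>

fun tree_form :: "ptree \<Rightarrow> nat \<Rightarrow> nat \<Rightarrow> nat \<Rightarrow> ('n::finite) form \<Rightarrow> 'n form"
  and tree_form_list :: "ptree list \<Rightarrow> nat \<Rightarrow> nat \<Rightarrow> nat \<Rightarrow> ('n::finite) form \<Rightarrow> 'n form" where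
  "tree_form Leaf d a b \<omega> = \<omega>"
| "tree_form (Node ts) d a b \<omega> = tree_form_list ts (Suc d) a b (graft_form d a (length ts - 1) b \<omega>)"
| "tree_form_list [] d a b \<omega> = \<omega>"
| "tree_form_list (t # ts) d a b \<omega> =
     tree_form_list ts (d + pdeg t) (a + leaves t) b (tree_form t d a (b + length ts) \<omega>)"

text \<open>The identity of H as a constant 0-form: the value attached to a bare leaf, from which
  the form of every tree is built up.\<close>

definition unit_form :: "('n::finite) form"
  where "unit_form = (\<lambda>\<theta> vs. if \<theta> \<in> Theta \<and> vs = [] then \<chi> i. monomial [i] else 0)"

definition Y_tree :: "ptree \<Rightarrow> ('n::finite) form"
  where "Y_tree t = tree_form t 0 0 0 unit_form"

abbreviation list_total :: "('a \<Rightarrow> nat) \<Rightarrow> 'a list \<Rightarrow> nat"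
  where "list_total f ts \<equiv> sum_list (map f ts)"

lemma ptree_list_induct [case_names Leaf Node Nil Cons]:
  assumes "P Leaf" and Node: "\<And>ts. Q ts \<Longrightarrow> P (Node ts)"
    and Q: "Q []" "\<And>t ts. P t \<Longrightarrow> Q ts \<Longrightarrow> Q (t # ts)"
  shows "P t" and "Q ts"
proof -
  show P: "P t" for t
  proof (induction t)
    case (Node ts)
    then have "Q ts" by (induction ts) (auto intro: Q)
    then show ?case by (rule assms)
  qed fact
  show "Q ts" by (induction ts) (auto intro: P Q)
qed

text \<open>The relation between dimension and number of nodes in additive form. Properness provides
  the bound that keeps the subtraction in \<open>pdim\<close> from being truncated.\<close>

lemma proper_dims:
  "proper t \<Longrightarrow> pdim t + pdeg t + 1 = leaves t"
  "list_all proper ts \<Longrightarrow> list_total pdim ts + list_total pdeg ts + length ts = list_total leaves ts"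
proof -
  have le: "proper t \<Longrightarrow> pdeg t + 1 \<le> leaves t" and "list_all proper ts \<Longrightarrow> list_total pdeg ts + length ts \<le> list_total leaves ts" for t ts
    by (induction t and ts rule: ptree_list_induct) auto
  then show t: "pdim t + pdeg t + 1 = leaves t" if "proper t" for t
    using le [OF that] by (simp add: pdim_def)
  show "list_all proper ts \<Longrightarrow> list_total pdim ts + list_total pdeg ts + length ts = list_total leaves ts"
  proof (induction ts)
    case (Cons u ts)
    then show ?case using t [of u] by simp
  qed simp
qed

lemma pdim_Node: "proper (Node ts) \<Longrightarrow> pdim (Node ts) = length ts - 2 + list_total pdim ts"
  using proper_dims(1) [of "Node ts"] proper_dims(2) [of ts] by simp

lemma tree_form_scale_form:
  "tree_form t d a b (scale_form c \<omega>) = scale_form c (tree_form t d a b \<omega>)"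
  "tree_form_list ts d a b (scale_form c \<omega>) = scale_form c (tree_form_list ts d a b \<omega>)"
  by (induction t and ts arbitrary: d a b \<omega> and d a b \<omega> rule: ptree_list_induct)
    (simp_all add: graft_form_scale_form)

text \<open>Moves an insertion at position \<open>a\<close> past all nodes of a tree to its right,
  with \<open>m\<close> letters in between. Each node costs the sign of
  \<open>graft_form_commute\<close>, and the exponents add up to \<open>q - 1\<close> times the
  dimension of the tree.\<close>

lemma graft_form_tree_form:
  fixes \<omega> :: "('n::finite) form"
  assumes q: "1 \<le> q"
  shows "proper t \<Longrightarrow> graft_form (d + pdeg t) a q (m + leaves t + b) (tree_form t d (a + 1 + m) b \<omega>) =
      scale_form ((- 1) ^ ((q - 1) * pdim t))
        (tree_form t (Suc d) (a + q + 1 + m) b (graft_form d a q (m + 1 + b) \<omega>))"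
    and "list_all proper ts \<Longrightarrow>
      graft_form (d + list_total pdeg ts) a q (m + list_total leaves ts + b) (tree_form_list ts d (a + 1 + m) b \<omega>) =
      scale_form ((- 1) ^ ((q - 1) * list_total pdim ts))
        (tree_form_list ts (Suc d) (a + q + 1 + m) b (graft_form d a q (m + length ts + b) \<omega>))"
proof (induction t and ts arbitrary: d m b \<omega> and d m b \<omega> rule: ptree_list_induct)
  case Leaf
  then show ?case by (simp add: pdim_def)
next
  case (Node ts)
  define p where "p = length ts - 1"
  have p: "1 \<le> p" "length ts = p + 1"
    using Node.prems by (auto simp: p_def)
  have "graft_form (d + pdeg (Node ts)) a q (m + leaves (Node ts) + b) (tree_form (Node ts) d (a + 1 + m) b \<omega>) =
    scale_form ((- 1) ^ ((q - 1) * list_total pdim ts))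
      (tree_form_list ts (Suc (Suc d)) (a + q + 1 + m) b
        (graft_form (Suc d) a q (m + p + 1 + b) (graft_form d (a + 1 + m) p b \<omega>)))"
    using Node.IH [of "Suc d" m b "graft_form d (a + 1 + m) p b \<omega>"] Node.prems p by (simp add: ac_simps)
  also have "\<dots> = scale_form ((- 1) ^ ((q - 1) * (p - 1 + list_total pdim ts)))
      (tree_form_list ts (Suc (Suc d)) (a + q + 1 + m) b
        (graft_form (Suc d) (a + q + 1 + m) p b (graft_form d a q (m + 1 + b) \<omega>)))"
    unfolding graft_form_commute [OF q p(1)] tree_form_scale_form
    by (simp add: power_add distrib_left mult.commute)
  also have "p - 1 + list_total pdim ts = pdim (Node ts)"
    using pdim_Node [OF Node.prems] p by simp
  finally show ?case
    by (simp add: p)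
next
  case Nil
  then show ?case by simp
next
  case (Cons t us)
  have 1: "graft_form (d + pdeg t) a q ((m + leaves t) + length us + b) (tree_form t d (a + 1 + m) (b + length us) \<omega>) =
    scale_form ((- 1) ^ ((q - 1) * pdim t))
      (tree_form t (Suc d) (a + q + 1 + m) (b + length us) (graft_form d a q (m + length (t # us) + b) \<omega>))"
    using Cons.IH(1) [of d m "b + length us" \<omega>] Cons.prems by (simp add: ac_simps)
  have 2: "graft_form (d + pdeg t + list_total pdeg us) a q ((m + leaves t) + list_total leaves us + b)
      (tree_form_list us (d + pdeg t) (a + 1 + (m + leaves t)) b \<omega>') =
    scale_form ((- 1) ^ ((q - 1) * list_total pdim us))
      (tree_form_list us (Suc (d + pdeg t)) (a + q + 1 + (m + leaves t)) b
        (graft_form (d + pdeg t) a q ((m + leaves t) + length us + b) \<omega>'))" for \<omega>' :: "'n form"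
    by (rule Cons.IH(2)) (use Cons.prems in auto)
  show ?case
    using 2 [of "tree_form t d (a + 1 + m) (b + length us) \<omega>", unfolded 1 tree_form_scale_form]
    by (simp add: ac_simps power_add distrib_left)
qed

section \<open>Grafting corollas onto trees\<close>

lemma length_graft_list [simp]: "length (graft_list a q ts) = length ts"
  by (induction ts arbitrary: a) auto

lemma tree_form_list_Leaf: "set ts \<subseteq> {Leaf} \<Longrightarrow> tree_form_list ts d a b \<omega> = \<omega>"
  by (induction ts arbitrary: d a b) auto

lemma tree_form_corolla: "tree_form (corolla q) d a b \<omega> = graft_form d a q b \<omega>"
  by (auto simp: corolla_def tree_form_list_Leaf simp del: replicate_Suc)

lemma graft_list_append:
  "graft_list a q (us @ vs) =
    (if a < list_total leaves us then graft_list a q us @ vs else us @ graft_list (a - list_total leaves us) q vs)"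
  by (induction us arbitrary: a) auto

lemma leaves_graft:
  "a < leaves t \<Longrightarrow> leaves (graft a q t) = leaves t + q"
  "a < list_total leaves ts \<Longrightarrow> list_total leaves (graft_list a q ts) = list_total leaves ts + q"
  by (induction t and ts arbitrary: a and a rule: ptree_list_induct)
    (auto simp: corolla_def sum_list_replicate)

lemma pdeg_graft:
  "a < leaves t \<Longrightarrow> pdeg (graft a q t) = Suc (pdeg t)"
  "a < list_total leaves ts \<Longrightarrow> list_total pdeg (graft_list a q ts) = Suc (list_total pdeg ts)"
  by (induction t and ts arbitrary: a and a rule: ptree_list_induct)
    (auto simp: corolla_def sum_list_replicate)

lemma proper_graft:
  assumes "1 \<le> q"
  shows "proper t \<Longrightarrow> proper (graft a q t)"
    and "list_all proper ts \<Longrightarrow> list_all proper (graft_list a q ts)"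
  using assms by (induction t and ts arbitrary: a and a rule: ptree_list_induct)
    (auto simp: corolla_def list_all_iff)

text \<open>In the depth-first product of the grafted tree the new factor sits in the middle. On its
  way to the end it passes exactly the factors counted by \<open>dim_after\<close>, so the sign is
  the one in \<open>face\<close>, and the depth-first form obeys the recursion of the cochain for
  every choice of the grafted node.\<close>

lemma tree_form_graft:
  assumes q: "1 \<le> q"
  shows "proper t \<Longrightarrow> a' < leaves t \<Longrightarrow> tree_form (graft a' q t) d a b \<omega> =
      scale_form ((- 1) ^ ((q - 1) * dim_after a' t))
        (graft_form (d + pdeg t) (a + a') q (leaves t - 1 - a' + b) (tree_form t d a b \<omega>))"
    and "list_all proper ts \<Longrightarrow> a' < list_total leaves ts \<Longrightarrow> tree_form_list (graft_list a' q ts) d a b \<omega> =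
      scale_form ((- 1) ^ ((q - 1) * dim_after_list a' ts))
        (graft_form (d + list_total pdeg ts) (a + a') q (list_total leaves ts - 1 - a' + b) (tree_form_list ts d a b \<omega>))"
proof (induction t and ts arbitrary: a' d a b \<omega> and a' d a b \<omega> rule: ptree_list_induct)
  case Leaf
  then show ?case by (simp add: tree_form_corolla)
next
  case (Node ts)
  then show ?case by simp
next
  case Nil
  then show ?case by simp
next
  case (Cons t us)
  show ?case
  proof (cases "a' < leaves t")
    case True
    define m where "m = leaves t - 1 - a'"
    have m: "leaves t = a' + 1 + m" using True by (simp add: m_def)
    have "tree_form_list (graft_list a' q (t # us)) d a b \<omega> =
      tree_form_list us (Suc (d + pdeg t)) (a + a' + q + 1 + m) b (tree_form (graft a' q t) d a (b + length us) \<omega>)"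
      using True by (simp add: leaves_graft pdeg_graft m ac_simps)
    also have "tree_form (graft a' q t) d a (b + length us) \<omega> =
      scale_form ((- 1) ^ ((q - 1) * dim_after a' t))
        (graft_form (d + pdeg t) (a + a') q (m + length us + b) (tree_form t d a (b + length us) \<omega>))"
      using Cons.IH(1) [of a' d a "b + length us" \<omega>] Cons.prems True by (simp add: m ac_simps)
    also have "tree_form_list us (Suc (d + pdeg t)) (a + a' + q + 1 + m) b \<dots> =
      scale_form ((- 1) ^ ((q - 1) * dim_after a' t)) (scale_form ((- 1) ^ ((q - 1) * list_total pdim us))
       (graft_form (d + pdeg t + list_total pdeg us) (a + a') q (m + list_total leaves us + b)
         (tree_form_list us (d + pdeg t) (a + a' + 1 + m) b (tree_form t d a (b + length us) \<omega>))))"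
      using graft_form_tree_form(2) [OF q, of us "d + pdeg t" "a + a'" m b "tree_form t d a (b + length us) \<omega>"] Cons.prems
      by (simp add: tree_form_scale_form flip: power_add mult_2)
    finally show ?thesis
      using True by (simp add: m ac_simps power_add distrib_left)
  next
    case False
    then show ?thesis
      using Cons.IH(2) [of "a' - leaves t" "d + pdeg t" "a + leaves t" b "tree_form t d a (b + length us) \<omega>"] Cons.prems
      by (simp add: ac_simps)
  qed
qed

text \<open>Descending into subtrees that are not leaves ends at a node whose children are all
  leaves, an innermost pair of parentheses; collapsing it to a leaf exhibits the tree as a
  graft.\<close>

lemma proper_cases_graft:
  assumes "proper t" "t \<noteq> Leaf"
  obtains a q t' where "t = graft a q t'" "proper t'" "a < leaves t'" "1 \<le> q"
proof -
  have "proper t \<Longrightarrow> t \<noteq> Leaf \<Longrightarrow> \<exists>a q t'. t = graft a q t' \<and> proper t' \<and> a < leaves t' \<and> 1 \<le> q" for t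
  proof (induction t)
    case (Node ts)
    show ?case
    proof (cases "\<exists>s\<in>set ts. s \<noteq> Leaf")
      case True
      then obtain us s vs where ts: "ts = us @ s # vs" and s: "s \<noteq> Leaf"
        by (meson split_list)
      with Node.IH [of s] Node.prems obtain a q s' where
        s': "s = graft a q s'" "proper s'" "a < leaves s'" "1 \<le> q" by auto
      show ?thesis
        \<comment> \<open>The leaves of the subtrees to the left of \<open>s\<close> shift the leaf
          number.\<close>
        by (rule exI [of _ "list_total leaves us + a"], rule exI [of _ q], rule exI [of _ "Node (us @ s' # vs)"])
          (use s' Node.prems in \<open>auto simp: ts graft_list_append\<close>)
    next
      case False
      then have eq: "ts = replicate (length ts) Leaf"
        by (metis replicate_length_same)
      have len: "length ts - 1 + 1 = length ts"
        using Node.prems by auto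
      have "Node ts = graft 0 (length ts - 1) Leaf"
        unfolding graft.simps corolla_def len by (rule arg_cong [OF eq])
      moreover have "1 \<le> length ts - 1"
        using Node.prems by auto
      ultimately show ?thesis
        by (intro exI [of _ 0] exI [of _ "length ts - 1"] exI [of _ Leaf] conjI) simp_all
    qed
  qed simp
  then show thesis using assms that by blast
qed

lemma proper_graft_induct [consumes 1, case_names Leaf graft]:
  assumes "proper t" "P Leaf"
    and step: "\<And>a q t. proper t \<Longrightarrow> a < leaves t \<Longrightarrow> 1 \<le> q \<Longrightarrow> P t \<Longrightarrow> P (graft a q t)"
  shows "P t"
  using assms(1)
proof (induction "pdeg t" arbitrary: t rule: less_induct)
  case less
  show ?case
  proof (cases "t = Leaf")
    case False
    with less.prems obtain a q t' where t: "t = graft a q t'" "proper t'" "a < leaves t'" "1 \<le> q"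
      by (rule proper_cases_graft)
    with less.hyps [of t'] step show ?thesis
      by (simp add: pdeg_graft)
  qed (simp add: assms)
qed

lemma unit_form_poly_forms: "unit_form \<in> poly_forms 0 1"
proof -
  have "poly_hom (\<lambda>\<theta>. unit_form \<theta> [])"
    by (rule poly_hom_cong [OF poly_hom_const [of "\<chi> i. monomial [i]"]]) (simp add: unit_form_def)
  then show ?thesis
    by (auto simp: poly_forms_def unit_form_def finite_stage_def Hom_deg_iff coeff_monomial)
qed

lemma insert_hom_unit: "insert_hom 0 u 0 (\<chi> i. monomial [i]) = u"
proof -
  have "coeff (ins 0 u 0 (monomial [j])) w = coeff (u $ j) w" for j w
    by (simp add: coeff_ins coeff_monomial if_distrib if_distribR cong: if_cong)
  then show ?thesis
    by (auto simp: vec_eq_iff insert_hom_nth intro!: tens_eqI)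
qed

lemma wedge_insert_unit_form: "wedge_insert 0 (eta p) 0 unit_form = eta p"
proof (intro ext)
  fix \<theta> :: "'a point" and vs :: "'a homs list"
  consider "vs = []" | v where "vs = [v]" | v v' ws where "vs = v # v' # ws"
    by (metis list.exhaust)
  then show "wedge_insert 0 (eta p) 0 unit_form \<theta> vs = eta p \<theta> vs"
  proof cases
    case 2
    then show ?thesis
      by (cases "\<theta> \<in> Theta") (auto simp: wedge_insert_def unit_form_def omit_def insert_hom_unit eta_def)
  next
    case 3
    have "omit i vs \<noteq> []" if "i < length vs" for i
      using that length_omit [of i vs] 3 by auto
    then show ?thesis
      using 3 by (auto simp: wedge_insert_def unit_form_def eta_def intro!: sum.neutral)
  qed (simp add: wedge_insert_def eta_def)
qed

lemma Y_tree_corolla: "Y_tree (corolla p) = eta p"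
  by (simp add: Y_tree_def tree_form_corolla graft_form_def wedge_insert_unit_form)

lemma Y_tree_graft:
  assumes "proper t" "a < leaves t" "1 \<le> q"
  shows "Y_tree (graft a q t) = scale_form ((- 1) ^ ((q - 1) * dim_after a t))
    (graft_form (pdeg t) a q (leaves t - 1 - a) (Y_tree t))"
  using tree_form_graft(1) [OF assms(3,1,2), of 0 0 0 unit_form] by (simp add: Y_tree_def)

lemma Y_tree_poly_forms: "proper t \<Longrightarrow> (Y_tree t :: ('n::finite) form) \<in> poly_forms (pdeg t) (leaves t)"
proof (induction t rule: proper_graft_induct)
  case Leaf
  then show ?case using unit_form_poly_forms by (simp add: Y_tree_def)
next
  case (graft a q t)
  let ?b = "leaves t - 1 - a"
  have "(Y_tree t :: 'n form) \<in> poly_forms (pdeg t) (a + ?b + 1)"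
    using graft by simp
  from wedge_insert_poly_forms [OF eta_poly_forms this, of q]
  show ?case
    using graft by (simp add: Y_tree_graft graft_form_def scale_form_def poly_forms_scaleR leaves_graft pdeg_graft ac_simps)
qed

text \<open>Whatever sequence of innermost pairs produced \<open>\<omega>\<close>, it is the
  depth-first form: the sign in \<open>face\<close> and the sign in \<open>Y_tree_graft\<close> are
  equal and cancel.\<close>

lemma Y_value_unique:
  assumes "Y_value w \<omega>"
  shows "proper (snd w) \<and> 2 \<le> leaves (snd w) \<and> \<omega> = scale_form (of_int (fst w)) (Y_tree (snd w))"
  using assms
proof (induction rule: Y_value.induct)
  case (top p e)
  then show ?case
    by (simp add: Y_tree_corolla scale_form_def) (simp add: corolla_def list_all_iff sum_list_replicate)
next
  case (face w y a b q)
  obtain e t where w: "w = (e, t)" by (cases w)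
  have t: "proper t" "leaves t = a + b + 1" and y: "y = scale_form (of_int e) (Y_tree t)"
    using face by (auto simp: w ocells_def)
  have "(\<lambda>\<theta> vs. (- 1) ^ (a + (q + 1) * b + pdeg (snd w)) *\<^sub>R wedge_insert a (eta q) b y \<theta> vs) =
      graft_form (pdeg t) a q b y"
    by (simp add: w graft_form_def scale_form_def)
  then show ?case
    using t face by (simp add: w y face_def proper_graft leaves_graft Y_tree_graft graft_form_scale_form mult.assoc
        flip: power_add mult_2)
qed

lemma Y_value_exists:
  assumes "proper t" "t \<noteq> Leaf" "e \<in> {1, - 1}"
  shows "\<exists>\<omega> :: ('n::finite) form. Y_value (e, t) \<omega>"
  using assms
proof (induction t arbitrary: e rule: proper_graft_induct)
  case (graft a q t)
  show ?case
  proof (cases "t = Leaf")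
    case True
    then show ?thesis using Y_value.top [of q e] graft by auto
  next
    case False
    define b where "b = leaves t - 1 - a"
    \<comment> \<open>The sign by which \<open>face\<close> multiplies is its own inverse, so a
      start from \<open>e'\<close> arrives at the orientation \<open>e\<close>.\<close>
    define e' where "e' = e * (- 1) ^ ((q - 1) * dim_after a t)"
    have e': "e' \<in> {1, - 1}"
      using graft.prems by (auto simp: e'_def minus_one_power_iff)
    obtain \<omega> :: "'n form" where \<omega>: "Y_value (e', t) \<omega>"
      using graft.IH [OF False e'] by blast
    have "proper t" "leaves t = a + b + 1"
      using graft.hyps by (simp_all add: b_def)
    moreover have "2 \<le> leaves t"
      using Y_value_unique [OF \<omega>] by simp
    ultimately have "(e', t) \<in> ocells (a + b)" "1 \<le> a + b"
      using e' by (auto simp: ocells_def)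
    from Y_value.face [OF \<omega> this graft.hyps(3)]
    show ?thesis
      by (auto simp: face_def e'_def mult.assoc simp flip: power_add mult_2)
  qed
qed simp

lemma Y_eq:
  assumes "proper t" "t \<noteq> Leaf" "e \<in> {1, - 1}"
  shows "Y (e, t) = (scale_form (of_int e) (Y_tree t) :: ('n::finite) form)"
proof -
  obtain \<omega> :: "'n form" where \<omega>: "Y_value (e, t) \<omega>"
    using Y_value_exists [OF assms] by blast
  then show ?thesis
    unfolding Y_def using Y_value_unique by (intro the_equality) fastforce+
qed

section \<open>The boundary of a grafted tree\<close>

text \<open>Linear extension of a function on cells to chains. The type of generators is left open,
  as chains of trees and chains of lists of trees both occur.\<close>

definition frag_eval :: "('a \<Rightarrow> 'b::real_vector) \<Rightarrow> ('a \<Rightarrow>\<^sub>0 int) \<Rightarrow> 'b"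
  where "frag_eval \<Phi> c = (\<Sum>t\<in>Poly_Mapping.keys c. of_int (Poly_Mapping.lookup c t) *\<^sub>R \<Phi> t)"

lemma frag_eval_superset:
  "finite S \<Longrightarrow> Poly_Mapping.keys c \<subseteq> S \<Longrightarrow>
    frag_eval \<Phi> c = (\<Sum>t\<in>S. of_int (Poly_Mapping.lookup c t) *\<^sub>R \<Phi> t)"
  unfolding frag_eval_def by (rule sum.mono_neutral_left) (auto simp: in_keys_iff)

lemma frag_eval_0 [simp]: "frag_eval \<Phi> 0 = 0"
  by (simp add: frag_eval_def)

lemma frag_eval_frag_of [simp]: "frag_eval \<Phi> (frag_of t) = \<Phi> t"
  by (simp add: frag_eval_def)

lemma frag_eval_add: "frag_eval \<Phi> (c + d) = frag_eval \<Phi> c + frag_eval \<Phi> d"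
proof -
  let ?S = "Poly_Mapping.keys c \<union> Poly_Mapping.keys d"
  have S: "finite ?S" by simp
  show ?thesis
    unfolding frag_eval_superset [OF S Poly_Mapping.keys_add] frag_eval_superset [OF S Un_upper1]
      frag_eval_superset [OF S Un_upper2]
    by (simp add: lookup_add scaleR_add_left sum.distrib)
qed

lemma frag_eval_cmul: "frag_eval \<Phi> (frag_cmul n c) = of_int n *\<^sub>R frag_eval \<Phi> c"
  unfolding frag_eval_superset [OF finite_keys keys_cmul] by (simp add: frag_eval_def scaleR_sum_right)

lemma frag_eval_sum: "frag_eval \<Phi> (sum f A) = (\<Sum>x\<in>A. frag_eval \<Phi> (f x))"
  by (induction A rule: infinite_finite_induct) (auto simp: frag_eval_add)

lemma frag_eval_extend: "frag_eval \<Phi> (frag_extend f c) = frag_eval (\<lambda>t. frag_eval \<Phi> (f t)) c"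
  unfolding frag_extend_def by (simp add: frag_eval_sum frag_eval_cmul frag_eval_def [of _ c])

lemma frag_eval_cong:
  "(\<And>t. t \<in> Poly_Mapping.keys c \<Longrightarrow> \<Phi> t = \<Psi> t) \<Longrightarrow> frag_eval \<Phi> c = frag_eval \<Psi> c"
  by (simp add: frag_eval_def)

lemma frag_eval_scaleR: "frag_eval (\<lambda>t. r *\<^sub>R \<Phi> t) c = r *\<^sub>R frag_eval \<Phi> c"
  by (simp add: frag_eval_def scaleR_sum_right mult.commute)

text \<open>A facet of the corolla factor of a node: the \<open>s + 1\<close> children from number
  \<open>k\<close> on, counted from \<open>0\<close>, are enclosed in a new pair of
  parentheses.\<close>

definition group_list :: "nat \<Rightarrow> nat \<Rightarrow> ptree list \<Rightarrow> ptree list"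
  where "group_list k s ts = take k ts @ Node (take (s + 1) (drop k ts)) # drop (k + s + 1) ts"

lemma frag_eval_bdry_Node:
  "frag_eval \<Phi> (bdry (Node ts)) =
    (\<Sum>s = 1..length ts - 1 - 1. \<Sum>k = 0..length ts - 1 - s.
      ((- 1) ^ ((s + 1) * (length ts - 1 + k) + k + 1) * (- 1) ^ ((s - 1) * list_total pdim (take k ts))) *\<^sub>R
        \<Phi> (Node (group_list k s ts))) +
    (- 1) ^ (length ts - 1 - 1) *\<^sub>R frag_eval (\<lambda>us. \<Phi> (Node us)) (bdry_list ts)"
  by (simp add: Let_def frag_eval_add frag_eval_sum frag_eval_cmul frag_eval_extend group_list_def)

lemma frag_eval_bdry_list_Cons:
  "frag_eval \<Phi> (bdry_list (t # ts)) = frag_eval (\<lambda>u. \<Phi> (u # ts)) (bdry t) +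
    (- 1) ^ pdim t *\<^sub>R frag_eval (\<lambda>us. \<Phi> (t # us)) (bdry_list ts)"
  by (simp add: frag_eval_add frag_eval_cmul frag_eval_extend)

section \<open>Trees occurring in a boundary\<close>

lemma keys_sum_subset:
  "(\<And>x. x \<in> A \<Longrightarrow> Poly_Mapping.keys (f x) \<subseteq> S) \<Longrightarrow> Poly_Mapping.keys (sum f A) \<subseteq> S"
  by (induction A rule: infinite_finite_induct) (auto dest!: subsetD [OF Poly_Mapping.keys_add])

lemma keys_bdry_Node:
  "Poly_Mapping.keys (bdry (Node ts)) \<subseteq>
    {Node (group_list k s ts) | k s. 1 \<le> s \<and> k + s \<le> length ts - 1 \<and> s < length ts - 1} \<union>
    Node ` Poly_Mapping.keys (bdry_list ts)" (is "_ \<subseteq> ?S \<union> ?T")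
proof -
  have "Poly_Mapping.keys (frag_cmul c (frag_of (Node (take k ts @ Node (take (s + 1) (drop k ts)) # drop (k + s + 1) ts)))) \<subseteq> ?S"
    if "s \<in> {1..length ts - 1 - 1}" "k \<in> {0..length ts - 1 - s}" for c k s
  proof -
    have "1 \<le> s \<and> k + s \<le> length ts - 1 \<and> s < length ts - 1"
      using that by auto
    then have "Node (group_list k s ts) \<in> ?S"
      by blast
    then show ?thesis
      by (intro order_trans [OF keys_cmul]) (simp add: group_list_def)
  qed
  then have 1: "Poly_Mapping.keys (\<Sum>s = 1..length ts - 1 - 1. \<Sum>k = 0..length ts - 1 - s.
      frag_cmul ((- 1) ^ ((s + 1) * (length ts - 1 + k) + k + 1) * (- 1) ^ ((s - 1) * list_total pdim (take k ts)))
        (frag_of (Node (take k ts @ Node (take (s + 1) (drop k ts)) # drop (k + s + 1) ts)))) \<subseteq> ?S"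
    by (intro keys_sum_subset)
  have "Poly_Mapping.keys (frag_extend (\<lambda>us. frag_of (Node us)) (bdry_list ts)) \<subseteq> ?T"
    by (rule order_trans [OF keys_frag_extend]) auto
  then have 2: "Poly_Mapping.keys (frag_cmul c (frag_extend (\<lambda>us. frag_of (Node us)) (bdry_list ts))) \<subseteq> ?T" for c
    by (rule order_trans [OF keys_cmul])
  show ?thesis
    unfolding bdry.simps Let_def by (rule order_trans [OF Poly_Mapping.keys_add Un_mono [OF 1 2]])
qed

lemma keys_bdry_list_Cons:
  "Poly_Mapping.keys (bdry_list (t # ts)) \<subseteq>
    (\<lambda>u. u # ts) ` Poly_Mapping.keys (bdry t) \<union> (\<lambda>us. t # us) ` Poly_Mapping.keys (bdry_list ts)"
proof -
  have 1: "Poly_Mapping.keys (frag_extend (\<lambda>u. frag_of (u # ts)) (bdry t)) \<subseteq> (\<lambda>u. u # ts) ` Poly_Mapping.keys (bdry t)"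
    by (rule order_trans [OF keys_frag_extend]) auto
  have "Poly_Mapping.keys (frag_extend (\<lambda>us. frag_of (t # us)) (bdry_list ts)) \<subseteq>
      (\<lambda>us. t # us) ` Poly_Mapping.keys (bdry_list ts)"
    by (rule order_trans [OF keys_frag_extend]) auto
  then have 2: "Poly_Mapping.keys (frag_cmul c (frag_extend (\<lambda>us. frag_of (t # us)) (bdry_list ts))) \<subseteq>
      (\<lambda>us. t # us) ` Poly_Mapping.keys (bdry_list ts)" for c
    by (rule order_trans [OF keys_cmul])
  show ?thesis
    unfolding bdry_list.simps by (rule order_trans [OF Poly_Mapping.keys_add Un_mono [OF 1 2]])
qed

lemma split_group:
  assumes "k + s + 1 \<le> length ts"
  obtains us ms vs where "ts = us @ ms @ vs" "length us = k" "length ms = s + 1"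
    "group_list k s ts = us @ Node ms # vs"
proof
  show "ts = take k ts @ take (s + 1) (drop k ts) @ drop (k + s + 1) ts"
    by (metis add.assoc add.commute append_take_drop_id drop_drop)
qed (use assms in \<open>auto simp: group_list_def\<close>)

text \<open>A facet keeps the leaves and gains one node. For lists the leaf counts are kept entry by
  entry, so the arity of a node whose subtrees are varied stays the same.\<close>

lemma keys_bdry:
  "proper t \<Longrightarrow> u \<in> Poly_Mapping.keys (bdry t) \<Longrightarrow>
    proper u \<and> leaves u = leaves t \<and> pdeg u = Suc (pdeg t)"
  "list_all proper ts \<Longrightarrow> us \<in> Poly_Mapping.keys (bdry_list ts) \<Longrightarrow>
    list_all proper us \<and> map leaves us = map leaves ts \<and> list_total pdeg us = Suc (list_total pdeg ts)"
proof (induction t and ts arbitrary: u and us rule: ptree_list_induct)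
  case (Node ts)
  from subsetD [OF keys_bdry_Node Node.prems(2)] show ?case
  proof
    assume "u \<in> {Node (group_list k s ts) | k s. 1 \<le> s \<and> k + s \<le> length ts - 1 \<and> s < length ts - 1}"
    then obtain k s where u: "u = Node (group_list k s ts)" and s: "1 \<le> s" "k + s \<le> length ts - 1" "s < length ts - 1"
      by blast
    then have "k + s + 1 \<le> length ts" by linarith
    then obtain xs ms ys where ts: "ts = xs @ ms @ ys" "length xs = k" "length ms = s + 1"
      and g: "group_list k s ts = xs @ Node ms # ys" by (rule split_group)
    have "list_all proper ts" using Node.prems by simp
    then show ?thesis
      using s by (simp add: u g) (auto simp: ts Suc_le_eq)
  next
    assume "u \<in> Node ` Poly_Mapping.keys (bdry_list ts)"
    then obtain us where us: "u = Node us" "us \<in> Poly_Mapping.keys (bdry_list ts)" by blast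
    have *: "list_all proper us \<and> map leaves us = map leaves ts \<and> list_total pdeg us = Suc (list_total pdeg ts)"
      using Node us by simp
    then have "length us = length ts" by (metis length_map)
    with * show ?thesis
      using Node.prems us by simp
  qed
next
  case (Cons t ts)
  from subsetD [OF keys_bdry_list_Cons Cons.prems(2)] show ?case
    using Cons.IH Cons.prems(1) by auto
qed auto

lemma pdim_keys_bdry_list:
  assumes "list_all proper ts" "us \<in> Poly_Mapping.keys (bdry_list ts)"
  shows "list_total pdim ts = Suc (list_total pdim us)"
proof -
  have us: "list_all proper us" "map leaves us = map leaves ts" "list_total pdeg us = Suc (list_total pdeg ts)"
    using keys_bdry(2) [OF assms] by auto
  then have "length us = length ts" by (metis length_map)
  then show ?thesis
    using proper_dims(2) [OF us(1)] proper_dims(2) [OF assms(1)] us(2,3) by simp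
qed

lemma pdim_graft:
  assumes "proper t" "a < leaves t" "1 \<le> q"
  shows "pdim (graft a q t) = pdim t + (q - 1)"
  using proper_dims(1) [OF assms(1)] proper_dims(1) [OF proper_graft(1) [OF assms(3,1)], of a] assms
  by (simp add: leaves_graft pdeg_graft)

lemma pdim_graft_list:
  assumes "list_all proper ts" "a < list_total leaves ts" "1 \<le> q"
  shows "list_total pdim (graft_list a q ts) = list_total pdim ts + (q - 1)"
  using proper_dims(2) [OF assms(1)] proper_dims(2) [OF proper_graft(2) [OF assms(3,1)], of a] assms
  by (simp add: leaves_graft pdeg_graft)

lemma dim_after_list_append:
  "dim_after_list a (us @ vs) = (if a < list_total leaves us then dim_after_list a us + list_total pdim vs
    else dim_after_list (a - list_total leaves us) vs)"
  by (induction us arbitrary: a) auto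

text \<open>Pulls a function on trees back along the face map: at a tree it gives the value of
  \<open>\<Phi>\<close> on \<open>face a q\<close> of the positively oriented cell, with the
  orientation sign as a factor.\<close>

definition graft_eval :: "nat \<Rightarrow> nat \<Rightarrow> (ptree \<Rightarrow> 'b::real_vector) \<Rightarrow> ptree \<Rightarrow> 'b"
  where "graft_eval a q \<Phi> t = (- 1) ^ ((q - 1) * dim_after a t) *\<^sub>R \<Phi> (graft a q t)"

definition graft_eval_list :: "nat \<Rightarrow> nat \<Rightarrow> (ptree list \<Rightarrow> 'b::real_vector) \<Rightarrow> ptree list \<Rightarrow> 'b"
  where "graft_eval_list a q \<Phi> ts = (- 1) ^ ((q - 1) * dim_after_list a ts) *\<^sub>R \<Phi> (graft_list a q ts)"

lemma graft_eval_Node: "graft_eval a q \<Phi> (Node ts) = graft_eval_list a q (\<lambda>us. \<Phi> (Node us)) ts"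
  by (simp add: graft_eval_def graft_eval_list_def)

lemma graft_eval_list_Cons_less:
  "a < leaves t \<Longrightarrow> graft_eval_list a q \<Phi> (t # ts) =
    (- 1) ^ ((q - 1) * list_total pdim ts) *\<^sub>R graft_eval a q (\<lambda>u. \<Phi> (u # ts)) t"
  by (simp add: graft_eval_def graft_eval_list_def power_add distrib_left mult.commute)

text \<open>Grafting at a leaf commutes with parenthesizing consecutive children, up to orientation.
  If the leaf precedes the new pair, the graft adds \<open>q - 1\<close> to the dimension that the
  new node passes, and the new node adds \<open>s - 1\<close> to the dimension that the graft
  passes; the two signs agree. If the leaf lies inside or behind, neither count changes.\<close>

lemma graft_eval_group_list:
  assumes ts: "list_all proper ts" and a: "a < list_total leaves ts" and q: "1 \<le> q"
    and ks: "1 \<le> s" "k + s + 1 \<le> length ts"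
  shows "((- 1) ^ ((q - 1) * dim_after_list a ts) * (- 1) ^ ((s - 1) * list_total pdim (take k (graft_list a q ts)))) *\<^sub>R
      \<Phi> (group_list k s (graft_list a q ts)) =
    (- 1) ^ ((s - 1) * list_total pdim (take k ts)) *\<^sub>R graft_eval_list a q \<Phi> (group_list k s ts)"
proof -
  obtain us ms vs where split: "ts = us @ ms @ vs" "length us = k" "length ms = s + 1"
    and g: "group_list k s ts = us @ Node ms # vs" using ks(2) by (rule split_group)
  have p: "list_all proper us" "list_all proper ms" "list_all proper vs"
    using ts by (auto simp: split)
  have group: "group_list k s (us' @ ms' @ vs') = us' @ Node ms' # vs'" "take k (us' @ ms' @ vs') = us'"
    if "length us' = k" "length ms' = s + 1" for us' ms' vs'
    using that by (simp_all add: group_list_def)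
  have [simp]: "pdim (Node ms) = s - 1 + list_total pdim ms"
    using pdim_Node [of ms] p(2) split(3) ks(1) by simp
  obtain q' s' where q': "q = Suc q'" and s': "s = Suc s'"
    using q ks(1) by (metis Suc_le_D One_nat_def)
  consider "a < list_total leaves us" | "list_total leaves us \<le> a" "a < list_total leaves us + list_total leaves ms"
    | "list_total leaves us + list_total leaves ms \<le> a"
    by linarith
  then show ?thesis
  proof cases
    case 1
    have gl: "graft_list a q ts = graft_list a q us @ ms @ vs"
      using 1 by (simp add: split graft_list_append)
    show ?thesis
      unfolding g gl group(1) [OF length_graft_list [THEN trans, OF split(2)] split(3)]
        group(2) [OF length_graft_list [THEN trans, OF split(2)] split(3)]
      using 1 q p split(2)
      by (simp add: graft_eval_list_def split(1) dim_after_list_append graft_list_append pdim_graft_list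
          q' s' algebra_simps flip: power_add)
  next
    case 2
    define a' where "a' = a - list_total leaves us"
    have "a' < list_total leaves ms"
      using 2 unfolding a'_def by linarith
    have gl: "graft_list a q ts = us @ graft_list a' q ms @ vs"
      using 2 \<open>a' < _\<close> by (simp add: split graft_list_append flip: a'_def)
    show ?thesis
      unfolding g gl group(1) [OF split(2) length_graft_list [THEN trans, OF split(3)]]
        group(2) [OF split(2) length_graft_list [THEN trans, OF split(3)]]
      using 2 split(2) \<open>a' < _\<close>
      by (simp add: graft_eval_list_def split(1) dim_after_list_append graft_list_append mult.commute flip: a'_def)
  next
    case 3
    define a' where "a' = a - list_total leaves us - list_total leaves ms"
    have "\<not> a - list_total leaves us < list_total leaves ms" "\<not> a < list_total leaves us"
      using 3 by linarith+
    note * = this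
    have gl: "graft_list a q ts = us @ ms @ graft_list a' q vs"
      using * by (simp add: split graft_list_append a'_def)
    show ?thesis
      unfolding g gl group(1) [OF split(2,3)] group(2) [OF split(2,3)]
      using * split(2)
      by (simp add: graft_eval_list_def split(1) dim_after_list_append graft_list_append a'_def mult.commute)
  qed
qed

text \<open>Both grafted factors move past \<open>ts\<close>, with weights \<open>q - s - 1\<close>
  and \<open>s - 1\<close>, whose sum has the parity of \<open>q\<close>.\<close>

lemma graft_eval_list_twice_Cons_less:
  assumes "a < leaves t" "1 \<le> s" "s < q" "k \<le> q - s"
  shows "graft_eval_list a (q - s) (graft_eval_list (a + k) s \<Phi>) (t # ts) =
    (- 1) ^ (q * list_total pdim ts) *\<^sub>R graft_eval a (q - s) (graft_eval (a + k) s (\<lambda>u. \<Phi> (u # ts))) t"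
proof -
  have "a + k < leaves (graft a (q - s) t)"
    using assms by (simp add: leaves_graft)
  moreover obtain s' r where "s = Suc s'" "q = s + Suc r"
    using assms by (metis Suc_le_D less_imp_Suc_add One_nat_def add_Suc_right)
  ultimately show ?thesis
    using assms(1) by (simp add: graft_eval_list_Cons_less graft_eval_def minus_one_power_iff)
qed

text \<open>The Leibniz rule for \<open>w \<times> K\<^sub>q\<^sub>+\<^sub>1\<close>, tested against an arbitrary cochain \<open>\<Phi>\<close>.\<close>

lemma frag_eval_bdry_graft:
  fixes \<Phi> :: "ptree \<Rightarrow> 'b::real_vector" and \<Psi> :: "ptree list \<Rightarrow> 'b"
  assumes q: "1 \<le> q"
  shows "proper t \<Longrightarrow> a < leaves t \<Longrightarrow>
      (- 1) ^ ((q - 1) * dim_after a t) *\<^sub>R frag_eval \<Phi> (bdry (graft a q t)) =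
      frag_eval (graft_eval a q \<Phi>) (bdry t) +
      (- 1) ^ pdim t *\<^sub>R (\<Sum>s = 1..q - 1. \<Sum>k = 0..q - s.
        (- 1) ^ ((s + 1) * (q + k) + k + 1) *\<^sub>R graft_eval a (q - s) (graft_eval (a + k) s \<Phi>) t)"
    and "list_all proper ts \<Longrightarrow> a < list_total leaves ts \<Longrightarrow>
      (- 1) ^ ((q - 1) * dim_after_list a ts) *\<^sub>R frag_eval \<Psi> (bdry_list (graft_list a q ts)) =
      frag_eval (graft_eval_list a q \<Psi>) (bdry_list ts) +
      (- 1) ^ list_total pdim ts *\<^sub>R (\<Sum>s = 1..q - 1. \<Sum>k = 0..q - s.
        (- 1) ^ ((s + 1) * (q + k) + k + 1) *\<^sub>R graft_eval_list a (q - s) (graft_eval_list (a + k) s \<Psi>) ts)"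
proof (induction t and ts arbitrary: a \<Phi> and a \<Psi> rule: ptree_list_induct)
  case Leaf
  have 0: "frag_eval \<Psi> (bdry_list (replicate n Leaf)) = 0" for n and \<Psi> :: "ptree list \<Rightarrow> 'b"
    by (induction n arbitrary: \<Psi>) (simp_all add: frag_eval_bdry_list_Cons del: bdry_list.simps(2))
  have dim: "pdim Leaf = 0" "list_total pdim (take k (replicate n Leaf)) = 0" for k n
    by (simp_all add: pdim_def take_replicate sum_list_replicate)
  have dim_after: "dim_after k (corolla n) = 0" for k n
  proof -
    have "dim_after_list k (replicate n Leaf) = 0" for n
      by (induction n arbitrary: k) (simp_all add: sum_list_replicate dim)
    then show ?thesis by (simp add: corolla_def del: replicate_Suc)
  qed
  have graft_rep: "graft_list k s (replicate (k + Suc n) Leaf) = replicate k Leaf @ corolla s # replicate n Leaf" for k s n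
    by (induction k) simp_all
  \<comment> \<open>Every facet of a corolla arises by two grafts onto a leaf: the outer corolla,
    followed by the inner one at leaf \<open>k\<close>.\<close>
  have graft: "graft k s (corolla (q - s)) = Node (group_list k s (replicate (q + 1) Leaf))"
    if "1 \<le> s" "s \<le> q - 1" "k \<le> q - s" for k s
  proof -
    from le_Suc_ex [OF that(3)] obtain n where n: "q - s = k + n" by blast
    then have q: "q = k + s + n" using that by linarith
    have "group_list k s (replicate (q + 1) Leaf) = replicate k Leaf @ corolla s # replicate n Leaf"
      by (simp add: group_list_def q corolla_def min_def del: replicate_Suc)
    then show ?thesis
      using graft_rep [of k s n] by (simp add: n corolla_def [of "k + n"] del: replicate_Suc)
  qed
  have "frag_eval \<Phi> (bdry (corolla q)) =
      (\<Sum>s = 1..q - 1. \<Sum>k = 0..q - s. (- 1) ^ ((s + 1) * (q + k) + k + 1) *\<^sub>R graft_eval a (q - s) (graft_eval (a + k) s \<Phi>) Leaf)"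
    unfolding corolla_def frag_eval_bdry_Node 0 length_replicate dim
    using Leaf.prems by (simp add: graft_eval_def dim_after graft del: replicate_Suc)
  then show ?case
    using Leaf.prems by (simp add: dim)
next
  case (Node ts)
  define p where "p = length ts - 1"
  have p: "1 \<le> p" "length ts = p + 1"
    using Node.prems by (auto simp: p_def)
  have ts: "list_all proper ts" "a < list_total leaves ts"
    using Node.prems by simp_all
  let ?gl = "graft_list a q ts"
  let ?sg = "(- 1 :: real) ^ ((q - 1) * dim_after_list a ts)"
  let ?E = "\<lambda>s k. (- 1 :: real) ^ ((s + 1) * (p + k) + k + 1)"
  let ?S = "\<Sum>s = 1..q - 1. \<Sum>k = 0..q - s.
        (- 1) ^ ((s + 1) * (q + k) + k + 1) *\<^sub>R graft_eval a (q - s) (graft_eval (a + k) s \<Phi>) (Node ts)"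
  have "?sg *\<^sub>R frag_eval \<Phi> (bdry (Node ?gl)) =
     (\<Sum>s = 1..p - 1. \<Sum>k = 0..p - s. ?E s k *\<^sub>R ((?sg * (- 1) ^ ((s - 1) * list_total pdim (take k ?gl))) *\<^sub>R
        \<Phi> (Node (group_list k s ?gl)))) +
     (- 1) ^ (p - 1) *\<^sub>R (?sg *\<^sub>R frag_eval (\<lambda>us. \<Phi> (Node us)) (bdry_list ?gl))"
    unfolding frag_eval_bdry_Node using p by (simp add: scaleR_add_right scaleR_sum_right ac_simps)
  also have "(\<Sum>s = 1..p - 1. \<Sum>k = 0..p - s. ?E s k *\<^sub>R ((?sg * (- 1) ^ ((s - 1) * list_total pdim (take k ?gl))) *\<^sub>R
        \<Phi> (Node (group_list k s ?gl)))) =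
      (\<Sum>s = 1..p - 1. \<Sum>k = 0..p - s. ?E s k *\<^sub>R ((- 1) ^ ((s - 1) * list_total pdim (take k ts)) *\<^sub>R
        graft_eval_list a q (\<lambda>us. \<Phi> (Node us)) (group_list k s ts)))"
  proof (intro sum.cong refl arg_cong [of _ _ "scaleR _"])
    fix s k assume "s \<in> {1..p - 1}" "k \<in> {0..p - s}"
    then have "1 \<le> s" "k + s + 1 \<le> length ts" using p by auto
    then show "(?sg * (- 1) ^ ((s - 1) * list_total pdim (take k ?gl))) *\<^sub>R \<Phi> (Node (group_list k s ?gl)) =
       (- 1) ^ ((s - 1) * list_total pdim (take k ts)) *\<^sub>R graft_eval_list a q (\<lambda>us. \<Phi> (Node us)) (group_list k s ts)"
      by (rule graft_eval_group_list [OF ts q])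
  qed
  also have "?sg *\<^sub>R frag_eval (\<lambda>us. \<Phi> (Node us)) (bdry_list ?gl) =
      frag_eval (\<lambda>us. graft_eval a q \<Phi> (Node us)) (bdry_list ts) + (- 1) ^ list_total pdim ts *\<^sub>R ?S"
    using Node.IH [OF ts, of "\<lambda>us. \<Phi> (Node us)"] by (simp add: graft_eval_Node)
  finally have "?sg *\<^sub>R frag_eval \<Phi> (bdry (Node ?gl)) =
     ((\<Sum>s = 1..p - 1. \<Sum>k = 0..p - s. ?E s k *\<^sub>R ((- 1) ^ ((s - 1) * list_total pdim (take k ts)) *\<^sub>R
        graft_eval a q \<Phi> (Node (group_list k s ts)))) +
     (- 1) ^ (p - 1) *\<^sub>R frag_eval (\<lambda>us. graft_eval a q \<Phi> (Node us)) (bdry_list ts)) +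
     (- 1) ^ (p - 1 + list_total pdim ts) *\<^sub>R ?S"
    unfolding graft_eval_Node by (simp add: scaleR_add_right power_add)
  \<comment> \<open>The signs collected from the corolla factor and from the subtrees make up that
    of passing the whole cell, as required in front of the boundary of the last factor.\<close>
  also have "p - 1 + list_total pdim ts = pdim (Node ts)"
    using pdim_Node [OF Node.prems(1)] p by simp
  also have "(\<Sum>s = 1..p - 1. \<Sum>k = 0..p - s. ?E s k *\<^sub>R ((- 1) ^ ((s - 1) * list_total pdim (take k ts)) *\<^sub>R
        graft_eval a q \<Phi> (Node (group_list k s ts)))) +
     (- 1) ^ (p - 1) *\<^sub>R frag_eval (\<lambda>us. graft_eval a q \<Phi> (Node us)) (bdry_list ts) =
     frag_eval (graft_eval a q \<Phi>) (bdry (Node ts))"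
    unfolding frag_eval_bdry_Node using p by simp
  finally show ?case by simp
next
  case Nil
  then show ?case by simp
next
  case (Cons t ts)
  have t: "proper t" and ts: "list_all proper ts"
    using Cons.prems by simp_all
  show ?case
  proof (cases "a < leaves t")
    case True
    let ?n = "list_total pdim ts"
    let ?\<Phi> = "\<lambda>u. \<Psi> (u # ts)"
    let ?S = "\<Sum>s = 1..q - 1. \<Sum>k = 0..q - s.
        (- 1) ^ ((s + 1) * (q + k) + k + 1) *\<^sub>R graft_eval a (q - s) (graft_eval (a + k) s ?\<Phi>) t"
    have S: "(\<Sum>s = 1..q - 1. \<Sum>k = 0..q - s. (- 1) ^ ((s + 1) * (q + k) + k + 1) *\<^sub>R
        graft_eval_list a (q - s) (graft_eval_list (a + k) s \<Psi>) (t # ts)) = (- 1) ^ (q * ?n) *\<^sub>R ?S"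
      unfolding scaleR_sum_right
    proof (intro sum.cong refl)
      fix s k assume "s \<in> {1..q - 1}" "k \<in> {0..q - s}"
      then have "1 \<le> s" "s < q" "k \<le> q - s" by auto
      from graft_eval_list_twice_Cons_less [OF True this, of \<Psi> ts]
      show "(- 1) ^ ((s + 1) * (q + k) + k + 1) *\<^sub>R graft_eval_list a (q - s) (graft_eval_list (a + k) s \<Psi>) (t # ts) =
        (- 1) ^ (q * ?n) *\<^sub>R (- 1) ^ ((s + 1) * (q + k) + k + 1) *\<^sub>R graft_eval a (q - s) (graft_eval (a + k) s ?\<Phi>) t"
        by (simp only: scaleR_scaleR mult.commute)
    qed
    have first: "frag_eval (\<lambda>u. graft_eval_list a q \<Psi> (u # ts)) (bdry t) =
        (- 1) ^ ((q - 1) * ?n) *\<^sub>R frag_eval (graft_eval a q ?\<Phi>) (bdry t)"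
      unfolding frag_eval_scaleR [symmetric]
      using keys_bdry(1) [OF t] True by (intro frag_eval_cong) (simp add: graft_eval_list_Cons_less)
    have second: "frag_eval (\<lambda>us. graft_eval_list a q \<Psi> (t # us)) (bdry_list ts) =
        ((- 1) ^ ((q - 1) * (dim_after a t + ?n)) * (- 1) ^ (q - 1)) *\<^sub>R
          frag_eval (\<lambda>us. \<Psi> (graft a q t # us)) (bdry_list ts)"
      unfolding frag_eval_scaleR [symmetric]
    proof (rule frag_eval_cong)
      fix us assume us: "us \<in> Poly_Mapping.keys (bdry_list ts)"
      \<comment> \<open>A boundary term \<open>us\<close> has one dimension less than
        \<open>ts\<close>, which changes the graft sign by \<open>(- 1) ^ (q - 1)\<close>. The same
        factor appears when the boundary operator passes \<open>graft a q t\<close> instead of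
        \<open>t\<close>.\<close>
      have "(- 1 :: real) ^ ((q - 1) * (dim_after a t + list_total pdim us)) =
          (- 1) ^ ((q - 1) * (dim_after a t + ?n)) * (- 1) ^ (q - 1)"
        unfolding pdim_keys_bdry_list [OF ts us] by (simp add: minus_one_power_iff)
      then show "graft_eval_list a q \<Psi> (t # us) =
          ((- 1) ^ ((q - 1) * (dim_after a t + ?n)) * (- 1) ^ (q - 1)) *\<^sub>R \<Psi> (graft a q t # us)"
        using True by (simp add: graft_eval_list_def)
    qed
    have "(- 1) ^ ((q - 1) * dim_after_list a (t # ts)) *\<^sub>R frag_eval \<Psi> (bdry_list (graft_list a q (t # ts))) =
      (- 1) ^ ((q - 1) * ?n) *\<^sub>R ((- 1) ^ ((q - 1) * dim_after a t) *\<^sub>R frag_eval ?\<Phi> (bdry (graft a q t))) +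
      ((- 1) ^ ((q - 1) * (dim_after a t + ?n)) * (- 1) ^ pdim (graft a q t)) *\<^sub>R
        frag_eval (\<lambda>us. \<Psi> (graft a q t # us)) (bdry_list ts)"
      using True by (simp add: frag_eval_bdry_list_Cons scaleR_add_right distrib_left power_add ac_simps
          del: bdry_list.simps(2))
    also have "(- 1) ^ ((q - 1) * dim_after a t) *\<^sub>R frag_eval ?\<Phi> (bdry (graft a q t)) =
        frag_eval (graft_eval a q ?\<Phi>) (bdry t) + (- 1) ^ pdim t *\<^sub>R ?S"
      by (rule Cons.IH(1) [OF t True])
    also have "((- 1) ^ ((q - 1) * (dim_after a t + ?n)) * (- 1) ^ pdim (graft a q t)) *\<^sub>R
        frag_eval (\<lambda>us. \<Psi> (graft a q t # us)) (bdry_list ts) =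
        (- 1) ^ pdim t *\<^sub>R frag_eval (\<lambda>us. graft_eval_list a q \<Psi> (t # us)) (bdry_list ts)"
      unfolding second pdim_graft [OF t True q] by (simp add: power_add ac_simps)
    also have "(- 1) ^ ((q - 1) * ?n) *\<^sub>R (frag_eval (graft_eval a q ?\<Phi>) (bdry t) + (- 1) ^ pdim t *\<^sub>R ?S) +
        (- 1) ^ pdim t *\<^sub>R frag_eval (\<lambda>us. graft_eval_list a q \<Psi> (t # us)) (bdry_list ts) =
        frag_eval (graft_eval_list a q \<Psi>) (bdry_list (t # ts)) + ((- 1) ^ ((q - 1) * ?n) * (- 1) ^ pdim t) *\<^sub>R ?S"
      unfolding frag_eval_bdry_list_Cons first by (simp add: scaleR_add_right)
    also have "(- 1 :: real) ^ ((q - 1) * ?n) * (- 1) ^ pdim t = (- 1) ^ list_total pdim (t # ts) * (- 1) ^ (q * ?n)"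
    proof -
      obtain r where "q = Suc r" using q by (metis Suc_le_D One_nat_def)
      then show ?thesis by (simp add: minus_one_power_iff)
    qed
    finally show ?thesis
      unfolding S by simp
  next
    case False
    let ?a = "a - leaves t"
    have a: "?a < list_total leaves ts"
      using Cons.prems False by simp
    let ?\<Psi> = "\<lambda>us. \<Psi> (t # us)"
    let ?S = "\<Sum>s = 1..q - 1. \<Sum>k = 0..q - s.
        (- 1) ^ ((s + 1) * (q + k) + k + 1) *\<^sub>R graft_eval_list ?a (q - s) (graft_eval_list (?a + k) s ?\<Psi>) ts"
    have S: "graft_eval_list a (q - s) (graft_eval_list (a + k) s \<Psi>) (t # ts) =
        graft_eval_list ?a (q - s) (graft_eval_list (?a + k) s ?\<Psi>) ts" for s k
      using False by (simp add: graft_eval_list_def)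
    have first: "frag_eval (\<lambda>u. graft_eval_list a q \<Psi> (u # ts)) (bdry t) =
        (- 1) ^ ((q - 1) * dim_after_list ?a ts) *\<^sub>R frag_eval (\<lambda>u. \<Psi> (u # graft_list ?a q ts)) (bdry t)"
      unfolding frag_eval_scaleR [symmetric]
      using keys_bdry(1) [OF t] False by (intro frag_eval_cong) (simp add: graft_eval_list_def)
    have second: "(\<lambda>us. graft_eval_list a q \<Psi> (t # us)) = graft_eval_list ?a q ?\<Psi>"
      using False by (auto simp: graft_eval_list_def)
    have "(- 1) ^ ((q - 1) * dim_after_list a (t # ts)) *\<^sub>R frag_eval \<Psi> (bdry_list (graft_list a q (t # ts))) =
      (- 1) ^ ((q - 1) * dim_after_list ?a ts) *\<^sub>R frag_eval (\<lambda>u. \<Psi> (u # graft_list ?a q ts)) (bdry t) +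
      (- 1) ^ pdim t *\<^sub>R ((- 1) ^ ((q - 1) * dim_after_list ?a ts) *\<^sub>R frag_eval ?\<Psi> (bdry_list (graft_list ?a q ts)))"
      using False by (simp add: frag_eval_bdry_list_Cons scaleR_add_right ac_simps del: bdry_list.simps(2))
    also have "\<dots> = frag_eval (graft_eval_list a q \<Psi>) (bdry_list (t # ts)) + (- 1) ^ list_total pdim (t # ts) *\<^sub>R ?S"
      unfolding Cons.IH(2) [OF ts a] frag_eval_bdry_list_Cons first second
      by (simp add: scaleR_add_right power_add)
    finally show ?thesis
      unfolding S .
  qed
qed

section \<open>The differential of the cochain\<close>

lemma wedge_insert_frag_eval:
  "wedge_insert a \<alpha> b (\<lambda>\<theta> vs. frag_eval (\<lambda>u. F u \<theta> vs) c) \<theta> vs =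
    frag_eval (\<lambda>u. wedge_insert a \<alpha> b (F u) \<theta> vs) c"
  unfolding wedge_insert_def frag_eval_def insert_hom_sum_right insert_hom_scaleR_right scaleR_sum_right
  by (subst sum.swap) (simp add: mult.commute)

lemma ext_deriv_unit_form: "ext_deriv unit_form \<theta> vs = 0"
proof (cases "\<theta> \<in> Theta \<and> length vs = Suc 0 \<and> set vs \<subseteq> TTheta")
  case True
  then obtain v where v: "vs = [v]" "v \<in> TTheta"
    by (auto simp: length_Suc_conv)
  have "deriv_hom v (\<lambda>\<theta>. unit_form \<theta> []) \<theta> = deriv_hom v (\<lambda>\<theta>. \<chi> i. monomial [i]) \<theta>"
    using True v by (intro deriv_hom_cong) (auto simp: unit_form_def)
  also have "\<dots> = 0"
    by (auto simp: vec_eq_iff deriv_hom_nth coeff_deriv_tens intro!: tens_eqI)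
  finally show ?thesis
    by (simp add: ext_deriv_eq v omit_def)
qed (use ext_deriv_zero [OF unit_form_poly_forms] in simp)

lemma graft_eval_Y_tree:
  assumes "proper t" "a < leaves t" "1 \<le> q"
  shows "graft_eval a q (\<lambda>u. Y_tree u \<theta> vs) t = graft_form (pdeg t) a q (leaves t - 1 - a) (Y_tree t) \<theta> vs"
  using assms by (simp add: graft_eval_def Y_tree_graft) (simp add: scale_form_def flip: mult.assoc power_add mult_2)

lemma graft_form_scale:
  "graft_form d a q b \<omega> \<theta> vs = (- 1) ^ (a + (q + 1) * b + d) *\<^sub>R wedge_insert a (eta q) b \<omega> \<theta> vs"
  by (simp add: graft_form_def scale_form_def)

text \<open>Here the signs of the boundary formula meet those of the cochain. The signs from
  \<open>dim_after\<close> occur in pairs and cancel. What is left, \<open>(- 1) ^ pdim t\<close>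
  times the boundary sign times the signs of two insertions, is the sign of a single insertion of
  \<open>eta q\<close>, whatever \<open>s\<close> and \<open>k\<close> are.\<close>

lemma graft_eval_twice_Y_tree:
  assumes t: "proper t" "a < leaves t" and s: "1 \<le> s" "s < q" "k \<le> q - s"
  shows "(- 1) ^ pdim t *\<^sub>R ((- 1) ^ ((s + 1) * (q + k) + k + 1) *\<^sub>R
      graft_eval a (q - s) (graft_eval (a + k) s (\<lambda>u. Y_tree u \<theta> vs)) t) =
    (- 1) ^ (a + (q + 1) * (leaves t - 1 - a) + pdeg t) *\<^sub>R
      wedge_insert (a + k) (eta s) (q - s - k + (leaves t - 1 - a))
        (wedge_insert a (eta (q - s)) (leaves t - 1 - a) (Y_tree t)) \<theta> vs"
proof -
  define b where "b = leaves t - 1 - a"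
  obtain r where r: "q - s = k + r" using s(3) le_Suc_ex by blast
  then have q: "q = s + k + r" using s by linarith
  let ?w = "graft a (q - s) t"
  have w: "proper ?w" "leaves ?w = leaves t + (q - s)" "pdeg ?w = Suc (pdeg t)" "a + k < leaves ?w"
    using t s by (simp_all add: proper_graft leaves_graft pdeg_graft)
  have "graft_eval a (q - s) (graft_eval (a + k) s (\<lambda>u. Y_tree u \<theta> vs)) t =
      (- 1) ^ ((q - s - 1) * dim_after a t) *\<^sub>R
        graft_form (Suc (pdeg t)) (a + k) s (r + b) (Y_tree ?w) \<theta> vs"
    using graft_eval_Y_tree [OF w(1,4) s(1)] w(2,3) t(2) r
    by (simp add: graft_eval_def [of a] b_def add.commute)
  also have "\<dots> = graft_form (Suc (pdeg t)) (a + k) s (r + b) (graft_form (pdeg t) a (q - s) b (Y_tree t)) \<theta> vs"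
  proof -
    have Yw: "Y_tree ?w = scale_form ((- 1) ^ ((q - s - 1) * dim_after a t)) (graft_form (pdeg t) a (q - s) b (Y_tree t))"
      unfolding b_def using s by (intro Y_tree_graft t) simp
    show ?thesis
      unfolding Yw graft_form_scale_form by (simp add: scale_form_def flip: power_add mult_2)
  qed
  also have "\<dots> = ((- 1) ^ (a + k + (s + 1) * (r + b) + Suc (pdeg t)) * (- 1) ^ (a + (q - s + 1) * b + pdeg t)) *\<^sub>R
      wedge_insert (a + k) (eta s) (r + b) (wedge_insert a (eta (q - s)) b (Y_tree t)) \<theta> vs"
    by (simp add: graft_form_def wedge_insert_scale_form) (simp add: scale_form_def)
  finally have eq: "graft_eval a (q - s) (graft_eval (a + k) s (\<lambda>u. Y_tree u \<theta> vs)) t = \<dots>" .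
  \<comment> \<open>Trades the dimension for the number of nodes, the quantity in which the
    exponents of the cochain are written.\<close>
  have "pdim t + pdeg t = a + b"
    using proper_dims(1) [OF t(1)] t(2) by (simp add: b_def)
  then have "even (pdim t) = even (a + b + pdeg t)"
    by presburger
  then have "(- 1 :: real) ^ pdim t * ((- 1) ^ ((s + 1) * (q + k) + k + 1) *
      ((- 1) ^ (a + k + (s + 1) * (r + b) + Suc (pdeg t)) * (- 1) ^ (a + (q - s + 1) * b + pdeg t))) =
      (- 1) ^ (a + (q + 1) * b + pdeg t)"
    unfolding r unfolding q by (simp add: minus_one_power_iff) auto
  then show ?thesis
    unfolding eq b_def [symmetric] scaleR_scaleR by (simp only: r add_diff_cancel_left')
qed

lemma ext_deriv_Y_tree:
  "proper t \<Longrightarrow> ext_deriv (Y_tree t :: ('n::finite) form) = (\<lambda>\<theta> vs. frag_eval (\<lambda>u. Y_tree u \<theta> vs) (bdry t))"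
proof (induction t rule: proper_graft_induct)
  case Leaf
  then show ?case by (simp add: Y_tree_def ext_deriv_unit_form)
next
  case (graft a q t)
  note t = graft.hyps(1,2) and q = graft.hyps(3)
  define b where "b = leaves t - 1 - a"
  let ?d = "pdeg t" and ?w = "graft a q t"
  have w: "proper ?w" "pdeg ?w = Suc ?d"
    using t q by (simp_all add: proper_graft pdeg_graft)
  show ?case
  proof (intro ext)
    fix \<theta> :: "'n point" and vs :: "'n homs list"
    let ?\<Phi> = "\<lambda>u. Y_tree u \<theta> vs"
    show "ext_deriv (Y_tree ?w) \<theta> vs = frag_eval ?\<Phi> (bdry ?w)"
    proof (cases "\<theta> \<in> Theta \<and> length vs = Suc (Suc ?d) \<and> set vs \<subseteq> TTheta")
      case False
      have "Y_tree u \<theta> vs = 0" if "u \<in> Poly_Mapping.keys (bdry ?w)" for u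
        using keys_bdry(1) [OF w(1) that] w(2) False by (intro poly_forms_zero [OF Y_tree_poly_forms]) auto
      then have "frag_eval ?\<Phi> (bdry ?w) = 0"
        by (simp add: frag_eval_def)
      then show ?thesis
        using ext_deriv_zero [OF Y_tree_poly_forms [OF w(1)]] w(2) False by auto
    next
      case True
      let ?E = "(- 1 :: real) ^ (a + (q + 1) * b + ?d)" and ?\<sigma> = "(- 1 :: real) ^ ((q - 1) * dim_after a t)"
      let ?W = "wedge_insert a (eta q) b (Y_tree t) :: 'n form"
      have Yt: "(Y_tree t :: 'n form) \<in> poly_forms ?d (a + b + 1)"
        using Y_tree_poly_forms [OF t(1)] t(2) by (simp add: b_def)
      have W: "?W \<in> poly_forms (Suc ?d) (a + q + b + 1)"
        by (rule wedge_insert_poly_forms [OF eta_poly_forms Yt])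
      \<comment> \<open>A tree in the boundary has one node more than \<open>t\<close>, and the
        number of nodes enters the exponent: this is the minus sign in the rule for differentiating
        a wedge product with a 1-form.\<close>
      have "graft_eval a q ?\<Phi> u = (- ?E) *\<^sub>R wedge_insert a (eta q) b (Y_tree u) \<theta> vs"
        if "u \<in> Poly_Mapping.keys (bdry t)" for u
      proof -
        have "graft_eval a q ?\<Phi> u = graft_form (Suc ?d) a q b (Y_tree u) \<theta> vs"
          using keys_bdry(1) [OF t(1) that] graft_eval_Y_tree [of u a q \<theta> vs] t(2) q
          by (simp add: b_def)
        then show ?thesis
          by (simp add: graft_form_scale)
      qed
      then have "frag_eval (graft_eval a q ?\<Phi>) (bdry t) =
          (- ?E) *\<^sub>R frag_eval (\<lambda>u. wedge_insert a (eta q) b (Y_tree u) \<theta> vs) (bdry t)"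
        unfolding frag_eval_scaleR [symmetric] by (rule frag_eval_cong)
      also have "\<dots> = (- ?E) *\<^sub>R wedge_insert a (eta q) b (ext_deriv (Y_tree t)) \<theta> vs"
        unfolding graft.IH wedge_insert_frag_eval ..
      finally have 1: "frag_eval (graft_eval a q ?\<Phi>) (bdry t) = (- ?E) *\<^sub>R wedge_insert a (eta q) b (ext_deriv (Y_tree t)) \<theta> vs" .
      have 2: "(- 1) ^ pdim t *\<^sub>R (\<Sum>s = 1..q - 1. \<Sum>k = 0..q - s.
          (- 1) ^ ((s + 1) * (q + k) + k + 1) *\<^sub>R graft_eval a (q - s) (graft_eval (a + k) s ?\<Phi>) t) =
          ?E *\<^sub>R (\<Sum>s = 1..q - 1. \<Sum>k = 0..q - s.
            wedge_insert (a + k) (eta s) (q - s - k + b) (wedge_insert a (eta (q - s)) b (Y_tree t)) \<theta> vs)"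
        unfolding scaleR_sum_right [where a = "(- 1) ^ pdim t"] scaleR_sum_right [where a = ?E] unfolding b_def
        by (intro sum.cong refl graft_eval_twice_Y_tree [OF t]) auto
      have "?\<sigma> *\<^sub>R frag_eval ?\<Phi> (bdry ?w) = ?E *\<^sub>R ext_deriv ?W \<theta> vs"
        unfolding frag_eval_bdry_graft(1) [OF q t] 1 2
        using True by (simp add: ext_deriv_wedge_insert_eta [OF Yt] scaleR_diff_right)
      \<comment> \<open>\<open>?\<sigma>\<close> is its own inverse, and it also stands in front of
        the form in \<open>Y_tree ?w\<close>.\<close>
      then have "?\<sigma> *\<^sub>R ?\<sigma> *\<^sub>R frag_eval ?\<Phi> (bdry ?w) = (?\<sigma> * ?E) *\<^sub>R ext_deriv ?W \<theta> vs"
        by simp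
      moreover have "?\<sigma> *\<^sub>R ?\<sigma> *\<^sub>R frag_eval ?\<Phi> (bdry ?w) = frag_eval ?\<Phi> (bdry ?w)"
        by (simp flip: power_add mult_2)
      moreover have "Y_tree ?w = (\<lambda>\<theta> vs. (?\<sigma> * ?E) *\<^sub>R ?W \<theta> vs)"
        unfolding Y_tree_graft [OF t q] graft_form_def b_def by (simp add: scale_form_def)
      ultimately show ?thesis
        by (simp only: ext_deriv_scaleR [OF W])
    qed
  qed
qed

lemma ocells_imp:
  assumes "(e, t) \<in> ocells p" "1 \<le> p"
  shows "proper t" "leaves t = p + 1" "t \<noteq> Leaf" "e \<in> {1, - 1}"
  using assms by (auto simp: ocells_def)

lemma ext_deriv_Y:
  assumes w: "(e, t) \<in> ocells p" and p: "1 \<le> p"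
  shows "ext_deriv (Y (e, t) :: ('n::finite) form) = coboundary Y (e, t)"
proof (intro ext)
  fix \<theta> :: "'n point" and vs :: "'n homs list"
  note t = ocells_imp [OF w p]
  have "coboundary Y (e, t) \<theta> vs = frag_eval (\<lambda>u. Y (1, u) \<theta> vs) (frag_cmul e (bdry t))"
    by (simp add: coboundary_def obdry_def frag_eval_def)
  also have "\<dots> = of_int e *\<^sub>R frag_eval (\<lambda>u. Y (1, u) \<theta> vs) (bdry t)"
    by (rule frag_eval_cmul)
  also have "frag_eval (\<lambda>u. Y (1, u) \<theta> vs) (bdry t) = frag_eval (\<lambda>u. Y_tree u \<theta> vs) (bdry t)"
  proof (rule frag_eval_cong)
    fix u assume "u \<in> Poly_Mapping.keys (bdry t)"
    then have "proper u" "leaves u = p + 1"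
      using keys_bdry(1) [OF t(1)] t(2) by auto
    moreover from this p have "u \<noteq> Leaf" by auto
    ultimately show "Y (1, u) \<theta> vs = Y_tree u \<theta> vs"
      by (simp add: Y_eq)
  qed
  also have "of_int e *\<^sub>R frag_eval (\<lambda>u. Y_tree u \<theta> vs) (bdry t) = of_int e *\<^sub>R ext_deriv (Y_tree t) \<theta> vs"
    by (simp add: ext_deriv_Y_tree [OF t(1)])
  also have "\<dots> = ext_deriv (Y (e, t)) \<theta> vs"
    unfolding Y_eq [OF t(1,3,4)] scale_form_def ext_deriv_scaleR [OF Y_tree_poly_forms [OF t(1)]] ..
  finally show "ext_deriv (Y (e, t)) \<theta> vs = coboundary Y (e, t) \<theta> vs" ..
qed

section \<open>Invariance under automorphisms of the free group\<close>

lemma coeff_tens_map: "coeff (tens_map M f) w = (\<Sum>x | length x = length w.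
    (\<Prod>i<length w. M $ (w ! i) $ (x ! i)) * coeff f x)"
  by (simp add: tens_map_def)

lemma coeff_tens_map_Nil [simp]: "coeff (tens_map M f) [] = coeff f []"
  by (simp add: coeff_tens_map)

lemma tens_map_add: "tens_map M (f + g) = tens_map M f + tens_map M g"
  by (rule tens_eqI) (simp add: coeff_tens_map distrib_left sum.distrib)

lemma tens_map_scaleR: "tens_map M (c *\<^sub>R f) = c *\<^sub>R tens_map M f"
  by (rule tens_eqI) (simp add: coeff_tens_map sum_distrib_left mult.left_commute)

lemma linear_tens_map: "linear (tens_map M)"
  by (rule linearI) (auto simp: tens_map_add tens_map_scaleR)

lemmas tens_map_zero [simp] = linear_0 [OF linear_tens_map]
lemmas tens_map_diff = linear_diff [OF linear_tens_map]
lemmas tens_map_sum = linear_sum [OF linear_tens_map, unfolded o_def]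

lemma lquot_tens_map: "lquot j (tens_map M f) = (\<Sum>i\<in>UNIV. M $ j $ i *\<^sub>R tens_map M (lquot i f))"
proof (rule tens_eqI)
  fix w :: "'a list"
  let ?n = "length w"
  let ?X = "{x :: 'a list. length x = ?n}"
  have "coeff (lquot j (tens_map M f)) w = (\<Sum>x | length x = Suc ?n.
      (\<Prod>l<Suc ?n. M $ ((j # w) ! l) $ (x ! l)) * coeff f x)"
    by (simp add: coeff_tens_map)
  also have "\<dots> = (\<Sum>(i, x)\<in>UNIV \<times> ?X. (\<Prod>l<Suc ?n. M $ ((j # w) ! l) $ ((i # x) ! l)) * coeff f (i # x))"
    by (rule sum.reindex_bij_witness [of _ "\<lambda>(i, x). i # x" "\<lambda>x. (hd x, tl x)"])
      (auto simp: length_Suc_conv simp del: prod.lessThan_Suc)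
  also have "\<dots> = (\<Sum>i\<in>UNIV. \<Sum>x\<in>?X. M $ j $ i * ((\<Prod>l<?n. M $ (w ! l) $ (x ! l)) * coeff f (i # x)))"
    by (simp add: sum.cartesian_product prod.lessThan_Suc_shift mult.assoc del: prod.lessThan_Suc)
  also have "\<dots> = coeff (\<Sum>i\<in>UNIV. M $ j $ i *\<^sub>R tens_map M (lquot i f)) w"
    by (simp add: coeff_sum coeff_tens_map sum_distrib_left)
  finally show "coeff (lquot j (tens_map M f)) w = coeff (\<Sum>i\<in>UNIV. M $ j $ i *\<^sub>R tens_map M (lquot i f)) w" .
qed

lemma coeff_tens_map_Cons:
  "coeff (tens_map M f) (j # w) = (\<Sum>i\<in>UNIV. M $ j $ i * coeff (tens_map M (lquot i f)) w)"
  using arg_cong [OF lquot_tens_map [of j M f], of "\<lambda>g. coeff g w"] by (simp add: coeff_sum)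

text \<open>Induction along the first letter: \<open>lquot_tens_map\<close> expresses the left
  quotients of an image by images of left quotients, to which the induction hypothesis
  applies.\<close>

lemma tens_map_mult: "tens_map M (f * g) = tens_map M f * tens_map M g"
proof (rule tens_eqI)
  fix w show "coeff (tens_map M (f * g)) w = coeff (tens_map M f * tens_map M g) w"
  proof (induction w arbitrary: f g)
    case Nil
    show ?case by (simp add: coeff_mult)
  next
    case (Cons j w)
    have "coeff (tens_map M (f * g)) (j # w) =
        (\<Sum>i\<in>UNIV. M $ j $ i * coeff (tens_map M (lquot i f) * tens_map M g) w) +
        coeff f [] * coeff (tens_map M g) (j # w)"
      by (simp add: coeff_tens_map_Cons lquot_mult tens_map_add tens_map_scaleR Cons distrib_left sum.distrib
          sum_distrib_left mult.left_commute)
    also have "\<dots> = coeff (tens_map M f * tens_map M g) (j # w)"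
      by (simp add: coeff_mult_Cons lquot_tens_map sum_distrib_right coeff_sum)
    finally show ?case .
  qed
qed

lemma tens_map_one [simp]: "tens_map M 1 = 1"
proof (rule tens_eqI)
  fix w :: "'a list"
  have "lquot i 1 = (0 :: 'a tens)" for i
    by (rule tens_eqI) (simp add: coeff_one)
  then show "coeff (tens_map M 1) w = coeff 1 w"
    by (cases w) (simp_all add: coeff_tens_map_Cons coeff_one)
qed

lemma tens_map_tens_ge: "f \<in> tens_ge p \<Longrightarrow> tens_map M f \<in> tens_ge p"
  by (auto simp: tens_ge_def coeff_tens_map intro!: sum.neutral)

lemma tens_map_tens_part: "tens_map M (tens_part m f) = tens_part m (tens_map M f)"
  by (rule tens_eqI) (simp add: coeff_tens_map coeff_tens_part)

lemma tens_map_of_H: "tens_map M (of_H h) = of_H (M *v h)"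
proof (rule tens_eqI)
  fix w :: "'a list"
  have l: "lquot i (of_H h) = h $ i *\<^sub>R 1" for i and h :: "real ^ 'a"
    by (rule tens_eqI) (auto simp: coeff_of_H coeff_one split: list.splits)
  have "coeff (of_H (M *v h)) (j # v) = coeff (lquot j (of_H (M *v h))) v" for j v
    by simp
  then show "coeff (tens_map M (of_H h)) w = coeff (of_H (M *v h)) w"
    by (cases w) (simp_all add: coeff_tens_map_Cons l tens_map_scaleR coeff_of_H [of _ "[]"]
        matrix_vector_mult_def sum_distrib_right mult.assoc del: coeff_lquot)
qed

lemma lquot_ins_Suc: "lquot j (ins (Suc a) u b f) = ins a u b (lquot j f)"
  by (rule tens_eqI) (auto simp: coeff_ins Suc_diff_le)

lemma ins_0: "ins 0 u b f = (\<Sum>i\<in>UNIV. u $ i * tens_part b (lquot i f))"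
proof (rule tens_eqI)
  fix w :: "'a list"
  have "coeff (u $ i * tens_part b (lquot i f)) w =
      (if b \<le> length w then coeff (u $ i) (take (length w - b) w) * coeff f (i # drop (length w - b) w) else 0)" for i
  proof -
    have "coeff (u $ i * tens_part b (lquot i f)) w = (\<Sum>k\<le>length w. if k = length w - b then
      (if b \<le> length w then coeff (u $ i) (take (length w - b) w) * coeff f (i # drop (length w - b) w) else 0) else 0)"
      unfolding coeff_mult coeff_tens_part by (rule sum.cong) auto
    then show ?thesis by simp
  qed
  then show "coeff (ins 0 u b f) w = coeff (\<Sum>i\<in>UNIV. u $ i * tens_part b (lquot i f)) w"
    by (simp add: coeff_sum coeff_ins mult.commute)
qed

lemma coeff_ins_Suc_Nil: "coeff (ins (Suc a) u b f) [] = 0"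
  by (simp add: coeff_ins)

lemma matrix_inv_mult:
  fixes M :: "real ^ 'n ^ 'm"
  assumes "invertible M"
  shows "M ** matrix_inv M = mat 1 \<and> matrix_inv M ** M = mat 1"
  using assms unfolding invertible_def matrix_inv_def by (rule someI_ex)

context
  fixes M :: "real ^ 'n ^ 'n::finite"
  assumes M: "invertible M"
begin

text \<open>\<open>hom_act M u\<close> is \<open>u\<close> preceded by the inverse of
  \<open>M\<close> and followed by the diagonal action of \<open>M\<close>; composition with
  \<open>M\<close> at the source leaves only the latter.\<close>

lemma hom_act_cancel: "(\<Sum>j\<in>UNIV. M $ j $ i *\<^sub>R hom_act M u $ j) = tens_map M (u $ i)"
proof -
  have inv: "matrix_inv M ** M = mat 1"
    by (rule matrix_inv_mult [OF M, THEN conjunct2])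
  have "(\<Sum>j\<in>UNIV. M $ j $ i *\<^sub>R hom_act M u $ j) =
      (\<Sum>k\<in>UNIV. (\<Sum>j\<in>UNIV. matrix_inv M $ k $ j * M $ j $ i) *\<^sub>R tens_map M (u $ k))"
    unfolding hom_act_def by (simp add: scaleR_sum_right scaleR_sum_left mult.commute) (rule sum.swap)
  also have "\<dots> = (\<Sum>k\<in>UNIV. (matrix_inv M ** M) $ k $ i *\<^sub>R tens_map M (u $ k))"
    by (simp add: matrix_matrix_mult_def)
  also have "\<dots> = tens_map M (u $ i)"
    unfolding inv by (simp add: mat_def if_distribR if_distrib [of "\<lambda>c. c *\<^sub>R _"] cong: if_cong)
  finally show ?thesis .
qed

text \<open>Induction on the number of letters in front of the insertion. With none in front, the
  matrix acting on the replaced letter meets the inverse matrix contained in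
  \<open>hom_act\<close>.\<close>

lemma ins_hom_act: "ins a (hom_act M u) b (tens_map M f) = tens_map M (ins a u b f)"
proof (induction a arbitrary: f)
  case 0
  have "ins 0 (hom_act M u) b (tens_map M f) =
      (\<Sum>i\<in>UNIV. (\<Sum>j\<in>UNIV. M $ j $ i *\<^sub>R hom_act M u $ j) * tens_part b (tens_map M (lquot i f)))"
  proof -
    have "tens_part b (lquot j (tens_map M f)) = (\<Sum>i\<in>UNIV. M $ j $ i *\<^sub>R tens_part b (tens_map M (lquot i f)))" for j
      by (rule tens_eqI) (simp add: lquot_tens_map coeff_tens_part coeff_sum)
    then show ?thesis
      unfolding ins_0 by (simp add: sum_distrib_left sum_distrib_right) (rule sum.swap)
  qed
  also have "\<dots> = tens_map M (ins 0 u b f)"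
    unfolding hom_act_cancel by (simp add: ins_0 tens_map_sum tens_map_mult tens_map_tens_part)
  finally show ?case .
next
  case (Suc a)
  have lin: "ins a v b (\<Sum>i\<in>UNIV. c i *\<^sub>R g i) = (\<Sum>i\<in>UNIV. c i *\<^sub>R ins a v b (g i))"
    for v :: "'n homs" and c and g :: "'n \<Rightarrow> 'n tens"
  proof -
    have "linear (ins a v b)"
      by (rule linearI; rule tens_eqI) (simp_all add: coeff_ins_linear)
    then show ?thesis by (simp add: linear_sum linear_cmul o_def)
  qed
  have "lquot j (ins (Suc a) (hom_act M u) b (tens_map M f)) = lquot j (tens_map M (ins (Suc a) u b f))" for j
    by (simp add: lquot_ins_Suc lquot_tens_map lin Suc)
  then have "coeff (ins (Suc a) (hom_act M u) b (tens_map M f)) (j # w) = coeff (tens_map M (ins (Suc a) u b f)) (j # w)" for j w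
    by (metis coeff_lquot)
  moreover have "coeff (ins (Suc a) (hom_act M u) b (tens_map M f)) [] = coeff (tens_map M (ins (Suc a) u b f)) []"
    by (simp add: coeff_ins_Suc_Nil)
  ultimately show ?case
    by (intro tens_eqI) (metis list.exhaust)
qed

lemma der_hom_act: "der (hom_act M u) (tens_map M f) = tens_map M (der u f)"
proof (rule tens_eqI)
  fix w :: "'n list"
  let ?P = "\<lambda>x. \<Prod>i<length w. M $ (w ! i) $ (x ! i)"
  have "coeff (tens_map M (der u f)) w =
      (\<Sum>x | length x = length w. \<Sum>a\<le>length w. \<Sum>b\<le>length w - a. ?P x * coeff (ins a u b f) x)"
    by (simp add: coeff_tens_map coeff_der sum_distrib_left)
  also have "\<dots> = (\<Sum>a\<le>length w. \<Sum>x | length x = length w. \<Sum>b\<le>length w - a. ?P x * coeff (ins a u b f) x)"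
    by (rule sum.swap)
  also have "\<dots> = (\<Sum>a\<le>length w. \<Sum>b\<le>length w - a. \<Sum>x | length x = length w. ?P x * coeff (ins a u b f) x)"
    by (intro sum.cong refl sum.swap)
  also have "\<dots> = coeff (der (hom_act M u) (tens_map M f)) w"
    by (simp add: coeff_der ins_hom_act) (simp add: coeff_tens_map)
  finally show "coeff (der (hom_act M u) (tens_map M f)) w = coeff (tens_map M (der u f)) w" ..
qed

lemma hom_act_insert_hom: "hom_act M (insert_hom a u b z) = insert_hom a (hom_act M u) b (hom_act M z)"
proof -
  have "linear (ins a (hom_act M u) b)"
    by (rule linearI; rule tens_eqI) (simp_all add: coeff_ins_linear)
  then have "ins a (hom_act M u) b (\<Sum>i\<in>UNIV. c i *\<^sub>R g i) = (\<Sum>i\<in>UNIV. c i *\<^sub>R ins a (hom_act M u) b (g i))"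
    for c and g :: "'n \<Rightarrow> 'n tens"
    by (simp add: linear_sum linear_cmul o_def)
  then show ?thesis
    by (simp add: vec_eq_iff hom_act_def [of M z] hom_act_def [of M "insert_hom a u b z"] insert_hom_nth ins_hom_act)
qed

lemma hom_act_unit: "hom_act M (\<chi> i. monomial [i]) = (\<chi> i. monomial [i])"
proof -
  have inv: "M ** matrix_inv M = mat 1"
    by (rule matrix_inv_mult [OF M, THEN conjunct1])
  have "tens_map M (monomial [i]) = (\<Sum>k\<in>UNIV. M $ k $ i *\<^sub>R monomial [k])" for i
    using tens_map_of_H [of M "axis i 1"]
    by (simp add: of_H_axis) (simp add: of_H_def matrix_vector_mult_basis column_def)
  then have "hom_act M (\<chi> i. monomial [i]) $ j = (\<Sum>k\<in>UNIV. (M ** matrix_inv M) $ k $ j *\<^sub>R monomial [k])" for j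
    unfolding hom_act_def matrix_matrix_mult_def
    by (simp add: scaleR_sum_right scaleR_sum_left mult.commute) (rule sum.swap)
  then show ?thesis
    unfolding inv vec_eq_iff
    by (simp add: mat_def if_distribR if_distrib [of "\<lambda>c. c *\<^sub>R _"] cong: if_cong)
qed

end

lemma linear_hom_act: "linear (hom_act M)"
  by (rule linearI) (simp_all add: hom_act_def vec_eq_iff tens_map_add tens_map_scaleR
      scaleR_add_right sum.distrib scaleR_sum_right mult.commute)

lemmas hom_act_sum = linear_sum [OF linear_hom_act, unfolded o_def]
lemmas hom_act_scaleR = linear_cmul [OF linear_hom_act]

lemma hom_part_hom_act: "hom_part m (hom_act M u) = hom_act M (hom_part m u)"
  by (auto simp: vec_eq_iff hom_part_def hom_act_def tens_map_tens_part coeff_tens_part coeff_sum intro!: tens_eqI)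

lemma TTheta_hom_act: "u \<in> TTheta \<Longrightarrow> hom_act M u \<in> TTheta"
  by (auto simp: TTheta_def hom_act_def intro!: tens_ge_sum tens_ge_scaleR tens_map_tens_ge)

section \<open>Automorphisms acting on Magnus expansions\<close>

lemma H_class_mult: "H_class (g \<otimes>\<^bsub>free_grp\<^esub> h) = H_class g + H_class h"
  by (simp add: mult_free_grp H_class_reduce H_class_append)

lemma H_class_endomorphism:
  assumes \<alpha>: "\<alpha> \<in> hom free_grp free_grp"
  shows "g \<in> carrier free_grp \<Longrightarrow> H_class (\<alpha> g) = H_matrix \<alpha> *v H_class g"
proof (induction g)
  have mult: "H_class (\<alpha> (g \<otimes>\<^bsub>free_grp\<^esub> h)) = H_class (\<alpha> g) + H_class (\<alpha> h)"
    if "g \<in> carrier free_grp" "h \<in> carrier free_grp" for g h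
    using \<alpha> that by (simp add: hom_def H_class_mult)
  have Nil: "H_class (\<alpha> []) = 0"
    using mult [of "[]" "[]"] by (simp add: mult_free_grp)
  {
    case Nil
    show ?case by (simp add: \<open>H_class (\<alpha> []) = 0\<close>)
  next
    case (Cons x g)
    have gen: "H_class (\<alpha> (gen i)) = H_matrix \<alpha> *v axis i 1" for i
      by (simp add: matrix_vector_mult_basis column_def H_matrix_def vec_eq_iff)
    have "H_class (\<alpha> [x]) = H_matrix \<alpha> *v ((if snd x then 1 else - 1) *\<^sub>R axis (fst x) 1)"
    proof (cases "snd x")
      case True
      then show ?thesis using gen [of "fst x"] by (cases x) simp
    next
      case False
      have "H_class (\<alpha> [(fst x, False)]) + H_class (\<alpha> (gen (fst x))) = 0"
        using mult [of "[(fst x, False)]" "gen (fst x)"] letter_mult_inverse [of "fst x" False] Nil by simp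
      then have "H_class (\<alpha> [(fst x, False)]) = - (H_matrix \<alpha> *v axis (fst x) 1)"
        by (simp add: gen eq_neg_iff_add_eq_0)
      then show ?thesis
        using False by (cases x) (simp add: vec.neg)
    qed
    moreover have "H_class (\<alpha> (x # g)) = H_class (\<alpha> [x]) + H_class (\<alpha> g)"
      using mult [of "[x]" g] Cons_eq_mult [OF Cons.prems] Cons_in_free_grpD [OF Cons.prems] by simp
    ultimately show ?case
      using Cons.IH Cons_in_free_grpD [OF Cons.prems] by (simp add: H_class_Cons matrix_vector_right_distrib)
  }
qed

text \<open>Extends the equation defining \<open>mc\<close> from the generators to the whole group,
  as needed for the values of \<open>\<theta>\<close> at inverse images of generators. Both sides
  satisfy the Leibniz rule; at an inverse letter, the rule applied to a product equal to
  \<open>1\<close> determines the derivative.\<close>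

lemma deriv_tens_value:
  assumes \<theta>: "\<theta> \<in> Theta" and v: "v \<in> TTheta"
  shows "g \<in> carrier free_grp \<Longrightarrow> deriv_tens v (\<lambda>\<theta>. \<theta> g) \<theta> = der (mc \<theta> v) (\<theta> g)"
proof (induction g)
  have mult: "deriv_tens v (\<lambda>\<theta>. \<theta> (g \<otimes>\<^bsub>free_grp\<^esub> h)) \<theta> =
      deriv_tens v (\<lambda>\<theta>. \<theta> g) \<theta> * \<theta> h + \<theta> g * deriv_tens v (\<lambda>\<theta>. \<theta> h) \<theta>"
    if "g \<in> carrier free_grp" "h \<in> carrier free_grp" for g h
  proof -
    have "deriv_tens v (\<lambda>\<theta>. \<theta> (g \<otimes>\<^bsub>free_grp\<^esub> h)) \<theta> = deriv_tens v (\<lambda>\<theta>. \<theta> g * \<theta> h) \<theta>"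
      by (rule deriv_tens_cong [OF v \<theta>]) (simp add: Theta_mult that)
    then show ?thesis
      by (simp add: deriv_tens_mult [OF v \<theta>] poly_tens_value that)
  qed
  have nil: "deriv_tens v (\<lambda>\<theta>. \<theta> []) \<theta> = 0"
    using deriv_tens_cong [OF v \<theta>, of "\<lambda>\<theta>. \<theta> []" "\<lambda>\<theta>. 1"] deriv_tens_const [OF v \<theta>, of 1] by simp
  {
    case Nil
    show ?case using nil \<theta> by simp
  next
    case (Cons x g)
    have gen: "deriv_tens v (\<lambda>\<theta>. \<theta> (gen i)) \<theta> = der (mc \<theta> v) (\<theta> (gen i))" for i
      by (simp add: deriv_tens_gen [OF v \<theta>] der_mc \<theta> v)
    have "deriv_tens v (\<lambda>\<theta>. \<theta> [x]) \<theta> = der (mc \<theta> v) (\<theta> [x])"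
    proof (cases "snd x")
      case True
      then show ?thesis using gen [of "fst x"] by (cases x) simp
    next
      case False
      let ?f = "\<theta> [(fst x, False)]" and ?g = "\<theta> (gen (fst x))"
      have fg: "?f * ?g = 1"
        using Theta_mult [OF \<theta>, of "[(fst x, False)]" "gen (fst x)"] letter_mult_inverse [of "fst x" False] \<theta>
        by simp
      have gf: "?g * ?f = 1"
        using Theta_mult [OF \<theta>, of "gen (fst x)" "[(fst x, False)]"] letter_mult_inverse [of "fst x" True] \<theta>
        by simp
      let ?d = "deriv_tens v (\<lambda>\<theta>. \<theta> [(fst x, False)]) \<theta>"
      have "?d * ?g + ?f * der (mc \<theta> v) ?g = 0"
        using mult [of "[(fst x, False)]" "gen (fst x)"] letter_mult_inverse [of "fst x" False] nil gen by simp
      moreover have "der (mc \<theta> v) ?f * ?g + ?f * der (mc \<theta> v) ?g = 0"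
        using der_mult [of "mc \<theta> v" ?f ?g] fg by simp
      ultimately have "?d * ?g = der (mc \<theta> v) ?f * ?g"
        by (metis add_right_cancel)
      then have "?d * (?g * ?f) = der (mc \<theta> v) ?f * (?g * ?f)"
        by (metis mult.assoc)
      then show ?thesis
        using False gf by (cases x) simp
    qed
    moreover have "g \<in> carrier free_grp"
      using Cons_in_free_grpD [OF Cons.prems] .
    ultimately show ?case
      using mult [of "[x]" g] Cons.IH Theta_mult [OF \<theta>, of "[x]" g] unfolding Cons_eq_mult [OF Cons.prems]
      by (simp add: der_mult)
  }
qed

context
  fixes \<phi> :: "('n::finite) fword \<Rightarrow> 'n fword"
  assumes \<phi>: "\<phi> \<in> auto free_grp"
begin

lemma auto_hom: "\<phi> \<in> hom free_grp free_grp"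
  using \<phi> by (simp add: auto_def)

lemma auto_bij: "bij_betw \<phi> (carrier free_grp) (carrier free_grp)"
  using \<phi> by (simp add: auto_def Bij_def)

lemma auto_inverse:
  assumes "g \<in> carrier free_grp"
  shows "inv_into (carrier free_grp) \<phi> g \<in> carrier free_grp"
    and "\<phi> (inv_into (carrier free_grp) \<phi> g) = g"
  using assms auto_bij by (auto simp: bij_betw_def inv_into_into f_inv_into_f)

lemma inverse_hom: "inv_into (carrier free_grp) \<phi> \<in> hom free_grp free_grp"
proof -
  let ?\<psi> = "inv_into (carrier free_grp) \<phi>"
  have "?\<psi> (g \<otimes>\<^bsub>free_grp\<^esub> h) = ?\<psi> g \<otimes>\<^bsub>free_grp\<^esub> ?\<psi> h"
    if "g \<in> carrier free_grp" "h \<in> carrier free_grp" for g h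
  proof (rule inv_into_f_eq)
    show "inj_on \<phi> (carrier free_grp)"
      using auto_bij by (simp add: bij_betw_def)
    show "?\<psi> g \<otimes>\<^bsub>free_grp\<^esub> ?\<psi> h \<in> carrier free_grp"
      by (simp add: mult_free_grp)
    show "\<phi> (?\<psi> g \<otimes>\<^bsub>free_grp\<^esub> ?\<psi> h) = g \<otimes>\<^bsub>free_grp\<^esub> h"
      using auto_hom auto_inverse that by (simp add: hom_def)
  qed
  then show ?thesis
    using auto_inverse(1) by (auto simp: hom_def)
qed

lemma H_class_inverse: "g \<in> carrier free_grp \<Longrightarrow>
    H_matrix \<phi> *v H_class (inv_into (carrier free_grp) \<phi> g) = H_class g"
  using H_class_endomorphism [OF auto_hom auto_inverse(1), of g] auto_inverse(2) [of g] by simp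

text \<open>The matrix of the inverse automorphism is a right inverse, as is seen on basis vectors;
  for square matrices this suffices.\<close>

lemma invertible_H_matrix: "invertible (H_matrix \<phi>)"
proof -
  let ?\<psi> = "inv_into (carrier free_grp) \<phi>"
  have "(H_matrix \<phi> ** H_matrix ?\<psi>) *v axis i 1 = axis i 1" for i
  proof -
    have "H_matrix ?\<psi> *v axis i 1 = H_class (?\<psi> (gen i))"
      by (simp add: matrix_vector_mult_basis column_def H_matrix_def vec_eq_iff)
    then show ?thesis
      using H_class_inverse [of "gen i"] by (simp add: H_class_Cons flip: matrix_vector_mul_assoc)
  qed
  then have "column i (H_matrix \<phi> ** H_matrix ?\<psi>) $ r = (axis i 1 :: real ^ 'n) $ r" for i r
    by (simp only: matrix_vector_mult_basis)
  then have "H_matrix \<phi> ** H_matrix ?\<psi> = mat 1"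
    by (simp only: vec_eq_iff column_def vec_lambda_beta) (simp add: mat_def axis_def)
  then show ?thesis
    using invertible_right_inverse by blast
qed

lemma Theta_act_in_Theta:
  assumes \<theta>: "\<theta> \<in> Theta"
  shows "Theta_act \<phi> \<theta> \<in> Theta"
proof -
  let ?\<psi> = "inv_into (carrier free_grp) \<phi>"
  have eq: "Theta_act \<phi> \<theta> g - (1 + of_H (H_class g)) = tens_map (H_matrix \<phi>) (\<theta> (?\<psi> g) - (1 + of_H (H_class (?\<psi> g))))"
    if "g \<in> carrier free_grp" for g
    using that by (simp add: Theta_act_def tens_map_diff tens_map_add tens_map_of_H H_class_inverse)
  have cong: "Theta_act \<phi> \<theta> g - (1 + of_H (H_class g)) \<in> tens_ge 2" if "g \<in> carrier free_grp" for g
    unfolding eq [OF that] by (intro tens_map_tens_ge Theta_congruence \<theta> auto_inverse that)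
  moreover have "Theta_act \<phi> \<theta> (g \<otimes>\<^bsub>free_grp\<^esub> h) = Theta_act \<phi> \<theta> g * Theta_act \<phi> \<theta> h"
    if "g \<in> carrier free_grp" "h \<in> carrier free_grp" for g h
    using that inverse_hom auto_inverse
    by (simp add: Theta_act_def hom_def Theta_mult [OF \<theta>] tens_map_mult) (simp add: mult_free_grp)
  moreover have "Theta_act \<phi> \<theta> g - 1 \<in> tens_ge 1" if "g \<in> carrier free_grp" for g
    by (rule gen_minus_one [OF cong [OF that]])
  ultimately show ?thesis
    by (auto simp: Theta_def hom_def one_plus_tens_def) (simp add: Theta_act_def)
qed

text \<open>By \<open>deriv_tens_value\<close> the velocity of the transported curve is
  \<open>der (mc \<theta> v)\<close> carried along by the matrix. In this form it shows that
  \<open>hom_act\<close> of \<open>mc \<theta> v\<close> solves the equation defining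
  \<open>mc\<close> at the new point, which yields the equivariance of \<open>eta\<close>.\<close>

lemma Theta_act_deriv_nth:
  assumes \<theta>: "\<theta> \<in> Theta" and v: "v \<in> TTheta"
  shows "Theta_act_deriv \<phi> \<theta> v $ i = der (hom_act (H_matrix \<phi>) (mc \<theta> v)) (Theta_act \<phi> \<theta> (gen i))"
proof -
  let ?\<psi> = "inv_into (carrier free_grp) \<phi>" and ?M = "H_matrix \<phi>"
  define v' where "v' = (\<chi> i. der (hom_act ?M (mc \<theta> v)) (Theta_act \<phi> \<theta> (gen i)))"
  have d: "((\<lambda>t. coeff (Theta_act \<phi> (displace \<theta> (t *\<^sub>R v)) (gen i)) w) has_real_derivative coeff (v' $ i) w) (at 0)" for i w
  proof -
    let ?g = "?\<psi> (gen i)"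
    have g: "?g \<in> carrier free_grp" by (simp add: auto_inverse)
    have "((\<lambda>t. \<Sum>x | length x = length w. (\<Prod>l<length w. ?M $ (w ! l) $ (x ! l)) * coeff (displace \<theta> (t *\<^sub>R v) ?g) x)
        has_real_derivative (\<Sum>x | length x = length w. (\<Prod>l<length w. ?M $ (w ! l) $ (x ! l)) *
          dir_deriv v (\<lambda>\<theta>. coeff (\<theta> ?g) x) \<theta>)) (at 0)"
      by (intro DERIV_sum DERIV_cmult has_dir_deriv poly_tensD poly_tens_value g v \<theta>)
    also have "(\<Sum>x | length x = length w. (\<Prod>l<length w. ?M $ (w ! l) $ (x ! l)) *
          dir_deriv v (\<lambda>\<theta>. coeff (\<theta> ?g) x) \<theta>) = coeff (tens_map ?M (der (mc \<theta> v) (\<theta> ?g))) w"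
      unfolding deriv_tens_value [OF \<theta> v g, symmetric] coeff_tens_map coeff_deriv_tens ..
    also have "tens_map ?M (der (mc \<theta> v) (\<theta> ?g)) = v' $ i"
      by (simp add: v'_def Theta_act_def der_hom_act [OF invertible_H_matrix])
    finally show ?thesis
      by (simp add: Theta_act_def coeff_tens_map)
  qed
  have "Theta_act_deriv \<phi> \<theta> v = v'"
    unfolding Theta_act_deriv_def
  proof (rule the_equality)
    show "velocity (\<lambda>t. Theta_act \<phi> (displace \<theta> (t *\<^sub>R v))) v'"
      using d by (simp add: velocity_def)
    show "v'' = v'" if "velocity (\<lambda>t. Theta_act \<phi> (displace \<theta> (t *\<^sub>R v))) v''" for v''
      using that DERIV_unique [OF d] by (auto simp: velocity_def vec_eq_iff intro!: tens_eqI) metis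
  qed
  then show ?thesis by (simp add: v'_def)
qed

lemma Theta_act_deriv_TTheta:
  assumes \<theta>: "\<theta> \<in> Theta" and v: "v \<in> TTheta"
  shows "Theta_act_deriv \<phi> \<theta> v \<in> TTheta"
proof -
  have "der (hom_act (H_matrix \<phi>) (mc \<theta> v)) (Theta_act \<phi> \<theta> (gen i)) \<in> tens_ge 2" for i
  proof -
    have "Theta_act \<phi> \<theta> (gen i) - 1 \<in> tens_ge 1"
      by (rule gen_minus_one [OF Theta_gen [OF Theta_act_in_Theta [OF \<theta>]]])
    then have "der (hom_act (H_matrix \<phi>) (mc \<theta> v)) (Theta_act \<phi> \<theta> (gen i) - 1) \<in> tens_ge 2"
      using der_in_derivations [OF TTheta_hom_act [OF mc_TTheta [OF \<theta> v]]] unfolding derivations_def by blast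
    then show ?thesis by (simp add: der_diff)
  qed
  then show ?thesis
    by (simp add: TTheta_def Theta_act_deriv_nth [OF \<theta> v])
qed

lemma eta_equivariant:
  assumes \<theta>: "\<theta> \<in> Theta" and v: "v \<in> TTheta"
  shows "eta p (Theta_act \<phi> \<theta>) [Theta_act_deriv \<phi> \<theta> v] = hom_act (H_matrix \<phi>) (eta p \<theta> [v])"
proof -
  have "mc (Theta_act \<phi> \<theta>) (Theta_act_deriv \<phi> \<theta> v) = hom_act (H_matrix \<phi>) (mc \<theta> v)"
    by (rule mc_eqI) (simp_all add: Theta_act_in_Theta Theta_act_deriv_TTheta Theta_act_deriv_nth \<theta> v)
  then show ?thesis
    by (simp add: eta_nth Theta_act_in_Theta Theta_act_deriv_TTheta \<theta> v hom_part_hom_act)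
qed

end

text \<open>The invariance clause of \<open>inv_forms\<close> by itself, so that it can be carried
  through the grafting induction separately from membership in \<open>forms\<close>.\<close>

definition equivariant :: "nat \<Rightarrow> ('n::finite) form \<Rightarrow> bool"
  where "equivariant k \<omega> \<longleftrightarrow> (\<forall>\<phi>\<in>auto free_grp. \<forall>\<theta>\<in>Theta. \<forall>vs. length vs = k \<and> set vs \<subseteq> TTheta \<longrightarrow>
    \<omega> (Theta_act \<phi> \<theta>) (map (Theta_act_deriv \<phi> \<theta>) vs) = hom_act (H_matrix \<phi>) (\<omega> \<theta> vs))"

lemma equivariant_unit_form: "equivariant 0 unit_form"
  by (simp add: equivariant_def unit_form_def Theta_act_in_Theta hom_act_unit invertible_H_matrix)

lemma equivariant_scale_form: "equivariant k \<omega> \<Longrightarrow> equivariant k (scale_form c \<omega>)"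
  by (simp add: equivariant_def scale_form_def hom_act_scaleR)

lemma omit_map: "omit i (map f xs) = map f (omit i xs)"
  by (simp add: omit_def take_map drop_map)

lemma equivariant_wedge_insert_eta:
  fixes \<omega> :: "('n::finite) form"
  assumes "equivariant k \<omega>"
  shows "equivariant (Suc k) (wedge_insert a (eta q) b \<omega>)"
  unfolding equivariant_def
proof (intro ballI allI impI, elim conjE)
  fix \<phi> :: "'n fword \<Rightarrow> 'n fword" and \<theta> :: "'n point" and vs :: "'n homs list"
  assume \<phi>: "\<phi> \<in> auto free_grp" and \<theta>: "\<theta> \<in> Theta" and vs: "length vs = Suc k" "set vs \<subseteq> TTheta"
  let ?d = "Theta_act_deriv \<phi> \<theta>" and ?M = "H_matrix \<phi>"
  have "insert_hom a (eta q (Theta_act \<phi> \<theta>) [map ?d vs ! i]) b (\<omega> (Theta_act \<phi> \<theta>) (omit i (map ?d vs))) =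
      hom_act ?M (insert_hom a (eta q \<theta> [vs ! i]) b (\<omega> \<theta> (omit i vs)))" if i: "i < length vs" for i
  proof -
    have "\<omega> (Theta_act \<phi> \<theta>) (map ?d (omit i vs)) = hom_act ?M (\<omega> \<theta> (omit i vs))"
      using assms \<phi> \<theta> vs i set_omit [of i vs] unfolding equivariant_def by (simp add: length_omit)
    then show ?thesis
      using i vs by (simp add: omit_map eta_equivariant [OF \<phi> \<theta>] subset_iff hom_act_insert_hom [OF invertible_H_matrix [OF \<phi>]])
  qed
  then show "wedge_insert a (eta q) b \<omega> (Theta_act \<phi> \<theta>) (map ?d vs) = hom_act ?M (wedge_insert a (eta q) b \<omega> \<theta> vs)"
    by (simp add: wedge_insert_def hom_act_sum hom_act_scaleR del: sum.lessThan_Suc)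
qed

lemma equivariant_Y_tree: "proper t \<Longrightarrow> equivariant (pdeg t) (Y_tree t)"
proof (induction t rule: proper_graft_induct)
  case Leaf
  then show ?case by (simp add: Y_tree_def equivariant_unit_form)
next
  case (graft a q t)
  then show ?case
    by (simp add: Y_tree_graft pdeg_graft graft_form_def equivariant_scale_form equivariant_wedge_insert_eta)
qed

lemma Y_inv_forms:
  assumes "proper t" "t \<noteq> Leaf" "e \<in> {1, - 1}"
  shows "(Y (e, t) :: ('n::finite) form) \<in> inv_forms (pdeg t) (leaves t)"
proof -
  have "(Y (e, t) :: 'n form) \<in> poly_forms (pdeg t) (leaves t)"
    unfolding Y_eq [OF assms] scale_form_def by (rule poly_forms_scaleR [OF Y_tree_poly_forms [OF assms(1)]])
  then have "(Y (e, t) :: 'n form) \<in> forms (pdeg t) (leaves t)"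
    by (rule subsetD [OF poly_forms_subset_forms])
  moreover have "equivariant (pdeg t) (Y (e, t) :: 'n form)"
    unfolding Y_eq [OF assms] by (rule equivariant_scale_form [OF equivariant_Y_tree [OF assms(1)]])
  ultimately show ?thesis
    by (simp add: inv_forms_def equivariant_def)
qed

theorem proposition3p1:
  fixes p :: nat
  assumes "2 \<le> CARD('n::finite)" and "1 \<le> p"
  shows "(\<forall>w\<in>ocells p. ext_deriv (Y w :: 'n form) = coboundary Y w) \<and>
         (Y :: ocell \<Rightarrow> 'n form) \<in> total_cochains p p"
proof
  show "\<forall>w\<in>ocells p. ext_deriv (Y w :: 'n form) = coboundary Y w"
    using ext_deriv_Y [OF _ assms(2)] by auto
  show "(Y :: ocell \<Rightarrow> 'n form) \<in> total_cochains p p"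
    unfolding total_cochains_def mem_Collect_eq
  proof clarify
    fix e t assume "(e, t) \<in> ocells p"
    note t = ocells_imp [OF this assms(2)]
    \<comment> \<open>Identifies the form degree \<open>p - pdim t\<close> asked for by
      \<open>total_cochains\<close> with the number of nodes, which is the degree of the form that
      \<open>Y\<close> attaches to the cell.\<close>
    have "pdim t + pdeg t = p"
      using proper_dims(1) [OF t(1)] t(2) by simp
    then have dims: "pdim t \<le> p" "p - pdim t = pdeg t" by auto
    have e: "- e \<in> {1, - 1}" using t(4) by auto
    have "Y (- e, t) = (\<lambda>\<theta> vs. - (Y (e, t) :: 'n form) \<theta> vs)"
      by (simp add: Y_eq [OF t(1,3,4)] Y_eq [OF t(1,3) e] scale_form_def)
    then show "Y (- e, t) = (\<lambda>\<theta> vs. - (Y (e, t) :: 'n form) \<theta> vs) \<and>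
        (if pdim t \<le> p then (Y (e, t) :: 'n form) \<in> inv_forms (p - pdim t) (p + 1) else Y (e, t) = (\<lambda>\<theta> vs. 0 :: 'n homs))"
      using Y_inv_forms [OF t(1,3,4)] dims t(2) by simp
  qed
qed

end
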